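(* Let $a<b$ and let $V_1,V_2:[0,1]\to\mathbb{R}$ be functions that belong to $C^2((0,1))$ and are continuous at $0$ and $1$. (1) Assume that the functions on $(0,1)$ $$W_1(p):=V_1(p)-\log(p(1-p)),\qquad W_2(p):=V_2(p)-\log(p(1-p))$$ each have a unique minimizer $p_1^*\in(0,1)$ and $p_2^*\in(0,1)$, respectively. For each $n$ let $m^{(n)}=(m_1^{(n)},\dots,m_n^{(n)})$ be drawn from the probability measure $\mathbb{P}_{n,[a,b],V_{1,2}}$ on $\mathcal{M}_n([a,b])$ (defined in the context), all random variables $m_j^{(n)}$ being defined on the same probability space, and put $q_i^*:=1-p_i^*$, $i=1,2$. Then for each $k\ge 1$, as $n\to\infty$, $$(m_1^{(n)},\dots,m_k^{(n)})\to(m_1^*,\dots,m_k^* )$$ almost surely and in $L^1$, where $m_1^*,\dots,m_k^*$ are the first $k$ moments of the probability measure $\mu_{p_1^*,p_2^*}=\mu^{ac}_{p_1^*,p_2^*}+\mu^{d}_{p_1^*,p_2^*}$ given, with $$l_\pm:=a+(b-a)\left(\sqrt{p_1^*q_2^*}\pm\sqrt{p_2^*q_1^*}\right)^2,$$ by $$\mu^{ac}_{p_1^*,p_2^*}(dx)=\frac{\sqrt{(x-l_-)(l_+-x)}}{2\pi p_2^*(x-a)(b-x)}\,1_{[l_-,l_+]}(x)\,dx,$$ $$\mu^{d}_{p_1^*,p_2^*}=\left(1-\frac{p_1^*}{p_2^*}\right)_+\delta_a+\left(\frac{p_1^*+p_2^*-1}{p_2^*}\right)_+\delta_b .$$ (2)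 If $p_1^*,p_2^*$ are such that $\mu_{p_1^*,p_2^*}$ does not have atoms, then $\mu_{p_1^*,p_2^*}$ is the equilibrium measure on $[a,b]$ to the external field $$Q(t):=-\left(\frac{p_1^*}{p_2^*}-1\right)\log(t-a)-\left(\frac{1-p_1^*-p_2^*}{p_2^*}\right)\log(b-t),$$ i.e. $\mu_{p_1^*,p_2^*}$ is the unique Borel probability measure on $[a,b]$ minimizing the functional $$\mu\mapsto\int_a^b Q(t)\,d\mu(t)-\int_a^b\int_a^b\log|t-s|\,d\mu(t)\,d\mu(s).$$
   Context: Notation: $(y)_+=\max(y,0)$; $\delta_y$ is the Dirac measure at $y$; $\lfloor x\rfloor$ is the largest integer not exceeding $x$. In part (2), $Q$ is regarded as a function $[a,b]\to\mathbb{R}\cup\{+\infty\}$ (with $0\cdot\log 0=0$). Moment space: let $\mathcal{P}([a,b])$ be the set of Borel probability measures on $[a,b]$, $m_j(\mu)=\int x^j\,d\mu(x)$, and $\mathcal{M}_n([a,b])=\{(m_1(\mu),\dots,m_n(\mu)):\mu\in\mathcal{P}([a,b])\}\subset\mathbb{R}^n$, with interior $\mathrm{Int}(\mathcal{M}_n([a,b]))$ and boundary $\partial\mathcal{M}_n([a,b])$. Canonical moments: for $(m_1,\dots,m_n)\in\mathrm{Int}(\mathcal{M}_n([a,b]))$ and $1\le j\le n$, the set $\{m_j(\mu):\mu\in\mathcal{P}([a,b]),\ m_i(\mu)=m_i\text{ for }i=1,\dots,j-1\}$ is a compact interval $[m_j^-,m_j^+]$ with $m_j^-<m_j^+$; the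 $j$-th canonical moment is $p_j:=\frac{m_j-m_j^-}{m_j^+-m_j^-}$. It depends only on $m_1,\dots,m_j$, and $(p_1,\dots,p_n)\mapsto(m_1,\dots,m_n)$ is a bijection from $(0,1)^n$ onto $\mathrm{Int}(\mathcal{M}_n([a,b]))$. The measure $\mathbb{P}_{n,[a,b],V_{1,2}}$: for continuous $V_1,V_2:[0,1]\to\mathbb{R}$ this is the probability measure on $\mathcal{M}_n([a,b])$ with $\mathbb{P}_{n,[a,b],V_{1,2}}(\partial\mathcal{M}_n([a,b]))=0$ and, on $\mathrm{Int}(\mathcal{M}_n([a,b]))$, density with respect to $n$-dimensional Lebesgue measure $$\frac{1}{Z_{n,[a,b],V_{1,2}}}\exp\Big[-n\sum_{j=1}^{\lfloor\frac{n+1}{2}\rfloor}V_1(p_{2j-1})-n\sum_{j=1}^{\lfloor\frac n2\rfloor}V_2(p_{2j})\Big],$$ where $p_j=p_j(m_1,\dots,m_j)$ are the canonical moments of $(m_1,\dots,m_n)$ and $Z_{n,[a,b],V_{1,2}}$ is the normalization constant. *)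

theory Defs
  imports "HOL-Probability.Probability"
begin

section \<open>Moment space and canonical moments\<close>

text \<open>The Borel probability measures on \<open>[a,b]\<close>. The underlying space of such a measure
  is \<open>[a,b]\<close> itself, so that equality of measures is the expected one.\<close>

definition borel_prob_on :: "real \<Rightarrow> real \<Rightarrow> real measure set" where
  "borel_prob_on a b =
     {\<mu>. prob_space \<mu> \<and> sets \<mu> = sets (restrict_space borel {a..b})}"

definition moment :: "nat \<Rightarrow> real measure \<Rightarrow> real" where
  "moment j \<mu> = (\<integral>x. x ^ j \<partial>\<mu>)"

text \<open>\<open>\<real>\<^sup>n\<close> is the set of extensional functions on \<open>{1..n}\<close>, with the product
  topology and the product of the one-dimensional Lebesgue measures.\<close>

abbreviation Rn_top :: "nat \<Rightarrow> (nat \<Rightarrow> real) topology" where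
  "Rn_top n \<equiv> product_topology (\<lambda>_. euclideanreal) {1..n}"

abbreviation Rn_leb :: "nat \<Rightarrow> (nat \<Rightarrow> real) measure" where
  "Rn_leb n \<equiv> Pi\<^sub>M {1..n} (\<lambda>_. lborel)"

definition moment_space :: "nat \<Rightarrow> real \<Rightarrow> real \<Rightarrow> (nat \<Rightarrow> real) set" where
  "moment_space n a b =
     {(\<lambda>j\<in>{1..n}. moment j \<mu>) | \<mu>. \<mu> \<in> borel_prob_on a b}"

definition admissible_moments :: "real \<Rightarrow> real \<Rightarrow> nat \<Rightarrow> (nat \<Rightarrow> real) \<Rightarrow> real set" where
  "admissible_moments a b j m =
     {moment j \<mu> | \<mu>. \<mu> \<in> borel_prob_on a b \<and> (\<forall>i\<in>{1..<j}. moment i \<mu> = m i)}"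

definition canonical_moment :: "real \<Rightarrow> real \<Rightarrow> nat \<Rightarrow> (nat \<Rightarrow> real) \<Rightarrow> real" where
  "canonical_moment a b j m =
     (m j - Inf (admissible_moments a b j m)) /
     (Sup (admissible_moments a b j m) - Inf (admissible_moments a b j m))"

section \<open>The random moment vectors\<close>

text \<open>The unnormalized density vanishes off the interior of the moment space, so the
  boundary is a null set.\<close>

definition moment_weight ::
  "nat \<Rightarrow> real \<Rightarrow> real \<Rightarrow> (real \<Rightarrow> real) \<Rightarrow> (real \<Rightarrow> real) \<Rightarrow> (nat \<Rightarrow> real) \<Rightarrow> ennreal" where
  "moment_weight n a b V1 V2 m =
     indicator (Rn_top n interior_of moment_space n a b) m *
     ennreal (exp (- real n * (\<Sum>j=1..(n + 1) div 2. V1 (canonical_moment a b (2 * j - 1) m))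
                   - real n * (\<Sum>j=1..n div 2. V2 (canonical_moment a b (2 * j) m))))"

definition moment_norm_const ::
  "nat \<Rightarrow> real \<Rightarrow> real \<Rightarrow> (real \<Rightarrow> real) \<Rightarrow> (real \<Rightarrow> real) \<Rightarrow> ennreal" where
  "moment_norm_const n a b V1 V2 = (\<integral>\<^sup>+m. moment_weight n a b V1 V2 m \<partial>Rn_leb n)"

definition moment_ensemble ::
  "nat \<Rightarrow> real \<Rightarrow> real \<Rightarrow> (real \<Rightarrow> real) \<Rightarrow> (real \<Rightarrow> real) \<Rightarrow> (nat \<Rightarrow> real) measure" where
  "moment_ensemble n a b V1 V2 =
     density (Rn_leb n) (\<lambda>m. moment_weight n a b V1 V2 m / moment_norm_const n a b V1 V2)"

section \<open>The limit measure\<close>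

definition l_minus :: "real \<Rightarrow> real \<Rightarrow> real \<Rightarrow> real \<Rightarrow> real" where
  "l_minus a b p1 p2 = a + (b - a) * (sqrt (p1 * (1 - p2)) - sqrt (p2 * (1 - p1)))\<^sup>2"

definition l_plus :: "real \<Rightarrow> real \<Rightarrow> real \<Rightarrow> real \<Rightarrow> real" where
  "l_plus a b p1 p2 = a + (b - a) * (sqrt (p1 * (1 - p2)) + sqrt (p2 * (1 - p1)))\<^sup>2"

definition add_measure :: "'a measure \<Rightarrow> 'a measure \<Rightarrow> 'a measure" where
  "add_measure M N = measure_of (space M) (sets M) (\<lambda>A. emeasure M A + emeasure N A)"

definition mu_ac :: "real \<Rightarrow> real \<Rightarrow> real \<Rightarrow> real \<Rightarrow> real measure" where
  "mu_ac a b p1 p2 = density (restrict_space lborel {a..b})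
     (\<lambda>x. indicator {l_minus a b p1 p2..l_plus a b p1 p2} x *
        ennreal (sqrt ((x - l_minus a b p1 p2) * (l_plus a b p1 p2 - x)) /
                 (2 * pi * p2 * (x - a) * (b - x))))"

definition mu_d :: "real \<Rightarrow> real \<Rightarrow> real \<Rightarrow> real \<Rightarrow> real measure" where
  "mu_d a b p1 p2 = add_measure
     (scale_measure (ennreal (max (1 - p1 / p2) 0)) (return (restrict_space borel {a..b}) a))
     (scale_measure (ennreal (max ((p1 + p2 - 1) / p2) 0)) (return (restrict_space borel {a..b}) b))"

definition mu_lim :: "real \<Rightarrow> real \<Rightarrow> real \<Rightarrow> real \<Rightarrow> real measure" where
  "mu_lim a b p1 p2 = add_measure (mu_ac a b p1 p2) (mu_d a b p1 p2)"

section \<open>Hypotheses on the potentials\<close>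

definition C2_on_unit :: "(real \<Rightarrow> real) \<Rightarrow> bool" where
  "C2_on_unit V \<longleftrightarrow>
     (\<forall>x\<in>{0<..<1}. V differentiable (at x) \<and> deriv V differentiable (at x)) \<and>
     continuous_on {0<..<1} (deriv (deriv V))"

definition W_of :: "(real \<Rightarrow> real) \<Rightarrow> real \<Rightarrow> real" where
  "W_of V p = V p - ln (p * (1 - p))"

definition unique_minimizer :: "('a \<Rightarrow> 'b::linorder) \<Rightarrow> 'a set \<Rightarrow> 'a \<Rightarrow> bool" where
  "unique_minimizer f S x \<longleftrightarrow> (\<forall>y. is_arg_min f (\<lambda>z. z \<in> S) y \<longleftrightarrow> y = x)"

section \<open>The energy functional\<close>

text \<open>Logarithm with value \<open>-\<infinity>\<close> at \<open>0\<close>; only nonnegative arguments matter.\<close>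

definition elog :: "real \<Rightarrow> ereal" where
  "elog x = (if x > 0 then ereal (ln x) else - \<infinity>)"

text \<open>The Lebesgue integral of an extended real function, as the integral of its positive part
  minus that of its negative part. It is used only for functions bounded above or below and finite
  measures, so \<open>\<infinity> - \<infinity>\<close> does not occur.\<close>

definition ereal_integral :: "'a measure \<Rightarrow> ('a \<Rightarrow> ereal) \<Rightarrow> ereal" where
  "ereal_integral M f =
     enn2ereal (\<integral>\<^sup>+x. e2ennreal (max (f x) 0) \<partial>M) -
     enn2ereal (\<integral>\<^sup>+x. e2ennreal (max (- f x) 0) \<partial>M)"

text \<open>In \<^typ>\<open>ereal\<close> one has \<open>0 * (-\<infinity>) = 0\<close>, which is the convention \<open>0 log 0 = 0\<close>.\<close>

definition ext_field :: "real \<Rightarrow> real \<Rightarrow> real \<Rightarrow> real \<Rightarrow> real \<Rightarrow> ereal" where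
  "ext_field a b p1 p2 t =
     - (ereal (p1 / p2 - 1) * elog (t - a)) - ereal ((1 - p1 - p2) / p2) * elog (b - t)"

definition energy :: "(real \<Rightarrow> ereal) \<Rightarrow> real measure \<Rightarrow> ereal" where
  "energy Q \<mu> =
     ereal_integral \<mu> Q - ereal_integral \<mu> (\<lambda>s. ereal_integral \<mu> (\<lambda>t. elog \<bar>t - s\<bar>))"

definition is_equilibrium_measure ::
  "real \<Rightarrow> real \<Rightarrow> (real \<Rightarrow> ereal) \<Rightarrow> real measure \<Rightarrow> bool" where
  "is_equilibrium_measure a b Q \<mu> \<longleftrightarrow> unique_minimizer (energy Q) (borel_prob_on a b) \<mu>"

end

theory Submission
  imports Defs "HOL-Computational_Algebra.Polynomial"
begin

text \<open>
  The substitution \<open>x = a + (b - a) t\<^sup>2\<close> turns a measure on \<open>[a,b]\<close> into an even functional on the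
  polynomials in \<open>t\<close>, and such a functional is described by the coefficients of the three-term
  recurrence \<open>t S\<^sub>n = S\<^sub>n\<^sub>+\<^sub>1 + z\<^sub>n S\<^sub>n\<^sub>-\<^sub>1\<close> of its orthogonal polynomials. The measures carried by
  \<open>|t| \<le> 1\<close> correspond to the chain sequences \<open>z\<^sub>n = (1 - p\<^sub>n\<^sub>-\<^sub>1) p\<^sub>n\<close> with parameters in \<open>[0,1]\<close>, and
  these parameters are the canonical moments. The \<open>j\<close>-th moment is affine in \<open>p\<^sub>j\<close>; the two end values
  \<open>p\<^sub>j = 0\<close> and \<open>p\<^sub>j = 1\<close> bound it, because the functional is nonnegative on the square of an
  orthogonal polynomial and on such a square times \<open>1 - t\<^sup>2\<close> (\<open>next_moment_bounds\<close>), and every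
  parameter sequence occurs, by Hausdorff's construction from Bernstein polynomials
  (\<open>cmom_realizable\<close>). Hence \<open>canonical_moment_eq\<close>, and the interior of the moment space is the
  image of the open cube (\<open>interior_moment_space\<close>).

  The map from canonical moments to moments is triangular with Jacobian
  \<open>\<Prod>\<^sub>i (b - a)\<^sup>i (p\<^sub>i (1 - p\<^sub>i))\<^sup>n\<^sup>-\<^sup>i\<close> (\<open>nn_integral_cube\<close>), so the canonical moments of the random
  vector are independent, and the \<open>i\<close>-th of them has a density proportional to
  \<open>exp (- n W(p)) / (p (1 - p))\<^sup>i\<close> with \<open>W = W\<^sub>1\<close> or \<open>W\<^sub>2\<close> according to the parity of \<open>i\<close>. By Laplace's
  method this law concentrates exponentially fast at the minimizer of \<open>W\<close> (\<open>laplace_tail\<close>). The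
  Borel-Cantelli lemma gives almost sure convergence of each canonical moment; moments are
  polynomials in finitely many canonical moments, and they are bounded, so they converge almost
  surely and in the mean (\<open>random_moments_converge\<close>) to the moments with the periodic parameters
  \<open>p\<^sub>1, p\<^sub>2, p\<^sub>1, p\<^sub>2, \<dots>\<close>. That the explicit limit measure has exactly these parameters is
  \<open>moment_mu_lim\<close>: in the coordinate \<open>x = a + (b - a) (A + B - 2 \<surd>(A B) cos \<theta>)\<close> the relevant
  orthogonal polynomials become Chebyshev polynomials of the second kind.

  Without atoms one has \<open>p\<^sub>2 \<le> p\<^sub>1\<close> and \<open>p\<^sub>1 + p\<^sub>2 \<le> 1\<close>, so the two logarithmic charges
  \<open>\<alpha> = p\<^sub>1 / p\<^sub>2 - 1\<close> and \<open>\<beta> = (1 - p\<^sub>1 - p\<^sub>2) / p\<^sub>2\<close> of the field are nonnegative. The cosine moments of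
  the limit measure in \<open>\<theta>\<close> are \<open>- (\<alpha> r\<^sub>1\<^sup>m + \<beta> (- r\<^sub>2)\<^sup>m) / 2\<close>, which sums the Chebyshev expansion of the
  logarithm in closed form: twice the potential plus the field is constant on the support and at
  least that constant elsewhere (\<open>potential\<close>, \<open>potential_AE\<close>). The same expansion shows
  that the logarithmic energy of a difference of two probability measures dominates, up to a
  positive factor, each squared difference of their Chebyshev moments (\<open>log_energy_positive\<close>). The two facts together make the energy
  of any other measure strictly larger (\<open>energy_minimizer_unique\<close>).
\<close>

section \<open>Linear functionals on polynomials\<close>

text \<open>A functional is given by its values \<open>f i\<close> on the powers of the variable.\<close>

definition lin :: "(nat \<Rightarrow> real) \<Rightarrow> real poly \<Rightarrow> real" where
  "lin f P = (\<Sum>i\<le>degree P. coeff P i * f i)"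

lemma lin_eq_sum:
  assumes "degree P \<le> N"
  shows "lin f P = (\<Sum>i\<le>N. coeff P i * f i)"
  unfolding lin_def
  by (rule sum.mono_neutral_left) (use assms in \<open>auto simp: coeff_eq_0\<close>)

lemma lin_0 [simp]: "lin f 0 = 0"
  by (simp add: lin_def)

lemma lin_add: "lin f (P + Q) = lin f P + lin f Q"
proof -
  let ?N = "max (degree P) (degree Q)"
  have "degree (P + Q) \<le> ?N" by (rule degree_add_le_max)
  then show ?thesis
    by (simp add: lin_eq_sum[of _ ?N] sum.distrib algebra_simps)
qed

lemma lin_smult: "lin f (smult c P) = c * lin f P"
  by (simp add: lin_eq_sum[of _ "degree P"] degree_smult_le sum_distrib_left mult.assoc)

lemma lin_diff: "lin f (P - Q) = lin f P - lin f Q"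
  using lin_add[of f P "smult (-1) Q"] lin_smult[of f "-1" Q] by simp

lemma lin_sum: "lin f (\<Sum>i\<in>A. P i) = (\<Sum>i\<in>A. lin f (P i))"
  by (induction A rule: infinite_finite_induct) (auto simp: lin_add)

lemma lin_pCons: "lin f (pCons c P) = c * f 0 + lin (\<lambda>i. f (Suc i)) P"
proof -
  have "lin f (pCons c P) = (\<Sum>i\<le>Suc (degree P). coeff (pCons c P) i * f i)"
    by (rule lin_eq_sum) (simp add: degree_pCons_le)
  also have "\<dots> = c * f 0 + (\<Sum>i\<le>degree P. coeff P i * f (Suc i))"
    by (simp only: sum.atMost_Suc_shift coeff_pCons_0 coeff_pCons_Suc)
  finally show ?thesis by (simp add: lin_def)
qed

lemma lin_monom [simp]: "lin f (monom c n) = c * f n"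
  by (cases "c = 0") (simp_all add: lin_def degree_monom_eq if_distrib[of "\<lambda>x. x * _"] sum.delta cong: if_cong)

lemma lin_add_fun: "lin (\<lambda>i. f i + g i) P = lin f P + lin g P"
  by (simp add: lin_def sum.distrib algebra_simps)

lemma lin_cmult_fun: "lin (\<lambda>i. c * f i) P = c * lin f P"
  by (simp add: lin_def sum_distrib_left algebra_simps)

text \<open>Only the top coefficient sees the first power on which two functionals disagree. Hence the sign
  of a functional on one well-chosen polynomial bounds the next moment.\<close>

lemma lin_diff_top:
  assumes "\<And>i. i < n \<Longrightarrow> f i = g i" and "degree R \<le> n"
  shows "lin f R - lin g R = coeff R n * (f n - g n)"
proof -
  have "lin f R - lin g R = (\<Sum>i\<le>n. coeff R i * (f i - g i))"
    by (simp add: lin_eq_sum[OF assms(2)] sum_subtractf algebra_simps)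
  also have "\<dots> = (\<Sum>i\<in>{n}. coeff R i * (f i - g i))"
    by (rule sum.mono_neutral_right) (use assms in auto)
  finally show ?thesis by simp
qed

section \<open>Favard functionals\<close>

text \<open>The coefficient of \<open>orth z k\<close> in the \<open>n\<close>-th power of the variable: by the recurrence it is the
  total weight of the lattice paths of \<open>n\<close> up and down steps from height \<open>0\<close> to height \<open>k\<close> that stay
  nonnegative, a down step from height \<open>j\<close> having weight \<open>z j\<close>.\<close>

fun path_weight :: "(nat \<Rightarrow> real) \<Rightarrow> nat \<Rightarrow> nat \<Rightarrow> real" where
  "path_weight z 0 k = (if k = 0 then 1 else 0)"
| "path_weight z (Suc n) 0 = z 1 * path_weight z n 1"
| "path_weight z (Suc n) (Suc k) = path_weight z n k + z (Suc (Suc k)) * path_weight z n (Suc (Suc k))"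

text \<open>The coefficient of \<open>orth z k\<close> in the expansion of \<open>P\<close> in the polynomials \<open>orth z\<close>.\<close>

definition ocoeff :: "(nat \<Rightarrow> real) \<Rightarrow> real poly \<Rightarrow> nat \<Rightarrow> real" where
  "ocoeff z P k = lin (\<lambda>i. path_weight z i k) P"

text \<open>The functional of Favard's theorem, for which the polynomials \<open>orth z\<close> are orthogonal: it
  reads off the constant coefficient of the expansion.\<close>

definition favard :: "(nat \<Rightarrow> real) \<Rightarrow> real poly \<Rightarrow> real" where
  "favard z P = ocoeff z P 0"

fun orth :: "(nat \<Rightarrow> real) \<Rightarrow> nat \<Rightarrow> real poly" where
  "orth z 0 = 1"
| "orth z (Suc 0) = [:0, 1:]"
| "orth z (Suc (Suc n)) = pCons 0 (orth z (Suc n)) - smult (z (Suc n)) (orth z n)"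

lemma ocoeff_add: "ocoeff z (P + Q) k = ocoeff z P k + ocoeff z Q k"
  and ocoeff_diff: "ocoeff z (P - Q) k = ocoeff z P k - ocoeff z Q k"
  and ocoeff_smult: "ocoeff z (smult c P) k = c * ocoeff z P k"
  and ocoeff_sum: "ocoeff z (sum F A) k = (\<Sum>i\<in>A. ocoeff z (F i) k)"
  by (simp_all add: ocoeff_def lin_add lin_diff lin_smult lin_sum)

lemma ocoeff_0 [simp]: "ocoeff z 0 k = 0"
  by (simp add: ocoeff_def)

lemma ocoeff_1: "ocoeff z 1 k = (if k = 0 then 1 else 0)"
  by (simp add: ocoeff_def lin_def)

lemma ocoeff_shift_0: "ocoeff z (pCons 0 P) 0 = z 1 * ocoeff z P 1"
  by (simp add: ocoeff_def lin_pCons lin_cmult_fun)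

lemma ocoeff_shift_Suc:
  "ocoeff z (pCons 0 P) (Suc k) = ocoeff z P k + z (Suc (Suc k)) * ocoeff z P (Suc (Suc k))"
  by (simp add: ocoeff_def lin_pCons lin_cmult_fun lin_add_fun)

text \<open>The two recurrences match, so path counting does compute the coefficients of the expansion in
  \<open>orth z\<close>.\<close>

lemma ocoeff_orth: "ocoeff z (orth z n) k = (if n = k then 1 else 0)"
proof (induction z n arbitrary: k rule: orth.induct)
  case (1 z)
  then show ?case by (simp add: ocoeff_1 del: One_nat_def)
next
  case (2 z)
  then show ?case
    by (cases k) (auto simp: ocoeff_def lin_pCons)
next
  case (3 z n)
  show ?case
    by (cases k) (auto simp: 3 ocoeff_diff ocoeff_smult ocoeff_shift_0 ocoeff_shift_Suc)
qed

lemma path_weight_above: "n < k \<Longrightarrow> path_weight z n k = 0"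
  by (induction z n k rule: path_weight.induct) auto

lemma path_weight_diag: "path_weight z n n = 1"
proof -
  have "n = k \<Longrightarrow> path_weight z n k = 1" for k
    by (induction z n k rule: path_weight.induct) (auto simp: path_weight_above)
  then show ?thesis by simp
qed

lemma path_weight_odd: "odd (n + k) \<Longrightarrow> path_weight z n k = 0"
  by (induction z n k rule: path_weight.induct) (auto intro: odd_pos)

lemma ocoeff_degree: "ocoeff z P (degree P) = lead_coeff P"
proof -
  have "ocoeff z P (degree P) = (\<Sum>i\<in>{degree P}. coeff P i * path_weight z i (degree P))"
    unfolding ocoeff_def lin_def
    by (rule sum.mono_neutral_right) (auto simp: path_weight_above)
  then show ?thesis by (simp add: path_weight_diag)
qed

lemma ocoeff_above: "degree P < k \<Longrightarrow> ocoeff z P k = 0"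
  unfolding ocoeff_def lin_def by (rule sum.neutral) (auto simp: path_weight_above)

lemma orth_expansion: "P = (\<Sum>k\<le>degree P. smult (ocoeff z P k) (orth z k))"
proof -
  define D where "D = P - (\<Sum>k\<le>degree P. smult (ocoeff z P k) (orth z k))"
  have "ocoeff z D k = 0" for k
    by (cases "k \<le> degree P")
       (auto simp: D_def ocoeff_diff ocoeff_sum ocoeff_smult ocoeff_orth ocoeff_above
          if_distrib[of "\<lambda>x. _ * x"] sum.delta cong: if_cong)
  then have "lead_coeff D = 0" using ocoeff_degree[of z D] by simp
  then have "D = 0" by (simp only: leading_coeff_0_iff)
  then show ?thesis by (simp add: D_def)
qed

text \<open>Orthogonality: multiplication by the variable is symmetric for the functional up to the factors
  \<open>z i\<close>, so the recurrence for \<open>orth z n\<close> can be moved to the other factor.\<close>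

lemma favard_orth_mult: "favard z (orth z n * P) = (\<Prod>i=1..n. z i) * ocoeff z P n"
proof (induction z n arbitrary: P rule: orth.induct)
  case (1 z)
  then show ?case by (simp add: favard_def)
next
  case (2 z)
  then show ?case by (simp add: favard_def ocoeff_shift_0)
next
  case (3 z n)
  have eq: "orth z (Suc (Suc n)) * P = orth z (Suc n) * pCons 0 P - smult (z (Suc n)) (orth z n * P)"
    by (simp add: algebra_simps)
  have "favard z (orth z (Suc (Suc n)) * P) =
      (\<Prod>i=1..Suc n. z i) * ocoeff z (pCons 0 P) (Suc n) - z (Suc n) * ((\<Prod>i=1..n. z i) * ocoeff z P n)"
    unfolding eq using 3[of "pCons 0 P"] 3[of P] by (simp add: favard_def ocoeff_diff ocoeff_smult del: orth.simps)
  also have "\<dots> = (\<Prod>i=1..Suc (Suc n). z i) * ocoeff z P (Suc (Suc n))"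
    by (simp add: ocoeff_shift_Suc algebra_simps)
  finally show ?case .
qed

lemma favard_diff: "favard z (P - Q) = favard z P - favard z Q"
  and favard_smult: "favard z (smult c P) = c * favard z P"
  and favard_sum: "favard z (sum F A) = (\<Sum>i\<in>A. favard z (F i))"
  by (simp_all add: favard_def ocoeff_add ocoeff_diff ocoeff_smult ocoeff_sum)

lemma favard_lin: "favard z P = lin (\<lambda>i. path_weight z i 0) P"
  by (simp add: favard_def ocoeff_def)

lemma favard_1: "favard z 1 = 1"
  by (simp add: favard_def ocoeff_1)

lemma favard_orth: "favard z (orth z n) = (if n = 0 then 1 else 0)"
  by (simp add: favard_def ocoeff_orth)

lemma favard_orth_square: "favard z (orth z n * orth z n) = (\<Prod>i=1..n. z i)"
  by (simp add: favard_orth_mult ocoeff_orth)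

text \<open>In the expansion of \<open>P\<close> the functional is diagonal with entries \<open>\<Prod>i=1..n. z i\<close>.\<close>

lemma favard_square_nonneg:
  assumes "\<And>i. 1 \<le> i \<Longrightarrow> 0 \<le> z i"
  shows "0 \<le> favard z (P * P)"
proof -
  have "favard z (P * P) = favard z ((\<Sum>k\<le>degree P. smult (ocoeff z P k) (orth z k)) * P)"
    using orth_expansion[of P z] by simp
  also have "\<dots> = (\<Sum>k\<le>degree P. ocoeff z P k * ((\<Prod>i=1..k. z i) * ocoeff z P k))"
    by (simp add: sum_distrib_right favard_sum favard_smult favard_orth_mult)
  also have "\<dots> = (\<Sum>k\<le>degree P. (\<Prod>i=1..k. z i) * (ocoeff z P k)\<^sup>2)"
    by (simp add: power2_eq_square algebra_simps)
  also have "\<dots> \<ge> 0"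
    by (intro sum_nonneg mult_nonneg_nonneg prod_nonneg) (use assms in auto)
  finally show ?thesis .
qed

lemma degree_orth_aux: "degree (orth z n) = n \<and> coeff (orth z n) n = 1"
proof (induction z n rule: orth.induct)
  case (3 z n)
  have d: "degree (pCons 0 (orth z (Suc n))) = Suc (Suc n)"
    using 3 by (auto simp: degree_pCons_eq_if)
  have s: "degree (smult (z (Suc n)) (orth z n)) < Suc (Suc n)"
    using 3 degree_smult_le[of "z (Suc n)" "orth z n"] by simp
  have "degree (orth z (Suc (Suc n))) = Suc (Suc n)"
    using d s degree_add_eq_left[of "- smult (z (Suc n)) (orth z n)" "pCons 0 (orth z (Suc n))"]
    by simp
  moreover have "coeff (orth z (Suc (Suc n))) (Suc (Suc n)) = 1"
    using 3 s by (simp add: coeff_eq_0)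
  ultimately show ?case by simp
qed auto

lemma degree_orth [simp]: "degree (orth z n) = n"
  and coeff_orth_top [simp]: "coeff (orth z n) n = 1"
  using degree_orth_aux by auto

text \<open>A path of \<open>m\<close> steps that ends at height \<open>k\<close> does not climb above \<open>(m + k) / 2\<close>.\<close>

lemma path_weight_cong:
  assumes "\<And>i. 1 \<le> i \<Longrightarrow> i \<le> N \<Longrightarrow> z i = z' i"
  shows "m + k \<le> 2 * N + 1 \<Longrightarrow> path_weight z m k = path_weight z' m k"
proof (induction m arbitrary: k)
  case (Suc n)
  show ?case
  proof (cases k)
    case 0
    have "z 1 = z' 1" if "1 \<le> n"
      using that Suc.prems by (intro assms) auto
    then show ?thesis
      using Suc.IH[of 1] Suc.prems 0 by (cases "1 \<le> n") (auto simp: path_weight_above)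
  next
    case (Suc l)
    have "z (Suc (Suc l)) = z' (Suc (Suc l))" if "Suc (Suc l) \<le> n"
      using that Suc.prems Suc by (intro assms) auto
    then show ?thesis
      using Suc.IH[of l] Suc.IH[of "Suc (Suc l)"] Suc.prems Suc
      by (cases "Suc (Suc l) \<le> n") (auto simp: path_weight_above)
  qed
qed auto

lemma orth_cong:
  "(\<And>i. 1 \<le> i \<Longrightarrow> i < n \<Longrightarrow> z i = z' i) \<Longrightarrow> orth z n = orth z' n"
  by (induction z n rule: orth.induct) auto

text \<open>An even functional has orthogonal polynomials of alternating parity.\<close>

lemma poly_orth_minus: "poly (orth z n) (- t) = (- 1) ^ n * poly (orth z n) t"
  by (induction z n rule: orth.induct) (auto simp: algebra_simps)

section \<open>Chain sequences\<close>

text \<open>The value at \<open>0\<close> makes the first element of the chain sequence equal to \<open>p 1\<close>.\<close>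

definition qc :: "(nat \<Rightarrow> real) \<Rightarrow> nat \<Rightarrow> real" where
  "qc p n = (if n = 0 then 1 else 1 - p n)"

definition chain :: "(nat \<Rightarrow> real) \<Rightarrow> nat \<Rightarrow> real" where
  "chain p n = qc p (n - 1) * p n"

text \<open>The chain sequence of the same functional after multiplication by \<open>1 - t\<^sup>2\<close>, see
  \<open>favard_dual\<close>.\<close>

definition dual_chain :: "(nat \<Rightarrow> real) \<Rightarrow> nat \<Rightarrow> real" where
  "dual_chain p n = p n * qc p (Suc n)"

definition edge_weight :: "real poly" where
  "edge_weight = [:1, 0, - 1:]"

text \<open>Christoffel's formula for the two mass points \<open>t = \<plusminus> 1\<close>. The factorized coefficients of a chain
  sequence are what makes the induction close.\<close>

lemma christoffel:
  "edge_weight * orth (dual_chain p) n =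
     smult (qc p n * qc p (Suc n)) (orth (chain p) n) - orth (chain p) (Suc (Suc n))"
proof (induction n rule: induct_nat_012)
  case 0
  show ?case by (simp add: edge_weight_def chain_def qc_def one_pCons)
next
  case 1
  show ?case by (simp add: edge_weight_def chain_def dual_chain_def qc_def one_pCons algebra_simps)
next
  case (ge2 n)
  let ?S = "orth (chain p)" and ?T = "orth (dual_chain p)"
  have T: "edge_weight * ?T (Suc (Suc n)) =
      pCons 0 (edge_weight * ?T (Suc n)) - smult (dual_chain p (Suc n)) (edge_weight * ?T n)"
    by (simp add: algebra_simps)
  have S: "pCons 0 (?S (Suc k)) = ?S (Suc (Suc k)) + smult (chain p (Suc k)) (?S k)" for k
    by simp
  have pc: "pCons 0 (smult c P - Q) = smult c (pCons 0 P) - pCons 0 Q" for c :: real and P Q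
    by simp
  have q: "qc p (Suc k) = 1 - p (Suc k)" for k
    by (simp add: qc_def)
  let ?P = "?S (Suc (Suc n))" and ?R = "?S (Suc (Suc (Suc (Suc n))))" and ?O = "?S n"
  have c: "chain p (Suc (Suc (Suc n))) = (1 - p (Suc (Suc n))) * p (Suc (Suc (Suc n)))"
    "chain p (Suc n) = qc p n * p (Suc n)"
    "dual_chain p (Suc n) = p (Suc n) * (1 - p (Suc (Suc n)))"
    by (simp_all add: chain_def dual_chain_def qc_def)
  show ?case
    unfolding T ge2 pc S c q
    by (rule poly_eqI) (simp add: algebra_simps del: orth.simps)
qed

text \<open>By \<open>christoffel\<close> both sides vanish on all dual orthogonal polynomials of positive degree. This
  makes the right end point as accessible as the left one: nonnegativity of the weight
  \<open>1 - t\<^sup>2\<close> becomes nonnegativity of the dual recurrence coefficients.\<close>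

lemma favard_dual: "favard (chain p) (edge_weight * P) = qc p 1 * favard (dual_chain p) P"
proof -
  have *: "favard (chain p) (edge_weight * orth (dual_chain p) n) =
      qc p 1 * favard (dual_chain p) (orth (dual_chain p) n)" for n
    unfolding christoffel by (simp add: favard_diff favard_smult favard_orth qc_def del: orth.simps)
  have "favard (chain p) (edge_weight * P) =
      favard (chain p) (\<Sum>k\<le>degree P. smult (ocoeff (dual_chain p) P k) (edge_weight * orth (dual_chain p) k))"
    by (subst orth_expansion[of P "dual_chain p"]) (simp add: sum_distrib_left)
  also have "\<dots> = qc p 1 * favard (dual_chain p) (\<Sum>k\<le>degree P. smult (ocoeff (dual_chain p) P k) (orth (dual_chain p) k))"
    by (simp add: favard_sum favard_smult * sum_distrib_left algebra_simps)
  finally show ?thesis using orth_expansion[of P "dual_chain p"] by simp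
qed

lemma chain_nonneg:
  assumes "\<And>i. 1 \<le> i \<Longrightarrow> p i \<in> {0..1}"
  shows "1 \<le> i \<Longrightarrow> 0 \<le> chain p i" and "1 \<le> i \<Longrightarrow> 0 \<le> dual_chain p i"
  using assms[of i] assms[of "i - 1"] assms[of "Suc i"] by (auto simp: chain_def dual_chain_def qc_def)

lemma favard_dual_square_nonneg:
  assumes "\<And>i. 1 \<le> i \<Longrightarrow> p i \<in> {0..1}"
  shows "0 \<le> favard (chain p) (edge_weight * (P * P))"
  unfolding favard_dual
  using favard_square_nonneg[of "dual_chain p" P] chain_nonneg[OF assms] assms[of 1] by (auto simp: qc_def)

lemma prod_chain: "(\<Prod>i=1..n. chain p i) = (\<Prod>i=1..<n. p i * (1 - p i)) * (if n = 0 then 1 else p n)"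
proof (induction n)
  case (Suc n)
  then show ?case
    by (cases "n = 0") (auto simp: chain_def qc_def algebra_simps atLeastLessThanSuc)
qed auto

lemma prod_dual_chain:
  "qc p 1 * (\<Prod>i=1..n. dual_chain p i) = (\<Prod>i=1..n. p i * (1 - p i)) * (1 - p (Suc n))"
proof (induction n)
  case (Suc n)
  have "qc p 1 * (\<Prod>i=1..Suc n. dual_chain p i) = qc p 1 * (\<Prod>i=1..n. dual_chain p i) * dual_chain p (Suc n)"
    by simp
  also have "\<dots> = (\<Prod>i=1..n. p i * (1 - p i)) * (1 - p (Suc n)) * (p (Suc n) * (1 - p (Suc (Suc n))))"
    unfolding Suc by (simp add: dual_chain_def qc_def)
  also have "\<dots> = (\<Prod>i=1..Suc n. p i * (1 - p i)) * (1 - p (Suc (Suc n)))"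
    by (simp add: mult_ac)
  finally show ?case .
qed (simp add: qc_def)

section \<open>The parametrized moments\<close>

text \<open>The polynomial \<open>x = a + (b - a) t\<^sup>2\<close> in the variable \<open>t\<close>.\<close>

definition xpoly :: "real \<Rightarrow> real \<Rightarrow> real poly" where
  "xpoly a b = [:a, 0, b - a:]"

text \<open>The \<open>j\<close>-th moment as a function of the canonical moments \<open>p\<close>.\<close>

definition cmom :: "real \<Rightarrow> real \<Rightarrow> (nat \<Rightarrow> real) \<Rightarrow> nat \<Rightarrow> real" where
  "cmom a b p j = favard (chain p) (xpoly a b ^ j)"

text \<open>The length of the interval of possible \<open>j\<close>-th moments once the lower ones are fixed, that is, the
  derivative of \<open>cmom a b p j\<close> with respect to \<open>p j\<close>.\<close>

definition slope :: "real \<Rightarrow> real \<Rightarrow> (nat \<Rightarrow> real) \<Rightarrow> nat \<Rightarrow> real" where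
  "slope a b p j = (b - a) ^ j * (\<Prod>i=1..<j. p i * (1 - p i))"

lemma degree_xpoly_power: "degree (xpoly a b ^ j) \<le> 2 * j"
proof -
  have "degree (xpoly a b) \<le> 2" by (simp add: xpoly_def)
  then show ?thesis
    using degree_power_le[of "xpoly a b" j] by (meson le_trans mult_le_mono1)
qed

lemma coeff_mult_top:
  fixes P Q :: "'a::comm_semiring_0 poly"
  assumes "degree P \<le> m" "degree Q \<le> n"
  shows "coeff (P * Q) (m + n) = coeff P m * coeff Q n"
proof -
  have "coeff (P * Q) (m + n) = (\<Sum>i\<le>m+n. coeff P i * coeff Q (m + n - i))"
    by (simp add: coeff_mult)
  also have "\<dots> = (\<Sum>i\<in>{m}. coeff P i * coeff Q (m + n - i))"
  proof (rule sum.mono_neutral_right)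
    show "\<forall>i\<in>{..m + n} - {m}. coeff P i * coeff Q (m + n - i) = 0"
    proof
      fix i assume "i \<in> {..m + n} - {m}"
      then have "m < i \<or> n < m + n - i" by auto
      then show "coeff P i * coeff Q (m + n - i) = 0"
        using assms coeff_eq_0[of P i] coeff_eq_0[of Q "m + n - i"] by auto
    qed
  qed auto
  finally show ?thesis by simp
qed

lemma coeff_xpoly_power: "coeff (xpoly a b ^ j) (2 * j) = (b - a) ^ j"
proof (induction j)
  case (Suc j)
  have "coeff (xpoly a b * xpoly a b ^ j) (2 + 2 * j) = coeff (xpoly a b) 2 * coeff (xpoly a b ^ j) (2 * j)"
    by (rule coeff_mult_top) (use degree_xpoly_power[of a b 1] degree_xpoly_power[of a b j] in auto)
  then show ?case using Suc by (simp add: xpoly_def numeral_2_eq_2)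
qed auto

lemma chain_cong: "(\<And>i. 1 \<le> i \<Longrightarrow> i \<le> N \<Longrightarrow> p i = p' i) \<Longrightarrow> 1 \<le> n \<Longrightarrow> n \<le> N \<Longrightarrow> chain p n = chain p' n"
  by (auto simp: chain_def qc_def)

lemma favard_chain_cong:
  assumes "\<And>i. 1 \<le> i \<Longrightarrow> i \<le> N \<Longrightarrow> p i = p' i" and "degree P \<le> 2 * N + 1"
  shows "favard (chain p) P = favard (chain p') P"
  unfolding favard_lin lin_def
proof (intro sum.cong refl arg_cong2[where f="(*)"])
  fix i assume "i \<in> {..degree P}"
  then show "path_weight (chain p) i 0 = path_weight (chain p') i 0"
    by (intro path_weight_cong[of N] chain_cong[of N] assms) (use assms(2) in auto)
qed

lemma cmom_cong:
  assumes "\<And>i. 1 \<le> i \<Longrightarrow> i \<le> j \<Longrightarrow> p i = p' i"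
  shows "cmom a b p j = cmom a b p' j"
  unfolding cmom_def
  by (rule favard_chain_cong[of j]) (use assms degree_xpoly_power[of a b j] in auto)

lemma slope_cong:
  assumes "\<And>i. 1 \<le> i \<Longrightarrow> i < j \<Longrightarrow> p i = p' i"
  shows "slope a b p j = slope a b p' j"
  unfolding slope_def by (intro arg_cong2[where f="(*)"] refl prod.cong) (use assms in auto)

lemma lower_poly:
  "degree (orth z j * orth z j) \<le> 2 * j" "coeff (orth z j * orth z j) (2 * j) = 1"
  using degree_mult_le[of "orth z j" "orth z j"] coeff_mult_top[of "orth z j" j "orth z j" j]
  by (auto simp: mult_2)

lemma upper_poly:
  fixes z :: "nat \<Rightarrow> real"
  assumes "1 \<le> j"
  defines "U \<equiv> edge_weight * (orth z (j - 1) * orth z (j - 1))"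
  shows "degree U \<le> 2 * j" "coeff U (2 * j) = - 1"
proof -
  have d: "degree (orth z (j - 1) * orth z (j - 1)) \<le> 2 * (j - 1)"
    by (rule lower_poly)
  have e: "2 * j = 2 + 2 * (j - 1)" using assms by simp
  show "degree U \<le> 2 * j"
    using degree_mult_le[of edge_weight "orth z (j - 1) * orth z (j - 1)"] d assms
    unfolding U_def e by (simp add: edge_weight_def del: mult_pCons_left)
  show "coeff U (2 * j) = - 1"
    unfolding U_def e
    by (subst coeff_mult_top) (use d lower_poly(2)[of z "j - 1"] in \<open>auto simp: edge_weight_def numeral_2_eq_2\<close>)
qed

text \<open>Since \<open>x = a + (b - a) t\<^sup>2\<close>, a power of \<open>x\<close> controls the even power of \<open>t\<close> of twice the exponent,
  modulo lower ones.\<close>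

lemma agree_powers:
  assumes "a < b" and odd: "\<And>i. odd i \<Longrightarrow> f i = g i"
    and agree: "\<And>i. i < j \<Longrightarrow> lin f (xpoly a b ^ i) = lin g (xpoly a b ^ i)"
  shows "i < 2 * j \<Longrightarrow> f i = g i"
proof (induction i rule: less_induct)
  case (less i)
  show ?case
  proof (cases "odd i")
    case False
    then obtain l where l: "i = 2 * l" by auto
    have "lin f (xpoly a b ^ l) - lin g (xpoly a b ^ l) = coeff (xpoly a b ^ l) i * (f i - g i)"
      by (rule lin_diff_top) (use less l degree_xpoly_power in auto)
    moreover have "coeff (xpoly a b ^ l) i \<noteq> 0"
      using assms(1) by (simp add: l coeff_xpoly_power)
    ultimately show ?thesis using agree[of l] less(2) l by simp
  qed (use odd in auto)
qed

text \<open>The parameter \<open>p j\<close> enters the first \<open>j\<close> moments only through the single path that climbs to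
  height \<open>j\<close>; evaluating at the square of an orthogonal polynomial isolates its weight.\<close>

lemma cmom_affine: "cmom a b (p(j := s)) j = cmom a b (p(j := 0)) j + s * slope a b p j" if "1 \<le> j"
proof -
  let ?L = "\<lambda>s i. path_weight (chain (p(j := s))) i 0"
  have ag: "?L s i = ?L 0 i" if "i < 2 * j" for i
    by (rule path_weight_cong[of "j - 1"]) (use that \<open>1 \<le> j\<close> in \<open>auto intro!: chain_cong[of "j - 1"]\<close>)
  have orth_eq: "orth (chain (p(j := 0))) j = orth (chain (p(j := s))) j"
    by (rule orth_cong) (auto intro!: chain_cong[of "j - 1"])
  have h: "favard (chain (p(j := r))) (orth (chain (p(j := r))) j * orth (chain (p(j := r))) j) =
      r * (\<Prod>i=1..<j. p i * (1 - p i))" for r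
    unfolding favard_orth_square prod_chain using \<open>1 \<le> j\<close> by (auto intro!: prod.cong)
  have "s * (\<Prod>i=1..<j. p i * (1 - p i)) - 0 = 1 * (?L s (2 * j) - ?L 0 (2 * j))"
    using lin_diff_top[of "2 * j" "?L s" "?L 0", OF ag lower_poly(1)[of "chain (p(j := s))"]] h[of s] h[of 0]
    unfolding orth_eq lower_poly(2) favard_lin by simp
  moreover have "cmom a b (p(j := s)) j - cmom a b (p(j := 0)) j = (b - a) ^ j * (?L s (2 * j) - ?L 0 (2 * j))"
    unfolding cmom_def favard_lin
    using lin_diff_top[of "2 * j" "?L s" "?L 0" "xpoly a b ^ j", OF ag degree_xpoly_power]
    by (simp add: coeff_xpoly_power)
  ultimately have "cmom a b (p(j := s)) j - cmom a b (p(j := 0)) j =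
      (b - a) ^ j * (s * (\<Prod>i=1..<j. p i * (1 - p i)))" by simp
  then show ?thesis by (simp add: slope_def diff_eq_eq mult_ac add_ac)
qed

section \<open>Measures on the interval as functionals\<close>

definition ucoord :: "real \<Rightarrow> real \<Rightarrow> real \<Rightarrow> real" where
  "ucoord a b x = (x - a) / (b - a)"

text \<open>The moments of the even measure in \<open>t\<close> whose image under \<open>t \<mapsto> t\<^sup>2\<close> is the given measure in the
  coordinate \<open>ucoord\<close>.\<close>

definition sym_moment :: "real \<Rightarrow> real \<Rightarrow> real measure \<Rightarrow> nat \<Rightarrow> real" where
  "sym_moment a b \<mu> i = (if even i then \<integral>x. ucoord a b x ^ (i div 2) \<partial>\<mu> else 0)"

lemma borel_prob_onD:
  assumes "\<mu> \<in> borel_prob_on a b"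
  shows "prob_space \<mu>" and "sets \<mu> = sets (restrict_space borel {a..b})" and "space \<mu> = {a..b}"
proof -
  show "prob_space \<mu>" and s: "sets \<mu> = sets (restrict_space borel {a..b})"
    using assms by (auto simp: borel_prob_on_def)
  show "space \<mu> = {a..b}"
    using sets_eq_imp_space_eq[OF s] by (simp add: space_restrict_space)
qed

lemma borel_prob_on_measurable:
  assumes "\<mu> \<in> borel_prob_on a b" and "f \<in> borel_measurable borel"
  shows "f \<in> borel_measurable \<mu>"
  using measurable_restrict_space1[OF assms(2), of "{a..b}"]
    measurable_cong_sets[OF borel_prob_onD(2)[OF assms(1)] refl, of borel] by blast

lemma borel_prob_on_integrable:
  fixes f :: "real \<Rightarrow> real"
  assumes "\<mu> \<in> borel_prob_on a b" and "continuous_on UNIV f"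
  shows "integrable \<mu> f"
proof -
  interpret prob_space \<mu> by (rule borel_prob_onD[OF assms(1)])
  have "compact (f ` {a..b})"
    by (rule compact_continuous_image[OF continuous_on_subset[OF assms(2)]]) auto
  then obtain B where "\<And>x. x \<in> {a..b} \<Longrightarrow> norm (f x) \<le> B"
    using compact_imp_bounded[of "f ` {a..b}"] unfolding bounded_iff by blast
  moreover have "f \<in> borel_measurable \<mu>"
    by (rule borel_prob_on_measurable[OF assms(1) borel_measurable_continuous_onI[OF assms(2)]])
  ultimately show ?thesis
    using borel_prob_onD(3)[OF assms(1)] by (intro integrable_const_bound[of _ B]) auto
qed

lemma sqrt_neg_power_mean:
  assumes "0 \<le> u"
  shows "(sqrt u ^ i + (- sqrt u) ^ i) / 2 = (if even i then u ^ (i div 2) else 0)"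
proof (cases "even i")
  case True
  then obtain k where "i = 2 * k" by blast
  then show ?thesis using assms by (simp add: power_mult)
next
  case False
  then show ?thesis by (simp add: power_minus_odd)
qed

text \<open>The even measure puts half of the mass on either square root.\<close>

lemma lin_sym_moment:
  assumes "a < b" and \<mu>: "\<mu> \<in> borel_prob_on a b"
  shows "lin (sym_moment a b \<mu>) P =
    (\<integral>x. (poly P (sqrt (ucoord a b x)) + poly P (- sqrt (ucoord a b x))) / 2 \<partial>\<mu>)"
proof -
  let ?e = "\<lambda>i x. if even i then ucoord a b x ^ (i div 2) else 0"
  have "(\<integral>x. (poly P (sqrt (ucoord a b x)) + poly P (- sqrt (ucoord a b x))) / 2 \<partial>\<mu>) =
      (\<integral>x. (\<Sum>i\<le>degree P. coeff P i * ?e i x) \<partial>\<mu>)"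
  proof (rule Bochner_Integration.integral_cong)
    fix x assume "x \<in> space \<mu>"
    then have "0 \<le> ucoord a b x"
      using assms by (simp add: borel_prob_onD ucoord_def)
    then have "(poly P (sqrt (ucoord a b x)) + poly P (- sqrt (ucoord a b x))) / 2 =
        (\<Sum>i\<le>degree P. coeff P i * ((sqrt (ucoord a b x) ^ i + (- sqrt (ucoord a b x)) ^ i) / 2))"
      by (simp add: poly_altdef sum.distrib[symmetric] sum_divide_distrib algebra_simps del: real_sqrt_power)
    then show "(poly P (sqrt (ucoord a b x)) + poly P (- sqrt (ucoord a b x))) / 2 =
        (\<Sum>i\<le>degree P. coeff P i * ?e i x)"
      using sqrt_neg_power_mean[OF \<open>0 \<le> ucoord a b x\<close>] by simp
  qed simp
  also have "\<dots> = (\<Sum>i\<le>degree P. coeff P i * (\<integral>x. ?e i x \<partial>\<mu>))"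
  proof -
    have "integrable \<mu> (\<lambda>x. ?e i x)" for i
      using assms(1)
      by (intro borel_prob_on_integrable[OF \<mu>], cases "even i") (auto simp: ucoord_def intro!: continuous_intros)
    then show ?thesis by simp
  qed
  also have "\<dots> = lin (sym_moment a b \<mu>) P"
    unfolding lin_def sym_moment_def by (intro sum.cong) auto
  finally show ?thesis by simp
qed

lemma lin_sym_moment_nonneg:
  assumes "a < b" and \<mu>: "\<mu> \<in> borel_prob_on a b" and "\<And>t. \<bar>t\<bar> \<le> 1 \<Longrightarrow> 0 \<le> poly P t"
  shows "0 \<le> lin (sym_moment a b \<mu>) P"
  unfolding lin_sym_moment[OF assms(1,2)]
proof (rule Bochner_Integration.integral_nonneg)
  fix x assume "x \<in> space \<mu>"
  then have "0 \<le> ucoord a b x" "ucoord a b x \<le> 1"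
    using assms by (simp_all add: borel_prob_onD ucoord_def)
  then show "0 \<le> (poly P (sqrt (ucoord a b x)) + poly P (- sqrt (ucoord a b x))) / 2"
    using assms(3)[of "sqrt (ucoord a b x)"] assms(3)[of "- sqrt (ucoord a b x)"] by simp
qed

lemma lin_sym_moment_xpoly:
  assumes "a < b" and \<mu>: "\<mu> \<in> borel_prob_on a b"
  shows "lin (sym_moment a b \<mu>) (xpoly a b ^ j) = moment j \<mu>"
  unfolding lin_sym_moment[OF assms] moment_def
proof (rule Bochner_Integration.integral_cong)
  fix x assume "x \<in> space \<mu>"
  then have "0 \<le> ucoord a b x"
    using assms by (simp_all add: borel_prob_onD ucoord_def)
  then have "sqrt (ucoord a b x) * (sqrt (ucoord a b x) * (b - a)) = x - a"
    using assms(1) by (simp add: mult.assoc[symmetric]) (simp add: ucoord_def)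
  then have "poly (xpoly a b) (sqrt (ucoord a b x)) = x" "poly (xpoly a b) (- sqrt (ucoord a b x)) = x"
    by (simp_all add: xpoly_def)
  then show "(poly (xpoly a b ^ j) (sqrt (ucoord a b x)) + poly (xpoly a b ^ j) (- sqrt (ucoord a b x))) / 2 = x ^ j"
    by simp
qed simp

text \<open>With \<open>p j = 0\<close> the Favard functional vanishes on the square of its \<open>j\<close>-th orthogonal polynomial,
  and with \<open>p j = 1\<close> it vanishes on \<open>1 - t\<^sup>2\<close> times the square of the dual polynomial of degree
  \<open>j - 1\<close>. The functional of \<open>\<mu>\<close> is nonnegative on both, and it differs from the Favard functional only
  through the top coefficient of the polynomial, which is \<open>1\<close> in the first case and \<open>- 1\<close> in the second.\<close>

lemma next_moment_bounds:
  assumes "a < b" and \<mu>: "\<mu> \<in> borel_prob_on a b" and j: "1 \<le> j"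
    and m: "\<And>i. 1 \<le> i \<Longrightarrow> i < j \<Longrightarrow> moment i \<mu> = cmom a b p i"
  shows "cmom a b (p(j := 0)) j \<le> moment j \<mu>" and "moment j \<mu> \<le> cmom a b (p(j := 0)) j + slope a b p j"
proof -
  let ?f = "sym_moment a b \<mu>"
  let ?g = "\<lambda>s i. path_weight (chain (p(j := s))) i 0"
  interpret prob_space \<mu> by (rule borel_prob_onD[OF \<mu>])
  have ag: "?f i = ?g s i" if "i < 2 * j" for i s
  proof (rule agree_powers[OF assms(1) _ _ that])
    show "?f i = ?g s i" if "odd i" for i
      using that by (simp add: sym_moment_def path_weight_odd)
    show "lin ?f (xpoly a b ^ i) = lin (?g s) (xpoly a b ^ i)" if "i < j" for i
    proof (cases "i = 0")
      case True
      then show ?thesis by (simp add: lin_def sym_moment_def prob_space)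
    next
      case False
      have "cmom a b p i = cmom a b (p(j := s)) i"
        by (rule cmom_cong) (use that in auto)
      then show ?thesis
        using m[of i] False that by (simp add: lin_sym_moment_xpoly[OF assms(1,2)] cmom_def favard_lin)
    qed
  qed
  have diff: "moment j \<mu> - cmom a b (p(j := s)) j = (b - a) ^ j * (?f (2 * j) - ?g s (2 * j))" for s
    using lin_diff_top[of "2 * j" ?f "?g s" "xpoly a b ^ j", OF ag degree_xpoly_power]
    by (simp add: coeff_xpoly_power lin_sym_moment_xpoly[OF assms(1,2)] cmom_def favard_lin)
  show "cmom a b (p(j := 0)) j \<le> moment j \<mu>"
  proof -
    let ?R = "orth (chain (p(j := 0))) j * orth (chain (p(j := 0))) j"
    have "favard (chain (p(j := 0))) ?R = 0"
      unfolding favard_orth_square prod_chain using j by simp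
    then have "lin ?f ?R = ?f (2 * j) - ?g 0 (2 * j)"
      using lin_diff_top[of "2 * j" ?f "?g 0" ?R, OF ag lower_poly(1)] by (simp add: lower_poly favard_lin)
    moreover have "0 \<le> lin ?f ?R"
      by (rule lin_sym_moment_nonneg[OF assms(1,2)]) simp
    ultimately show ?thesis
      using diff[of 0] assms(1) by (smt (verit) mult_nonneg_nonneg zero_le_power)
  qed
  show "moment j \<mu> \<le> cmom a b (p(j := 0)) j + slope a b p j"
  proof -
    let ?z = "dual_chain (p(j := 1))"
    let ?R = "edge_weight * (orth ?z (j - 1) * orth ?z (j - 1))"
    have "favard (chain (p(j := 1))) ?R = 0"
      unfolding favard_dual favard_orth_square prod_dual_chain using j by simp
    then have "lin ?f ?R = - (?f (2 * j) - ?g 1 (2 * j))"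
      using lin_diff_top[of "2 * j" ?f "?g 1" ?R, OF ag upper_poly(1)[OF j]]
      by (simp add: upper_poly(2)[OF j] favard_lin del: One_nat_def)
    moreover have "0 \<le> lin ?f ?R"
    proof (rule lin_sym_moment_nonneg[OF assms(1,2)])
      fix t :: real
      assume "\<bar>t\<bar> \<le> 1"
      moreover have "poly ?R t = (1 - t\<^sup>2) * (poly (orth ?z (j - 1)) t)\<^sup>2"
        by (simp add: edge_weight_def power2_eq_square algebra_simps)
      ultimately show "0 \<le> poly ?R t" by (simp add: abs_square_le_1)
    qed
    ultimately have "moment j \<mu> \<le> cmom a b (p(j := 1)) j"
      using diff[of 1] assms(1) by (smt (verit) mult_nonneg_nonneg zero_le_power right_diff_distrib)
    then show ?thesis using cmom_affine[OF j, of a b p 1] by simp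
  qed
qed

section \<open>Realizing the parameters by measures\<close>

text \<open>The polynomial \<open>t\<^sup>2\<close>, complementary to \<open>edge_weight\<close>.\<close>

definition tsq :: "real poly" where "tsq = [:0, 0, 1:]"

lemma tsq_plus_edge: "tsq + edge_weight = 1"
  by (simp add: tsq_def edge_weight_def one_pCons)

lemma tsq_power: "tsq ^ r = monom 1 (2 * r)"
proof -
  have "tsq = monom 1 2" by (simp add: tsq_def monom_altdef numeral_2_eq_2)
  then show ?thesis by (simp add: monom_altdef power_mult)
qed

text \<open>The value of the functional on the Bernstein polynomial of degree \<open>N\<close> in \<open>t\<^sup>2\<close>. These are the
  masses, at the points \<open>k / N\<close>, of Hausdorff's approximating measures.\<close>

definition bernstein_weight :: "(nat \<Rightarrow> real) \<Rightarrow> nat \<Rightarrow> nat \<Rightarrow> real" where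
  "bernstein_weight p N k = real (N choose k) * favard (chain p) (tsq ^ k * edge_weight ^ (N - k))"

text \<open>The Bernstein polynomial is a square or \<open>1 - t\<^sup>2\<close> times a square.\<close>

lemma bernstein_weight_nonneg:
  assumes "\<And>i. 1 \<le> i \<Longrightarrow> p i \<in> {0..1}"
  shows "0 \<le> bernstein_weight p N k"
proof -
  let ?P = "[:0, 1:] ^ k * edge_weight ^ ((N - k) div 2)"
  have t: "tsq ^ k = [:0, 1:] ^ k * [:0, 1:] ^ k"
    by (simp add: tsq_def flip: power_mult_distrib)
  have "0 \<le> favard (chain p) (tsq ^ k * edge_weight ^ (N - k))"
  proof (cases "even (N - k)")
    case True
    then have "edge_weight ^ (N - k) = edge_weight ^ ((N - k) div 2) * edge_weight ^ ((N - k) div 2)"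
      by (metis dvd_mult_div_cancel mult_2 power_add)
    then have "tsq ^ k * edge_weight ^ (N - k) = ?P * ?P"
      unfolding t by (simp only: mult_ac)
    then show ?thesis
      using favard_square_nonneg[of "chain p" ?P] chain_nonneg[OF assms] by simp
  next
    case False
    then have "edge_weight ^ (N - k) = edge_weight * (edge_weight ^ ((N - k) div 2) * edge_weight ^ ((N - k) div 2))"
      by (metis odd_two_times_div_two_succ mult_2 power_add power_Suc Suc_eq_plus1)
    then have "tsq ^ k * edge_weight ^ (N - k) = edge_weight * (?P * ?P)"
      unfolding t by (simp only: mult_ac)
    then show ?thesis
      using favard_dual_square_nonneg[of p ?P] assms by simp
  qed
  then show ?thesis by (simp add: bernstein_weight_def)
qed

text \<open>The binomial theorem applied to \<open>(t\<^sup>2 + (1 - t\<^sup>2))\<^sup>N\<^sup>-\<^sup>r\<close>.\<close>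

lemma bernstein_factorial_moment:
  assumes "r \<le> N"
  shows "(\<Sum>k\<le>N. bernstein_weight p N k * real (k choose r)) = real (N choose r) * favard (chain p) (tsq ^ r)"
proof -
  have "(\<Sum>k\<le>N. bernstein_weight p N k * real (k choose r)) =
      (\<Sum>k\<in>{r..N}. bernstein_weight p N k * real (k choose r))"
    by (rule sum.mono_neutral_right) (auto simp: binomial_eq_0)
  also have "\<dots> = (\<Sum>k\<in>{r..N}. real (N choose r) *
      favard (chain p) (of_nat ((N - r) choose (k - r)) * tsq ^ r * tsq ^ (k - r) * edge_weight ^ (N - k)))"
  proof (rule sum.cong)
    fix k assume k: "k \<in> {r..N}"
    then have "tsq ^ k = tsq ^ r * tsq ^ (k - r)"
      by (metis atLeastAtMost_iff le_add_diff_inverse power_add)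
    moreover have "real (N choose k) * real (k choose r) = real (N choose r) * real ((N - r) choose (k - r))"
      using choose_mult[of r k N] k by (metis atLeastAtMost_iff of_nat_mult)
    moreover have "of_nat n * P = smult (real n) P" for n and P :: "real poly"
      by (simp add: of_nat_poly)
    ultimately show "bernstein_weight p N k * real (k choose r) = real (N choose r) *
      favard (chain p) (of_nat ((N - r) choose (k - r)) * tsq ^ r * tsq ^ (k - r) * edge_weight ^ (N - k))"
      by (simp add: bernstein_weight_def favard_smult mult.assoc)
  qed simp
  also have "\<dots> = (\<Sum>l\<le>N - r. real (N choose r) *
      favard (chain p) (of_nat ((N - r) choose l) * tsq ^ r * tsq ^ l * edge_weight ^ (N - r - l)))"
    by (rule sum.reindex_bij_witness[of _ "\<lambda>l. l + r" "\<lambda>k. k - r"]) (use assms in auto)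
  also have "\<dots> = real (N choose r) * favard (chain p) (tsq ^ r * (tsq + edge_weight) ^ (N - r))"
    unfolding binomial_ring by (simp add: sum_distrib_left favard_sum mult_ac)
  finally show ?thesis by (simp add: tsq_plus_edge)
qed

lemma bernstein_weight_sum: "(\<Sum>k\<le>N. bernstein_weight p N k) = 1"
  using bernstein_factorial_moment[of 0 N p] by (simp add: favard_1)

text \<open>Passes from the factorial moments of \<open>bernstein_factorial_moment\<close> to power moments.\<close>

lemma choose_ratio_approx:
  assumes "2 * r < N" "k \<le> N"
  shows "\<bar>real (k choose r) / real (N choose r) - (real k / real N) ^ r\<bar> \<le> real r * real r / real (N - r)"
proof -
  have ratio: "real (k choose r) / real (N choose r) = (\<Prod>i=0..<r. (real k - real i) / (real N - real i))"
    by (simp add: binomial_gbinomial gbinomial_prod_rev prod_dividef)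
  have "norm ((\<Prod>i\<in>{0..<r}. (real k - real i) / (real N - real i)) - (\<Prod>i\<in>{0..<r}. real k / real N)) \<le>
      (\<Sum>i\<in>{0..<r}. norm ((real k - real i) / (real N - real i) - real k / real N))"
  proof (rule norm_prod_diff)
    fix i assume "i \<in> {0..<r}"
    then have "real i < real r" "2 * real r < real N" "real k \<le> real N" using assms by auto
    then show "norm ((real k - real i) / (real N - real i)) \<le> 1"
      by (simp add: divide_le_eq abs_le_iff)
    show "norm (real k / real N) \<le> 1" using assms by (simp add: divide_le_eq)
  qed
  also have "\<dots> \<le> (\<Sum>i\<in>{0..<r}. real r / real (N - r))"
  proof (rule sum_mono)
    fix i assume "i \<in> {0..<r}"
    then have i: "real i < real r" "2 * real r < real N" "real k \<le> real N" using assms by auto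
    have "(real k - real i) / (real N - real i) - real k / real N =
        - (real i * (real N - real k) / (real N * (real N - real i)))"
      using i by (simp add: field_simps)
    then have "norm ((real k - real i) / (real N - real i) - real k / real N) =
        real i * ((real N - real k) / real N) / (real N - real i)"
      using i by (simp add: abs_mult abs_divide)
    also have "\<dots> \<le> real r * 1 / (real N - real r)"
      using i by (intro frac_le mult_mono) auto
    finally show "norm ((real k - real i) / (real N - real i) - real k / real N) \<le> real r / real (N - r)"
      using assms by (simp add: of_nat_diff)
  qed
  finally show ?thesis by (simp add: ratio prod_constant)
qed

lemma bernstein_moment_limit:
  assumes p: "\<And>i. 1 \<le> i \<Longrightarrow> p i \<in> {0..1}"
  shows "(\<lambda>N. \<Sum>k\<le>N. bernstein_weight p N k * (real k / real N) ^ r) \<longlonglongrightarrow> favard (chain p) (tsq ^ r)"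
proof -
  have w: "0 \<le> bernstein_weight p N k" for N k
    by (rule bernstein_weight_nonneg) (rule p)
  have bound: "\<bar>(\<Sum>k\<le>N. bernstein_weight p N k * (real k / real N) ^ r) - favard (chain p) (tsq ^ r)\<bar>
      \<le> real r * real r / real (N - r)" if "2 * r < N" for N
  proof -
    let ?w = "bernstein_weight p N"
    have "favard (chain p) (tsq ^ r) = (\<Sum>k\<le>N. ?w k * (real (k choose r) / real (N choose r)))"
      using bernstein_factorial_moment[of r N p] that
      by (simp add: sum_divide_distrib[symmetric] divide_simps)
    then have "\<bar>(\<Sum>k\<le>N. ?w k * (real k / real N) ^ r) - favard (chain p) (tsq ^ r)\<bar> =
       \<bar>\<Sum>k\<le>N. ?w k * ((real k / real N) ^ r - real (k choose r) / real (N choose r))\<bar>"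
      by (simp add: sum_subtractf algebra_simps)
    also have "\<dots> \<le> (\<Sum>k\<le>N. ?w k * (real r * real r / real (N - r)))"
    proof (rule order_trans[OF sum_abs sum_mono])
      fix k assume "k \<in> {..N}"
      then show "\<bar>?w k * ((real k / real N) ^ r - real (k choose r) / real (N choose r))\<bar>
         \<le> ?w k * (real r * real r / real (N - r))"
        unfolding abs_mult abs_of_nonneg[OF w]
        using choose_ratio_approx[of r N k] that
        by (intro mult_left_mono w) (auto simp: abs_minus_commute)
    qed
    also have "\<dots> = real r * real r / real (N - r)"
      unfolding sum_distrib_right[symmetric] bernstein_weight_sum by simp
    finally show ?thesis .
  qed
  have "(\<lambda>N. real r * real r / real (N - r)) \<longlonglongrightarrow> 0"
    by (rule LIMSEQ_offset[of _ r]) (simp add: lim_const_over_n)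
  then have "(\<lambda>N. (\<Sum>k\<le>N. bernstein_weight p N k * (real k / real N) ^ r) - favard (chain p) (tsq ^ r)) \<longlonglongrightarrow> 0"
    by (rule Lim_null_comparison[rotated])
       (use bound in \<open>auto simp: eventually_at_top_dense intro!: exI[of _ "2 * r"]\<close>)
  then show ?thesis by (simp add: LIM_zero_iff)
qed

text \<open>Hausdorff's construction: all Bernstein measures live on \<open>[a,b]\<close>, hence they are tight, and a weak
  limit has the prescribed moments.\<close>

theorem cmom_realizable:
  assumes "a < b" and p: "\<And>i. 1 \<le> i \<Longrightarrow> p i \<in> {0..1}"
  shows "\<exists>\<mu>\<in>borel_prob_on a b. \<forall>j. moment j \<mu> = cmom a b p j"
proof -
  have w: "0 \<le> bernstein_weight p N k" for N k
    by (rule bernstein_weight_nonneg) (rule p)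
  have lim_r: "(\<lambda>N. \<Sum>k\<le>N. bernstein_weight p N k * (real k / real N) ^ r) \<longlonglongrightarrow> favard (chain p) (tsq ^ r)" for r
    by (rule bernstein_moment_limit) (rule p)
  let ?x = "\<lambda>N k. a + (b - a) * (real k / real N)"
  let ?P = "\<lambda>N. point_measure {..N} (\<lambda>k. ennreal (bernstein_weight p N k))"
  define \<nu> where "\<nu> N = distr (?P N) borel (?x N)" for N :: nat
  have xin: "?x N k \<in> {a..b}" if "k \<le> N" for N k
  proof -
    have "real k / real N \<le> 1" using that by (simp add: divide_le_eq)
    then have "(b - a) * (real k / real N) \<le> (b - a) * 1"
      using assms(1) by (intro mult_left_mono) auto
    then show ?thesis using assms(1) by simp
  qed
  have prob: "prob_space (?P N)" for N
  proof
    have "emeasure (?P N) (space (?P N)) = (\<Sum>k\<le>N. ennreal (bernstein_weight p N k))"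
      by (subst emeasure_point_measure_finite) (auto simp: space_point_measure)
    also have "\<dots> = ennreal (\<Sum>k\<le>N. bernstein_weight p N k)"
      by (rule sum_ennreal) (rule w)
    finally show "emeasure (?P N) (space (?P N)) = 1"
      by (simp add: bernstein_weight_sum)
  qed
  have meas: "?x N \<in> borel_measurable (?P N)" for N
    by (simp add: point_measure_def)
  have rd: "real_distribution (\<nu> N)" for N
    unfolding \<nu>_def by (rule prob_space.real_distribution_distr[OF prob meas])
  have int: "(\<integral>x. f x \<partial>\<nu> N) = (\<Sum>k\<le>N. bernstein_weight p N k * f (?x N k))"
    if "f \<in> borel_measurable borel" for f :: "real \<Rightarrow> real" and N
    unfolding \<nu>_def
    using that meas by (simp add: integral_distr lebesgue_integral_point_measure_finite w)
  have "tight \<nu>"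
    unfolding tight_def
  proof (intro conjI allI impI rd)
    fix e :: real assume "0 < e"
    have "measure (\<nu> n) {a - 1<..b} = 1" for n
    proof -
      have "measure (\<nu> n) {a - 1<..b} = measure (?P n) (?x n -` {a - 1<..b} \<inter> space (?P n))"
        unfolding \<nu>_def by (rule measure_distr) (use meas in auto)
      also have "?x n -` {a - 1<..b} \<inter> space (?P n) = space (?P n)"
        using xin[of _ n] by (fastforce simp: space_point_measure)
      finally show ?thesis using prob_space.prob_space[OF prob] by simp
    qed
    then show "\<exists>a b. a < b \<and> (\<forall>n. 1 - e < measure (\<nu> n) {a<..b})"
      using \<open>0 < e\<close> assms(1) by (intro exI[of _ "a - 1"] exI[of _ b]) auto
  qed
  from tight_imp_convergent_subsubsequence[OF this strict_mono_id] obtain s M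
    where s: "strict_mono s" and M: "real_distribution M" and w: "weak_conv_m (\<nu> \<circ> id \<circ> s) M"
    by auto
  interpret M: real_distribution M by (rule M)
  have lim: "(\<lambda>n. \<integral>x. f x \<partial>\<nu> (s n)) \<longlonglongrightarrow> (\<integral>x. f x \<partial>M)"
    if "continuous_on UNIV f" "\<And>x. norm (f x) \<le> B" for f :: "real \<Rightarrow> real" and B
    using weak_conv_imp_integral_bdd_continuous_conv[OF _ M w, of f B] that rd
    by (auto simp: continuous_on_eq_continuous_at)
  \<comment> \<open>A bounded continuous function whose zero set is \<open>[a,b]\<close>: testing with it shows that the weak
    limit is carried by \<open>[a,b]\<close>.\<close>
  define g where "g x = min 1 (max 0 (max (a - x) (x - b)))" for x :: real
  have g: "continuous_on UNIV g" "\<And>x. norm (g x) \<le> 1" "\<And>x. 0 \<le> g x"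
    unfolding g_def by (auto intro!: continuous_intros)
  have gm: "g \<in> borel_measurable borel" by (rule borel_measurable_continuous_onI) (rule g)
  have "(\<integral>x. g x \<partial>\<nu> N) = 0" for N
    unfolding int[OF gm] using xin[of _ N] by (intro sum.neutral) (auto simp: g_def)
  then have "(\<integral>x. g x \<partial>M) = 0"
    using lim[OF g(1,2)] by (simp add: LIMSEQ_const_iff)
  then have "AE x in M. g x = 0"
    using g gm by (subst (asm) integral_nonneg_eq_0_iff_AE) (auto intro!: M.integrable_const_bound[of _ 1])
  then have AE: "AE x in M. x \<in> {a..b}"
    by eventually_elim (auto simp: g_def min_def max_def split: if_splits)
  have em: "emeasure M {a..b} = 1"
    using AE by (intro M.emeasure_eq_1_AE) auto
  define \<mu> where "\<mu> = restrict_space M {a..b}"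
  have \<mu>: "\<mu> \<in> borel_prob_on a b"
    unfolding borel_prob_on_def \<mu>_def
    using em by (auto intro!: prob_space_restrict_space sets_restrict_space_cong)
  have um: "(\<integral>x. ucoord a b x ^ r \<partial>\<mu>) = favard (chain p) (tsq ^ r)" for r
  proof -
    \<comment> \<open>The power is truncated outside \<open>[a,b]\<close> to obtain a bounded test function.\<close>
    define h where "h x = ucoord a b (max a (min b x)) ^ r" for x
    have h: "continuous_on UNIV h" unfolding h_def ucoord_def by (auto intro!: continuous_intros simp: assms less_imp_neq[symmetric])
    have h1: "norm (h x) \<le> 1" for x
      unfolding h_def ucoord_def norm_power
      by (intro power_le_one) (use assms(1) in \<open>auto simp: divide_le_eq min_def max_def\<close>)
    have hm: "h \<in> borel_measurable borel" by (rule borel_measurable_continuous_onI) (rule h)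
    have "(\<integral>x. h x \<partial>\<nu> N) = (\<Sum>k\<le>N. bernstein_weight p N k * (real k / real N) ^ r)" for N
      unfolding int[OF hm]
    proof (rule sum.cong)
      fix k assume "k \<in> {..N}"
      then have "max a (min b (?x N k)) = ?x N k" using xin[of k N] by (simp only: atMost_iff atLeastAtMost_iff) (simp add: min_def max_def)
      then show "bernstein_weight p N k * h (?x N k) = bernstein_weight p N k * (real k / real N) ^ r"
        using assms(1) unfolding h_def by (simp add: ucoord_def)
    qed simp
    then have "(\<lambda>n. \<integral>x. h x \<partial>\<nu> (s n)) \<longlonglongrightarrow> favard (chain p) (tsq ^ r)"
      using LIMSEQ_subseq_LIMSEQ[OF lim_r[of r] s] by (simp add: comp_def)
    then have "(\<integral>x. h x \<partial>M) = favard (chain p) (tsq ^ r)"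
      using LIMSEQ_unique lim[OF h h1] by blast
    moreover have "AE x in M. indicator {a..b} x *\<^sub>R ucoord a b x ^ r = h x"
      using AE by eventually_elim (simp add: h_def)
    then have "(\<integral>x. ucoord a b x ^ r \<partial>\<mu>) = (\<integral>x. h x \<partial>M)"
      unfolding \<mu>_def using hm
      by (subst integral_restrict_space) (auto intro!: integral_cong_AE simp: ucoord_def)
    ultimately show ?thesis by simp
  qed
  have "sym_moment a b \<mu> i = path_weight (chain p) i 0" for i
    using um[of "i div 2"] path_weight_odd[of i 0 "chain p"]
    by (auto simp: sym_moment_def tsq_power favard_lin)
  then have "moment j \<mu> = cmom a b p j" for j
    using lin_sym_moment_xpoly[OF assms(1) \<mu>, of j] by (simp add: cmom_def favard_lin lin_def)
  with \<mu> show ?thesis by blast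
qed

lemma slope_pos:
  assumes "a < b" "\<And>i. 1 \<le> i \<Longrightarrow> i < j \<Longrightarrow> p i \<in> {0<..<1}"
  shows "0 < slope a b p j"
proof -
  have "0 < (\<Prod>i=1..<j. p i * (1 - p i))"
    by (rule prod_pos) (use assms(2) in auto)
  then show ?thesis
    unfolding slope_def using assms(1) by simp
qed

text \<open>The bounds of \<open>next_moment_bounds\<close> are attained, since the parameters \<open>0\<close> and \<open>1\<close> are
  realizable.\<close>

theorem canonical_moment_eq:
  assumes "a < b" and j: "1 \<le> j" and p: "\<And>i. 1 \<le> i \<Longrightarrow> i < j \<Longrightarrow> p i \<in> {0<..<1}"
    and m: "\<And>i. 1 \<le> i \<Longrightarrow> i < j \<Longrightarrow> m i = cmom a b p i"
  shows "canonical_moment a b j m = (m j - cmom a b (p(j := 0)) j) / slope a b p j"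
proof -
  let ?A = "admissible_moments a b j m" and ?l = "cmom a b (p(j := 0)) j"
  have bd: "?l \<le> x \<and> x \<le> ?l + slope a b p j" if "x \<in> ?A" for x
  proof -
    from that obtain \<mu> where \<mu>: "\<mu> \<in> borel_prob_on a b" "\<forall>i\<in>{1..<j}. moment i \<mu> = m i" "x = moment j \<mu>"
      by (auto simp: admissible_moments_def)
    show ?thesis
      using next_moment_bounds[OF assms(1) \<mu>(1) j, of p] \<mu>(2,3) m by auto
  qed
  have real: "cmom a b (p(j := s)) j \<in> ?A" if "s \<in> {0..1}" for s
  proof -
    define p' where "p' i = (if i < j then p i else if i = j then s else 0)" for i
    have p': "p' i \<in> {0..1}" if "1 \<le> i" for i
      using p[of i] that \<open>s \<in> {0..1}\<close> by (auto simp: p'_def)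
    have "\<exists>\<mu>\<in>borel_prob_on a b. \<forall>i. moment i \<mu> = cmom a b p' i"
      by (rule cmom_realizable[OF assms(1)]) (rule p')
    then obtain \<mu> where \<mu>: "\<mu> \<in> borel_prob_on a b" "\<And>i. moment i \<mu> = cmom a b p' i"
      by blast
    have "moment i \<mu> = m i" if "i \<in> {1..<j}" for i
      using that m[of i] \<mu>(2)[of i] cmom_cong[of i p' p a b] by (auto simp: p'_def)
    moreover have "moment j \<mu> = cmom a b (p(j := s)) j"
      using \<mu>(2)[of j] cmom_cong[of j p' "p(j := s)" a b] by (auto simp: p'_def)
    ultimately show ?thesis
      unfolding admissible_moments_def using \<mu>(1) by (intro CollectI exI[of _ \<mu>]) auto
  qed
  have "Inf ?A = ?l"
    by (rule cInf_eq_minimum) (use real[of 0] bd in auto)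
  moreover have "Sup ?A = ?l + slope a b p j"
    using real[of 1] cmom_affine[OF j, of a b p 1] bd by (intro cSup_eq_maximum) auto
  ultimately show ?thesis by (simp add: canonical_moment_def)
qed

section \<open>Canonical coordinates on the moment space\<close>

text \<open>The inverse of \<open>cmom\<close>, computed one coordinate at a time; coordinates above \<open>n\<close> are set to
  \<open>0\<close>, so that \<open>cmom a b (params a b m n) (Suc n)\<close> is the least possible next moment.\<close>

fun params :: "real \<Rightarrow> real \<Rightarrow> (nat \<Rightarrow> real) \<Rightarrow> nat \<Rightarrow> nat \<Rightarrow> real" where
  "params a b m 0 = (\<lambda>_. 0)"
| "params a b m (Suc n) = (params a b m n)(Suc n :=
     (m (Suc n) - cmom a b (params a b m n) (Suc n)) / slope a b (params a b m n) (Suc n))"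

lemma params_above: "n < i \<Longrightarrow> params a b m n i = 0"
  by (induction n) auto

lemma params_stable: "i \<le> n \<Longrightarrow> params a b m n i = params a b m i i"
  by (induction n) (auto simp: le_Suc_eq)

lemma params_cong:
  "(\<And>i. 1 \<le> i \<Longrightarrow> i \<le> n \<Longrightarrow> m i = m' i) \<Longrightarrow> params a b m n = params a b m' n"
  by (induction n) auto

definition in_cube :: "real \<Rightarrow> real \<Rightarrow> nat \<Rightarrow> (nat \<Rightarrow> real) \<Rightarrow> bool" where
  "in_cube a b n m \<longleftrightarrow> (\<forall>j\<in>{1..n}. params a b m n j \<in> {0<..<1})"

lemma in_cube_Suc:
  "in_cube a b (Suc n) m \<longleftrightarrow> in_cube a b n m \<and> params a b m (Suc n) (Suc n) \<in> {0<..<1}"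
  unfolding in_cube_def atLeastAtMostSuc_conv[of 1 n, simplified] by auto

lemma in_cube_mono: "in_cube a b n m \<Longrightarrow> k \<le> n \<Longrightarrow> in_cube a b k m"
  using params_stable[of _ n a b m] params_stable[of _ k a b m] by (fastforce simp: in_cube_def)

lemma in_cube_cong:
  assumes "\<And>i. 1 \<le> i \<Longrightarrow> i \<le> n \<Longrightarrow> m i = m' i"
  shows "in_cube a b n m = in_cube a b n m'"
  unfolding in_cube_def using params_cong[OF assms, of n] by auto

lemma slope_params_pos:
  assumes "a < b" "in_cube a b n m"
  shows "0 < slope a b (params a b m n) (Suc n)"
  using assms by (intro slope_pos) (auto simp: in_cube_def)

lemma cmom_params:
  assumes "a < b" and "in_cube a b n m"
  shows "1 \<le> j \<Longrightarrow> j \<le> Suc n \<Longrightarrow> cmom a b (params a b m (Suc n)) j = m j"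
  using assms(2)
proof (induction n)
  case 0
  then have "j = Suc 0" by simp
  then show ?case
    using cmom_affine[of 1 a b "\<lambda>_. 0" "params a b m 1 1"] slope_params_pos[OF assms(1) 0(3)]
    by (simp add: fun_upd_def cong: if_cong)
next
  case (Suc n)
  show ?case
  proof (cases "j = Suc (Suc n)")
    case True
    let ?p = "params a b m (Suc n)"
    have 0: "?p(Suc (Suc n) := 0) = ?p"
      by (rule ext) (simp add: params_above del: params.simps)
    have "cmom a b (params a b m (Suc (Suc n))) j = cmom a b ?p j +
        ((m j - cmom a b ?p j) / slope a b ?p j) * slope a b ?p j"
      using cmom_affine[of j a b ?p] 0 True unfolding params.simps(2)[of a b m "Suc n"] by simp
    then show ?thesis
      using slope_params_pos[OF assms(1) Suc.prems(3)] True by (simp del: params.simps)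
  next
    case False
    then have "cmom a b (params a b m (Suc (Suc n))) j = cmom a b (params a b m (Suc n)) j"
      using Suc.prems by (intro cmom_cong) auto
    also have "\<dots> = m j"
      using False Suc.prems in_cube_mono[of a b "Suc n" m n] by (intro Suc.IH) auto
    finally show ?thesis .
  qed
qed

lemma params_cmom:
  assumes "a < b" and "\<And>i. 1 \<le> i \<Longrightarrow> i \<le> n \<Longrightarrow> p i \<in> {0<..<1}"
    and "\<And>i. 1 \<le> i \<Longrightarrow> i \<le> n \<Longrightarrow> m i = cmom a b p i"
  shows "1 \<le> i \<Longrightarrow> i \<le> n \<Longrightarrow> params a b m n i = p i"
  using assms(2,3)
proof (induction n arbitrary: i)
  case (Suc n)
  have IH: "params a b m n i = p i" if "1 \<le> i" "i \<le> n" for i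
    using that by (intro Suc.IH) (use Suc.prems in auto)
  show ?case
  proof (cases "i = Suc n")
    case True
    have "cmom a b (params a b m n) (Suc n) = cmom a b (p(Suc n := 0)) (Suc n)"
      by (rule cmom_cong) (use IH in \<open>auto simp: params_above le_Suc_eq\<close>)
    moreover have "slope a b (params a b m n) (Suc n) = slope a b p (Suc n)"
      by (rule slope_cong) (use IH in auto)
    moreover have "m (Suc n) = cmom a b (p(Suc n := 0)) (Suc n) + p (Suc n) * slope a b p (Suc n)"
      using cmom_affine[of "Suc n" a b p "p (Suc n)"] Suc.prems(4)[of "Suc n"] by simp
    moreover have "0 < slope a b p (Suc n)"
      by (rule slope_pos[OF assms(1)]) (use Suc.prems(3) in auto)
    ultimately show ?thesis using True by simp
  next
    case False
    then show ?thesis using Suc.prems IH[of i] by simp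
  qed
qed simp

lemma canonical_moment_params:
  assumes "a < b" "in_cube a b n m" "1 \<le> j" "j \<le> n"
  shows "canonical_moment a b j m = params a b m n j"
proof -
  obtain k where k: "j = Suc k" using assms(3) by (cases j) auto
  have c: "in_cube a b k m" using in_cube_mono[OF assms(2)] assms(4) k by simp
  let ?p = "params a b m k"
  have 0: "?p(j := 0) = ?p"
    by (rule ext) (simp add: params_above k)
  have "canonical_moment a b j m = (m j - cmom a b (?p(j := 0)) j) / slope a b ?p j"
  proof (rule canonical_moment_eq[OF assms(1,3)])
    show "?p i \<in> {0<..<1}" if "1 \<le> i" "i < j" for i
      using c that k by (auto simp: in_cube_def)
    show "m i = cmom a b ?p i" if "1 \<le> i" "i < j" for i
    proof -
      have "m i = cmom a b (params a b m (Suc k)) i"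
        using cmom_params[OF assms(1) c, of i] that k by simp
      also have "\<dots> = cmom a b ?p i" by (rule cmom_cong) (use that k in auto)
      finally show ?thesis .
    qed
  qed
  then have "canonical_moment a b j m = (m j - cmom a b ?p j) / slope a b ?p j"
    unfolding 0 .
  moreover have "params a b m n j = params a b m (Suc k) (Suc k)"
    using params_stable[OF assms(4), of a b m] k by simp
  ultimately show ?thesis by (simp add: k)
qed

section \<open>Continuity and measurability\<close>

lemma continuous_map_path_weight:
  assumes "\<And>i. 1 \<le> i \<Longrightarrow> continuous_map X euclideanreal (\<lambda>x. z x i)"
  shows "continuous_map X euclideanreal (\<lambda>x. path_weight (z x) n k)"
proof (induction n arbitrary: k)
  case (Suc n)
  then show ?case
    by (cases k) (auto intro!: continuous_map_add continuous_map_real_mult assms)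
qed (simp split: if_split)

lemma continuous_map_cmom:
  assumes "\<And>i. continuous_map X euclideanreal (\<lambda>x. p x i)"
  shows "continuous_map X euclideanreal (\<lambda>x. cmom a b (p x) j)"
proof -
  have "continuous_map X euclideanreal (\<lambda>x. chain (p x) i)" for i
    unfolding chain_def qc_def
    by (cases "i - 1 = 0") (auto intro!: continuous_map_real_mult continuous_map_diff assms)
  then show ?thesis
    unfolding cmom_def favard_lin lin_def
    by (intro continuous_map_sum continuous_map_real_mult continuous_map_path_weight) auto
qed

lemma continuous_map_slope:
  assumes "\<And>i. continuous_map X euclideanreal (\<lambda>x. p x i)"
  shows "continuous_map X euclideanreal (\<lambda>x. slope a b (p x) j)"
  unfolding slope_def
  by (auto intro!: continuous_map_real_mult continuous_map_prod continuous_map_diff assms)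

lemma measurable_path_weight:
  assumes "\<And>i. 1 \<le> i \<Longrightarrow> (\<lambda>x. z x i) \<in> borel_measurable M"
  shows "(\<lambda>x. path_weight (z x) n k :: real) \<in> borel_measurable M"
proof (induction n arbitrary: k)
  case (Suc n)
  then show ?case
    by (cases k) (auto intro!: borel_measurable_add borel_measurable_times assms)
qed (simp split: if_split)

lemma measurable_cmom:
  assumes "\<And>i. (\<lambda>x. p x i) \<in> borel_measurable M"
  shows "(\<lambda>x. cmom a b (p x) j) \<in> borel_measurable M"
proof -
  have "(\<lambda>x. chain (p x) i) \<in> borel_measurable M" for i
    unfolding chain_def qc_def using assms by (cases "i - 1 = 0") auto
  then show ?thesis
    unfolding cmom_def favard_lin lin_def
    by (intro borel_measurable_sum borel_measurable_times measurable_path_weight) auto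
qed

lemma measurable_slope:
  assumes "\<And>i. (\<lambda>x. p x i) \<in> borel_measurable M"
  shows "(\<lambda>x. slope a b (p x) j) \<in> borel_measurable M"
  unfolding slope_def using assms by auto

lemma measurable_params:
  assumes "\<And>i. 1 \<le> i \<Longrightarrow> i \<le> n \<Longrightarrow> (\<lambda>x. m x i) \<in> borel_measurable M"
  shows "(\<lambda>x. params a b (m x) n i) \<in> borel_measurable M"
  using assms
proof (induction n arbitrary: i)
  case (Suc n)
  have "(\<lambda>x. params a b (m x) n i) \<in> borel_measurable M" for i
    by (rule Suc.IH) (use Suc.prems in auto)
  then show ?case
    using Suc.prems
    by (cases "i = Suc n") (auto intro!: borel_measurable_divide borel_measurable_diff measurable_cmom measurable_slope)
qed simp

lemma tendsto_path_weight:
  assumes "\<And>i. 1 \<le> i \<Longrightarrow> ((\<lambda>x. z x i) \<longlongrightarrow> z0 i) F"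
  shows "((\<lambda>x. path_weight (z x) n k) \<longlongrightarrow> path_weight z0 n k) F"
proof (induction n arbitrary: k)
  case (Suc n)
  then show ?case
    by (cases k) (auto intro!: tendsto_intros assms)
qed simp

lemma tendsto_cmom:
  assumes "\<And>i. 1 \<le> i \<Longrightarrow> ((\<lambda>x. p x i) \<longlongrightarrow> p0 i) F"
  shows "((\<lambda>x. cmom a b (p x) j) \<longlongrightarrow> cmom a b p0 j) F"
proof -
  have "((\<lambda>x. chain (p x) i) \<longlongrightarrow> chain p0 i) F" if "1 \<le> i" for i
    unfolding chain_def qc_def
    using that by (cases "i - 1 = 0") (auto intro!: tendsto_intros assms)
  then show ?thesis
    unfolding cmom_def favard_lin lin_def
    by (intro tendsto_intros tendsto_path_weight) auto
qed

text \<open>Openness and continuity have to be proved together: the next coordinate divides by a slope that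
  is positive only where the earlier coordinates lie in the open unit interval.\<close>

lemma open_in_cube:
  assumes "a < b" "k \<le> n"
  shows "openin (Rn_top n) {m \<in> topspace (Rn_top n). in_cube a b k m} \<and>
    (\<forall>i. continuous_map (subtopology (Rn_top n) {m. in_cube a b k m}) euclideanreal (\<lambda>m. params a b m k i))"
  using assms(2)
proof (induction k)
  case 0
  have "{m \<in> topspace (Rn_top n). in_cube a b 0 m} = topspace (Rn_top n)"
    by (simp add: in_cube_def)
  then show ?case using openin_topspace[of "Rn_top n"] by simp
next
  case (Suc k)
  let ?X = "Rn_top n"
  let ?U = "\<lambda>k. {m. in_cube a b k m}"
  from Suc have op: "openin ?X {m \<in> topspace ?X. in_cube a b k m}"
    and cont: "\<And>i. continuous_map (subtopology ?X (?U k)) euclideanreal (\<lambda>m. params a b m k i)"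
    by auto
  have cont': "continuous_map (subtopology ?X (?U k)) euclideanreal (\<lambda>m. params a b m (Suc k) i)" for i
  proof (cases "i = Suc k")
    case True
    have "continuous_map (subtopology ?X (?U k)) euclideanreal
       (\<lambda>m. (m (Suc k) - cmom a b (params a b m k) (Suc k)) / slope a b (params a b m k) (Suc k))"
    proof (intro continuous_map_real_divide continuous_map_diff continuous_map_cmom continuous_map_slope cont)
      show "continuous_map (subtopology ?X (?U k)) euclideanreal (\<lambda>m. m (Suc k))"
        using Suc.prems by (intro continuous_map_from_subtopology continuous_map_product_projection) auto
      show "slope a b (params a b m k) (Suc k) \<noteq> 0" if "m \<in> topspace (subtopology ?X (?U k))" for m
        using slope_params_pos[OF assms(1), of k m] that by simp
    qed
    then show ?thesis using True by simp
  qed (use cont in simp)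
  have sub: "?U (Suc k) \<subseteq> ?U k" by (auto simp: in_cube_Suc)
  have "openin (subtopology ?X (?U k))
    {m \<in> topspace (subtopology ?X (?U k)). params a b m (Suc k) (Suc k) \<in> {0<..<1}}"
    by (rule openin_continuous_map_preimage[OF cont']) (simp flip: open_openin)
  moreover have e: "{m \<in> topspace ?X. in_cube a b k m} = topspace ?X \<inter> ?U k"
    by auto
  ultimately have "openin ?X {m \<in> topspace (subtopology ?X (?U k)). params a b m (Suc k) (Suc k) \<in> {0<..<1}}"
    using openin_trans_full[OF _ op] unfolding e subtopology_restrict by blast
  also have "{m \<in> topspace (subtopology ?X (?U k)). params a b m (Suc k) (Suc k) \<in> {0<..<1}} =
     {m \<in> topspace ?X. in_cube a b (Suc k) m}"
    by (auto simp: in_cube_Suc)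
  finally show ?case
    using continuous_map_from_subtopology_mono[OF cont' sub] by blast
qed

text \<open>Points of the open cube are moment vectors by \<open>cmom_realizable\<close>, and they form an open set.
  Conversely, around an interior point one coordinate can be moved both ways, so it cannot sit at an
  end of the interval of \<open>next_moment_bounds\<close>.\<close>

theorem interior_moment_space:
  assumes "a < b"
  shows "Rn_top n interior_of moment_space n a b = {m \<in> topspace (Rn_top n). in_cube a b n m}"
proof
  show "{m \<in> topspace (Rn_top n). in_cube a b n m} \<subseteq> Rn_top n interior_of moment_space n a b"
  proof (rule interior_of_maximal)
    show "openin (Rn_top n) {m \<in> topspace (Rn_top n). in_cube a b n m}"
      using open_in_cube[OF assms, of n n] by simp
    show "{m \<in> topspace (Rn_top n). in_cube a b n m} \<subseteq> moment_space n a b"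
    proof
      fix m assume m: "m \<in> {m \<in> topspace (Rn_top n). in_cube a b n m}"
      have "params a b m n i \<in> {0..1}" if "1 \<le> i" for i
      proof (cases "i \<le> n")
        case True
        then have "params a b m n i \<in> {0<..<1}"
          using m that unfolding in_cube_def by simp
        then show ?thesis by simp
      qed (simp add: params_above)
      then have "\<exists>\<mu>\<in>borel_prob_on a b. \<forall>j. moment j \<mu> = cmom a b (params a b m n) j"
        by (rule cmom_realizable[OF assms])
      then obtain \<mu> where \<mu>: "\<mu> \<in> borel_prob_on a b" "\<And>j. moment j \<mu> = cmom a b (params a b m n) j"
        by blast
      have "m = (\<lambda>j\<in>{1..n}. moment j \<mu>)"
      proof
        fix j
        show "m j = (\<lambda>j\<in>{1..n}. moment j \<mu>) j"
        proof (cases "j \<in> {1..n}")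
          case True
          have "m j = cmom a b (params a b m (Suc n)) j"
            using cmom_params[OF assms, of n m j] m True by simp
          also have "\<dots> = cmom a b (params a b m n) j"
            by (rule cmom_cong) (use True in auto)
          finally show ?thesis using True \<mu>(2) by simp
        next
          case False
          then show ?thesis using m by (auto simp: PiE_def extensional_def)
        qed
      qed
      with \<mu>(1) show "m \<in> moment_space n a b" by (auto simp: moment_space_def)
    qed
  qed
  show "Rn_top n interior_of moment_space n a b \<subseteq> {m \<in> topspace (Rn_top n). in_cube a b n m}"
  proof
    fix m assume m: "m \<in> Rn_top n interior_of moment_space n a b"
    let ?I = "Rn_top n interior_of moment_space n a b"
    have mt: "m \<in> topspace (Rn_top n)" by (rule subsetD[OF interior_of_subset_topspace m])
    have "k \<le> n \<Longrightarrow> in_cube a b k m" for k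
    proof (induction k)
      case 0
      then show ?case by (simp add: in_cube_def)
    next
      case (Suc k)
      then have c: "in_cube a b k m" by simp
      let ?p = "params a b m k"
      let ?l = "cmom a b ?p (Suc k)" and ?s = "slope a b ?p (Suc k)"
      have 0: "?p(Suc k := 0) = ?p"
        by (rule ext) (simp add: params_above)
      have sp: "0 < ?s" by (rule slope_params_pos[OF assms c])
      \<comment> \<open>Moving the coordinate \<open>Suc k\<close> alone must stay in the moment space for a short while.\<close>
      define line where "line y = m(Suc k := y)" for y
      have lc: "continuous_map euclideanreal (Rn_top n) line"
        unfolding continuous_map_componentwise
      proof (intro conjI ballI)
        have "m i = undefined" if "i \<notin> {1..n}" for i
          using mt that by (simp only: topspace_product_topology PiE_def extensional_def) simp
        then show "line ` topspace euclideanreal \<subseteq> extensional {1..n}"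
          using Suc.prems by (auto simp: line_def extensional_def)
        show "continuous_map euclideanreal euclideanreal (\<lambda>y. line y i)" if "i \<in> {1..n}" for i
          by (cases "i = Suc k") (auto simp: line_def)
      qed
      have "openin euclideanreal {y \<in> topspace euclideanreal. line y \<in> ?I}"
        by (rule openin_continuous_map_preimage[OF lc]) simp
      then have "open {y. line y \<in> ?I}" by (simp flip: open_openin)
      moreover have "m (Suc k) \<in> {y. line y \<in> ?I}" using m by (simp add: line_def)
      ultimately obtain e where e: "e > 0" "ball (m (Suc k)) e \<subseteq> {y. line y \<in> ?I}"
        using open_contains_ball by blast
      have rng: "?l \<le> y \<and> y \<le> ?l + ?s" if "\<bar>y - m (Suc k)\<bar> < e" for y
      proof -
        have "y \<in> ball (m (Suc k)) e" using that by (simp add: dist_real_def abs_minus_commute)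
        then have "line y \<in> ?I" using e(2) by blast
        then have "line y \<in> moment_space n a b"
          using interior_of_subset[of "Rn_top n" "moment_space n a b"] by blast
        then obtain \<mu> where \<mu>: "\<mu> \<in> borel_prob_on a b" "line y = (\<lambda>j\<in>{1..n}. moment j \<mu>)"
          by (auto simp: moment_space_def)
        have mo: "moment i \<mu> = line y i" if "i \<in> {1..n}" for i
          using \<mu>(2) that by simp
        have low: "moment i \<mu> = cmom a b ?p i" if "1 \<le> i" "i < Suc k" for i
        proof -
          have "moment i \<mu> = m i" using mo[of i] that Suc.prems by (simp add: line_def)
          also have "\<dots> = cmom a b (params a b m (Suc k)) i"
            using cmom_params[OF assms c, of i] that by simp
          also have "\<dots> = cmom a b ?p i" by (rule cmom_cong) (use that in auto)
          finally show ?thesis .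
        qed
        have "cmom a b (?p(Suc k := 0)) (Suc k) \<le> moment (Suc k) \<mu>"
          by (rule next_moment_bounds(1)[OF assms \<mu>(1)]) (simp, rule low)
        moreover have "moment (Suc k) \<mu> \<le> cmom a b (?p(Suc k := 0)) (Suc k) + ?s"
          by (rule next_moment_bounds(2)[OF assms \<mu>(1)]) (simp, rule low)
        moreover have "moment (Suc k) \<mu> = y"
          using mo[of "Suc k"] Suc.prems by (simp add: line_def)
        ultimately show ?thesis unfolding 0 by simp
      qed
      have "?l \<le> m (Suc k) - e / 2 \<and> m (Suc k) + e / 2 \<le> ?l + ?s"
        using rng[of "m (Suc k) - e / 2"] rng[of "m (Suc k) + e / 2"] e(1) by simp
      then have "0 < m (Suc k) - ?l" "m (Suc k) - ?l < ?s" using e(1) by auto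
      then have "params a b m (Suc k) (Suc k) \<in> {0<..<1}"
        using sp by simp
      then show ?case using c by (simp only: in_cube_Suc simp_thms)
    qed
    then show "m \<in> {m \<in> topspace (Rn_top n). in_cube a b n m}" using mt by simp
  qed
qed

section \<open>Change of variables\<close>

definition cmom_vec :: "real \<Rightarrow> real \<Rightarrow> nat \<Rightarrow> (nat \<Rightarrow> real) \<Rightarrow> nat \<Rightarrow> real" where
  "cmom_vec a b n p = (\<lambda>j\<in>{1..n}. cmom a b p j)"

lemma coord_measurable: "i \<in> {1..n} \<Longrightarrow> (\<lambda>m. m i) \<in> borel_measurable (Rn_leb n)"
  using measurable_component_singleton[of i "{1..n}" "\<lambda>_. lborel :: real measure"] by simp

lemma params_measurable: "k \<le> n \<Longrightarrow> (\<lambda>m. params a b m k i) \<in> borel_measurable (Rn_leb n)"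
  by (rule measurable_params) (auto intro: coord_measurable)

lemma in_cube_measurable: "k \<le> n \<Longrightarrow> Measurable.pred (Rn_leb n) (in_cube a b k)"
  unfolding in_cube_def using params_measurable[of k n a b] by simp

lemma truncated_coord_measurable:
  "(\<lambda>p. if i \<in> {1..n} then p i else 0 :: real) \<in> borel_measurable (Rn_leb n)"
  by (cases "i \<in> {1..n}") (simp_all add: coord_measurable del: atLeastAtMost_iff)

lemma cmom_measurable: "j \<le> n \<Longrightarrow> (\<lambda>p. cmom a b p j) \<in> borel_measurable (Rn_leb n)"
proof -
  assume "j \<le> n"
  have "(\<lambda>p. cmom a b (\<lambda>i. if i \<in> {1..n} then p i else 0) j) \<in> borel_measurable (Rn_leb n)"
    by (rule measurable_cmom) (rule truncated_coord_measurable)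
  also have "(\<lambda>p. cmom a b (\<lambda>i. if i \<in> {1..n} then p i else 0) j) = (\<lambda>p. cmom a b p j)"
    using \<open>j \<le> n\<close> by (intro ext cmom_cong) auto
  finally show ?thesis .
qed

lemma slope_measurable: "j \<le> Suc n \<Longrightarrow> (\<lambda>p. slope a b p j) \<in> borel_measurable (Rn_leb n)"
proof -
  assume "j \<le> Suc n"
  have "(\<lambda>p. slope a b (\<lambda>i. if i \<in> {1..n} then p i else 0) j) \<in> borel_measurable (Rn_leb n)"
    by (rule measurable_slope) (rule truncated_coord_measurable)
  also have "(\<lambda>p. slope a b (\<lambda>i. if i \<in> {1..n} then p i else 0) j) = (\<lambda>p. slope a b p j)"
    using \<open>j \<le> Suc n\<close> by (intro ext slope_cong) auto
  finally show ?thesis .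
qed

lemma cmom_vec_measurable: "cmom_vec a b n \<in> measurable (Rn_leb n) (Rn_leb n)"
  unfolding cmom_vec_def by (rule measurable_restrict) (use cmom_measurable in simp)

text \<open>The Jacobian of \<open>cmom_vec\<close> on the open cube: the map is triangular with diagonal entries
  \<open>slope\<close>.\<close>

definition cube_density :: "real \<Rightarrow> real \<Rightarrow> nat \<Rightarrow> (nat \<Rightarrow> real) \<Rightarrow> ennreal" where
  "cube_density a b n p = (\<Prod>j\<in>{1..n}. indicator {0<..<1} (p j) * ennreal (slope a b p j))"

lemma cube_density_measurable: "cube_density a b n \<in> borel_measurable (Rn_leb n)"
  unfolding cube_density_def
proof (intro borel_measurable_prod_ennreal borel_measurable_times_ennreal)
  fix i assume i: "i \<in> {1..n}"
  show "(\<lambda>x. indicator {0<..<1} (x i) :: ennreal) \<in> borel_measurable (Rn_leb n)"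
    using measurable_compose[OF coord_measurable[OF i], of "indicator {0<..<1}" borel] by simp
  show "(\<lambda>x. ennreal (slope a b x i)) \<in> borel_measurable (Rn_leb n)"
    using slope_measurable[of i n a b] i by simp
qed

text \<open>Induction on the dimension. Integrating out the last moment is an affine substitution with factor
  \<open>slope\<close>, and the remaining integral is of the same form.\<close>

theorem nn_integral_cube:
  assumes "a < b" and "f \<in> borel_measurable (Rn_leb n)"
  shows "(\<integral>\<^sup>+m. indicator {m. in_cube a b n m} m * f m \<partial>Rn_leb n) =
    (\<integral>\<^sup>+p. cube_density a b n p * f (cmom_vec a b n p) \<partial>Rn_leb n)"
  using assms(2)
proof (induction n arbitrary: f)
  case 0
  show ?case
    by (rule nn_integral_cong) (auto simp: in_cube_def cube_density_def cmom_vec_def space_PiM)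
next
  case (Suc n)
  interpret product_sigma_finite "\<lambda>_. lborel :: real measure" by standard
  have ins: "{1..Suc n} = insert (Suc n) {1..n}" by auto
  have prod: "(\<integral>\<^sup>+m. g m \<partial>Rn_leb (Suc n)) = (\<integral>\<^sup>+m. (\<integral>\<^sup>+y. g (m(Suc n := y)) \<partial>lborel) \<partial>Rn_leb n)"
    if "g \<in> borel_measurable (Rn_leb (Suc n))" for g
    using that unfolding ins by (intro product_nn_integral_insert) auto
  let ?p = "\<lambda>m. params a b m n"
  let ?l = "\<lambda>m. cmom a b (?p m) (Suc n)" and ?s = "\<lambda>m. slope a b (?p m) (Suc n)"
  define F where "F m = (\<integral>\<^sup>+s. indicator {0<..<1} s * (ennreal (?s m) * f (m(Suc n := ?l m + ?s m * s))) \<partial>lborel)" for m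
  note [measurable] = Suc.prems
  have upd: "(\<lambda>x. (fst x)(Suc n := ?l (fst x) + ?s (fst x) * snd x)) \<in> measurable (Rn_leb n \<Otimes>\<^sub>M lborel) (Rn_leb (Suc n))"
  proof -
    have [measurable]: "?l \<in> borel_measurable (Rn_leb n)"
      by (rule measurable_cmom) (rule params_measurable, simp)
    have [measurable]: "?s \<in> borel_measurable (Rn_leb n)"
      by (rule measurable_slope) (rule params_measurable, simp)
    show ?thesis
    proof (rule measurable_fun_upd[where J="{1..n}" and i="Suc n"])
      show "{1..Suc n} = {1..n} \<union> {Suc n}" by auto
      show "(\<lambda>x. ?l (fst x) + ?s (fst x) * snd x) \<in> measurable (Rn_leb n \<Otimes>\<^sub>M lborel) lborel"
        by measurable
    qed measurable
  qed
  have Fm: "F \<in> borel_measurable (Rn_leb n)"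
  proof -
    have [measurable]: "?s \<in> borel_measurable (Rn_leb n)"
      by (rule measurable_slope) (rule params_measurable, simp)
    have [measurable]: "(\<lambda>x. f ((fst x)(Suc n := ?l (fst x) + ?s (fst x) * snd x))) \<in> borel_measurable (Rn_leb n \<Otimes>\<^sub>M lborel)"
      by (rule measurable_compose[OF upd Suc.prems])
    have "(\<lambda>x. indicator {0<..<1} (snd x) * (ennreal (?s (fst x)) * f ((fst x)(Suc n := ?l (fst x) + ?s (fst x) * snd x))))
       \<in> borel_measurable (Rn_leb n \<Otimes>\<^sub>M lborel)"
      by measurable
    then show ?thesis
      unfolding F_def by (intro lborel.borel_measurable_nn_integral) (simp add: case_prod_beta)
  qed
  \<comment> \<open>For a point of the lower-dimensional cube, the admissible values of the last moment form an
    interval, and the last canonical moment is its affine coordinate.\<close>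
  have cube: "in_cube a b (Suc n) (m(Suc n := y)) \<longleftrightarrow> in_cube a b n m \<and> (y - ?l m) / ?s m \<in> {0<..<1}" for m y
  proof -
    have "params a b (m(Suc n := y)) n = ?p m" by (rule params_cong) auto
    moreover have "in_cube a b n (m(Suc n := y)) = in_cube a b n m" by (rule in_cube_cong) auto
    ultimately show ?thesis by (simp add: in_cube_Suc)
  qed
  have "(\<integral>\<^sup>+m. indicator {m. in_cube a b (Suc n) m} m * f m \<partial>Rn_leb (Suc n)) =
     (\<integral>\<^sup>+m. (\<integral>\<^sup>+y. indicator {m. in_cube a b (Suc n) m} (m(Suc n := y)) * f (m(Suc n := y)) \<partial>lborel) \<partial>Rn_leb n)"
  proof (rule prod, intro borel_measurable_times_ennreal Suc.prems borel_measurable_indicator')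
    show "{x \<in> space (Rn_leb (Suc n)). x \<in> {m. in_cube a b (Suc n) m}} \<in> sets (Rn_leb (Suc n))"
      using in_cube_measurable[of "Suc n" "Suc n" a b] by (simp add: pred_def)
  qed
  also have "\<dots> = (\<integral>\<^sup>+m. indicator {m. in_cube a b n m} m * F m \<partial>Rn_leb n)"
  proof (rule nn_integral_cong)
    fix m assume m: "m \<in> space (Rn_leb n)"
    show "(\<integral>\<^sup>+y. indicator {m. in_cube a b (Suc n) m} (m(Suc n := y)) * f (m(Suc n := y)) \<partial>lborel) =
      indicator {m. in_cube a b n m} m * F m"
    proof (cases "in_cube a b n m")
      case False
      then show ?thesis by (simp add: cube indicator_def)
    next
      case True
      have sp: "0 < ?s m" by (rule slope_params_pos[OF assms(1) True])
      have mf: "(\<lambda>y. f (m(Suc n := y))) \<in> borel_measurable borel"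
      proof -
        have "(\<lambda>y. m(Suc n := y)) \<in> measurable lborel (Rn_leb (Suc n))"
          unfolding ins by (rule measurable_component_update) (use m in auto)
        from measurable_compose[OF this Suc.prems] show ?thesis
          by (simp only: measurable_lborel1 measurable_lborel2)
      qed
      have "(\<integral>\<^sup>+y. indicator {m. in_cube a b (Suc n) m} (m(Suc n := y)) * f (m(Suc n := y)) \<partial>lborel) =
        (\<integral>\<^sup>+y. indicator {0<..<1} ((y - ?l m) / ?s m) * f (m(Suc n := y)) \<partial>lborel)"
        using True by (intro nn_integral_cong) (simp add: cube indicator_def)
      also have "\<dots> = ennreal \<bar>?s m\<bar> * (\<integral>\<^sup>+s. indicator {0<..<1} ((?l m + ?s m * s - ?l m) / ?s m) * f (m(Suc n := ?l m + ?s m * s)) \<partial>lborel)"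
        using sp mf by (intro nn_integral_real_affine) (auto intro!: borel_measurable_times_ennreal)
      also have "\<dots> = (\<integral>\<^sup>+s. ennreal (?s m) * (indicator {0<..<1} s * f (m(Suc n := ?l m + ?s m * s))) \<partial>lborel)"
      proof -
        have "(\<lambda>s. f (m(Suc n := ?l m + ?s m * s))) \<in> borel_measurable borel"
          by (rule measurable_compose[OF _ mf]) simp
        then show ?thesis using sp by (simp add: nn_integral_cmult)
      qed
      also have "\<dots> = F m" unfolding F_def by (simp add: mult_ac)
      finally show ?thesis using True by simp
    qed
  qed
  also have "\<dots> = (\<integral>\<^sup>+p. cube_density a b n p * F (cmom_vec a b n p) \<partial>Rn_leb n)"
    by (rule Suc.IH[OF Fm])
  also have "\<dots> = (\<integral>\<^sup>+p. (\<integral>\<^sup>+s. cube_density a b (Suc n) (p(Suc n := s)) * f (cmom_vec a b (Suc n) (p(Suc n := s))) \<partial>lborel) \<partial>Rn_leb n)"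
  proof (rule nn_integral_cong)
    fix p assume p: "p \<in> space (Rn_leb n)"
    have split: "cube_density a b (Suc n) (p(Suc n := s)) =
      cube_density a b n p * (indicator {0<..<1} s * ennreal (slope a b p (Suc n)))" for s
    proof -
      have "cube_density a b n (p(Suc n := s)) = cube_density a b n p"
        unfolding cube_density_def
        by (intro prod.cong arg_cong2[where f="(*)"] arg_cong[where f=ennreal] slope_cong) auto
      moreover have "slope a b (p(Suc n := s)) (Suc n) = slope a b p (Suc n)"
        by (rule slope_cong) auto
      ultimately show ?thesis
        unfolding cube_density_def ins by (simp add: mult_ac)
    qed
    show "cube_density a b n p * F (cmom_vec a b n p) =
      (\<integral>\<^sup>+s. cube_density a b (Suc n) (p(Suc n := s)) * f (cmom_vec a b (Suc n) (p(Suc n := s))) \<partial>lborel)"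
    proof (cases "\<forall>j\<in>{1..n}. p j \<in> {0<..<1}")
      case False
      then have "cube_density a b n p = 0" by (auto simp: cube_density_def indicator_def)
      then show ?thesis by (simp add: split)
    next
      case True
      let ?m = "cmom_vec a b n p"
      have pe: "?p ?m i = p i" if "1 \<le> i" "i \<le> n" for i
        by (rule params_cmom[OF assms(1)]) (use True that in \<open>auto simp: cmom_vec_def\<close>)
      have l: "?l ?m = cmom a b (p(Suc n := 0)) (Suc n)"
        by (rule cmom_cong) (use pe in \<open>auto simp: params_above le_Suc_eq\<close>)
      have s: "?s ?m = slope a b p (Suc n)"
        by (rule slope_cong) (use pe in auto)
      have vec: "cmom_vec a b (Suc n) (p(Suc n := s)) = ?m(Suc n := ?l ?m + ?s ?m * s)" for s
      proof
        fix j
        show "cmom_vec a b (Suc n) (p(Suc n := s)) j = (?m(Suc n := ?l ?m + ?s ?m * s)) j"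
          using cmom_affine[of "Suc n" a b p s] l s cmom_cong[of j "p(Suc n := s)" p a b]
          by (cases "j = Suc n") (auto simp: cmom_vec_def mult.commute)
      qed
      have "(\<integral>\<^sup>+s. cube_density a b (Suc n) (p(Suc n := s)) * f (cmom_vec a b (Suc n) (p(Suc n := s))) \<partial>lborel) =
        (\<integral>\<^sup>+s. cube_density a b n p * (indicator {0<..<1} s * (ennreal (?s ?m) * f (?m(Suc n := ?l ?m + ?s ?m * s)))) \<partial>lborel)"
        unfolding split vec s by (simp add: mult_ac)
      also have "\<dots> = cube_density a b n p * F ?m"
        unfolding F_def
      proof (rule nn_integral_cmult)
        have "?m \<in> space (Rn_leb n)" using measurable_space[OF cmom_vec_measurable p] .
        then have "(\<lambda>s. (?m, s)) \<in> measurable lborel (Rn_leb n \<Otimes>\<^sub>M lborel)" by simp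
        from measurable_compose[OF this measurable_compose[OF upd Suc.prems]]
        have "(\<lambda>s. f (?m(Suc n := ?l ?m + ?s ?m * s))) \<in> borel_measurable lborel"
          by (simp only: fst_conv snd_conv)
        then show "(\<lambda>s. indicator {0<..<1} s * (ennreal (?s ?m) * f (?m(Suc n := ?l ?m + ?s ?m * s)))) \<in> borel_measurable lborel"
          by (intro borel_measurable_times_ennreal) auto
      qed
      finally show ?thesis by simp
    qed
  qed
  also have "\<dots> = (\<integral>\<^sup>+p. cube_density a b (Suc n) p * f (cmom_vec a b (Suc n) p) \<partial>Rn_leb (Suc n))"
    by (rule prod[symmetric])
       (intro borel_measurable_times_ennreal cube_density_measurable measurable_compose[OF cmom_vec_measurable Suc.prems])
  finally show ?case .
qed

section \<open>Laplace bounds in one variable\<close>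

text \<open>The density of the \<open>i\<close>-th canonical moment up to normalization. The factor \<open>p (1 - p)\<close> enters the
  Jacobian once for each of the \<open>n - i\<close> higher moments.\<close>

definition coord_weight :: "(real \<Rightarrow> real) \<Rightarrow> nat \<Rightarrow> nat \<Rightarrow> real \<Rightarrow> ennreal" where
  "coord_weight V n i p = indicator {0<..<1} p * ennreal ((p * (1 - p)) ^ (n - i) * exp (- real n * V p))"

lemma coord_weight_measurable:
  assumes "continuous_on UNIV V"
  shows "coord_weight V n i \<in> borel_measurable borel"
proof -
  have "continuous_on UNIV (\<lambda>p. (p * (1 - p)) ^ (n - i) * exp (- real n * V p))"
    by (intro continuous_intros assms)
  then have "(\<lambda>p. (p * (1 - p)) ^ (n - i) * exp (- real n * V p)) \<in> borel_measurable borel"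
    by (rule borel_measurable_continuous_onI)
  then show ?thesis
    unfolding coord_weight_def by measurable
qed

lemma unique_minimizerD:
  fixes f :: "'a \<Rightarrow> real"
  assumes "unique_minimizer f S x"
  shows "x \<in> S" and "y \<in> S \<Longrightarrow> y \<noteq> x \<Longrightarrow> f x < f y"
proof -
  have x: "is_arg_min f (\<lambda>z. z \<in> S) x"
    using assms unfolding unique_minimizer_def by simp
  then show "x \<in> S" by (simp add: is_arg_min_def)
  show "f x < f y" if "y \<in> S" "y \<noteq> x"
  proof (rule ccontr)
    assume "\<not> f x < f y"
    then have "is_arg_min f (\<lambda>z. z \<in> S) y"
      using x that unfolding is_arg_min_def by force
    then show False using assms that unfolding unique_minimizer_def by blast
  qed
qed

text \<open>With \<open>g = exp (- W_of V)\<close> the weight is \<open>g\<^sup>n\<^sup>-\<^sup>i exp (- i V)\<close>. By compactness \<open>g\<close> stays below some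
  \<open>g1 < g s\<close> away from \<open>s\<close>, and it exceeds a larger value \<open>g2\<close> near \<open>s\<close>, which gives the ratio
  \<open>g1 / g2\<close>.\<close>

lemma laplace_tail:
  assumes V: "continuous_on UNIV V" and min: "unique_minimizer (W_of V) {0<..<1} s" and e: "0 < e"
  shows "\<exists>C \<kappa>. 0 \<le> C \<and> 0 \<le> \<kappa> \<and> \<kappa> < 1 \<and> (\<forall>n\<ge>i.
    (\<integral>\<^sup>+p. coord_weight V n i p * indicator {p. e \<le> \<bar>p - s\<bar>} p \<partial>lborel) \<le>
    ennreal (C * \<kappa> ^ (n - i)) * (\<integral>\<^sup>+p. coord_weight V n i p \<partial>lborel))"
proof -
  define g where "g p = p * (1 - p) * exp (- V p)" for p :: real
  have s: "s \<in> {0<..<1}" by (rule unique_minimizerD[OF min])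
  have gcont: "continuous_on A g" for A
    unfolding g_def by (intro continuous_intros continuous_on_subset[OF V]) auto
  have gW: "g p = exp (- W_of V p)" if "p \<in> {0<..<1}" for p
    using that by (simp add: g_def W_of_def exp_diff exp_minus divide_simps)
  have gless: "g p < g s" if "p \<in> {0..1}" "p \<noteq> s" for p
  proof (cases "p \<in> {0<..<1}")
    case True
    then show ?thesis using unique_minimizerD(2)[OF min True that(2)] s by (simp add: gW)
  next
    case False
    then have "p = 0 \<or> p = 1" using that(1) by auto
    then show ?thesis using s by (auto simp: g_def)
  qed
  have gnn: "0 \<le> g p" if "p \<in> {0..1}" for p using that by (simp add: g_def)
  obtain g1 where g1: "0 \<le> g1" "g1 < g s" "\<And>p. p \<in> {0..1} \<Longrightarrow> e \<le> \<bar>p - s\<bar> \<Longrightarrow> g p \<le> g1"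
  proof (cases "{p \<in> {0..1}. e \<le> \<bar>p - s\<bar>} = {}")
    case True
    then show ?thesis using that[of 0] gnn[of 0] gless[of 0] s by (auto simp: g_def)
  next
    case False
    have "{p \<in> {0..1}. e \<le> \<bar>p - s\<bar>} = {0..1} \<inter> {p. e \<le> \<bar>p - s\<bar>}" by auto
    moreover have "closed {p. e \<le> \<bar>p - s\<bar>}"
      by (intro closed_Collect_le continuous_intros)
    ultimately have "compact {p \<in> {0..1}. e \<le> \<bar>p - s\<bar>}"
      by (simp add: compact_Int_closed)
    from continuous_attains_sup[OF this False gcont] obtain x
      where x: "x \<in> {0..1}" "e \<le> \<bar>x - s\<bar>" "\<And>y. y \<in> {0..1} \<Longrightarrow> e \<le> \<bar>y - s\<bar> \<Longrightarrow> g y \<le> g x" by auto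
    show ?thesis
      by (rule that[of "g x"]) (use x gnn gless[of x] e in auto)
  qed
  \<comment> \<open>Any level strictly between \<open>g1\<close> and \<open>g s\<close> would do.\<close>
  define g2 where "g2 = (g1 + g s) / 2"
  have g2: "g1 < g2" "g2 < g s" "0 < g2" using g1 by (auto simp: g2_def)
  have "open ({0<..<1} \<inter> {p. g2 < g p})"
    by (intro open_Int open_greaterThanLessThan open_Collect_less gcont continuous_on_const)
  moreover have "s \<in> {0<..<1} \<inter> {p. g2 < g p}" using s g2 by simp
  ultimately obtain d where d: "d > 0" "ball s d \<subseteq> {0<..<1} \<inter> {p. g2 < g p}"
    using open_contains_ball by blast
  have "compact (V ` {0..1})"
    by (rule compact_continuous_image[OF continuous_on_subset[OF V]]) auto
  then obtain B where "\<forall>y\<in>V ` {0..1}. norm y \<le> B"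
    using compact_imp_bounded[of "V ` {0..1}"] unfolding bounded_iff by blast
  then have B: "\<bar>V x\<bar> \<le> B" if "x \<in> {0..1}" for x
    using that by simp
  \<comment> \<open>The factor \<open>exp (- i V)\<close> varies at most by \<open>exp (2 * i * B)\<close>, and \<open>2 * d\<close> is the length of the
    interval on which \<open>g > g2\<close>.\<close>
  define C where "C = exp (2 * real i * B) / (2 * d)"
  show ?thesis
  proof (rule exI[of _ C], rule exI[of _ "g1 / g2"], intro conjI allI impI)
    fix n assume n: "i \<le> n"
    have split: "(p * (1 - p)) ^ (n - i) * exp (- real n * V p) = g p ^ (n - i) * exp (- real i * V p)" for p
    proof -
      have "exp (- real n * V p) = exp (- V p) ^ (n - i) * exp (- real i * V p)"
        using n by (simp add: exp_of_nat_mult[symmetric] exp_add[symmetric] of_nat_diff algebra_simps)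
      then show ?thesis by (simp add: g_def power_mult_distrib)
    qed
    have ebound: "exp (- real i * B) \<le> exp (- real i * V p)" "exp (- real i * V p) \<le> exp (real i * B)"
      if "p \<in> {0..1}" for p
    proof -
      have "\<bar>real i * V p\<bar> \<le> real i * B"
        using B[OF that] by (simp add: abs_mult mult_left_mono)
      then have "real i * V p \<le> real i * B" "- (real i * V p) \<le> real i * B"
        by (auto simp: abs_le_iff)
      then show "exp (- real i * B) \<le> exp (- real i * V p)" "exp (- real i * V p) \<le> exp (real i * B)"
        by auto
    qed
    have "(\<integral>\<^sup>+p. coord_weight V n i p * indicator {p. e \<le> \<bar>p - s\<bar>} p \<partial>lborel) \<le>
        (\<integral>\<^sup>+p. ennreal (g1 ^ (n - i) * exp (real i * B)) * indicator {0..1::real} p \<partial>lborel)"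
    proof (rule nn_integral_mono)
      fix p :: real
      show "coord_weight V n i p * indicator {p. e \<le> \<bar>p - s\<bar>} p \<le>
          ennreal (g1 ^ (n - i) * exp (real i * B)) * indicator {0..1} p"
      proof (cases "p \<in> {0<..<1} \<and> e \<le> \<bar>p - s\<bar>")
        case True
        then have "g p ^ (n - i) * exp (- real i * V p) \<le> g1 ^ (n - i) * exp (real i * B)"
          using g1(3)[of p] gnn[of p] g1(1) ebound[of p] by (intro mult_mono power_mono) auto
        then show ?thesis
          using True unfolding coord_weight_def split by (auto intro: ennreal_leI)
      qed (auto simp: coord_weight_def indicator_def)
    qed
    also have "\<dots> = ennreal (g1 ^ (n - i) * exp (real i * B))"
      by (subst nn_integral_cmult) auto
    also have "\<dots> = ennreal (C * (g1 / g2) ^ (n - i) * (g2 ^ (n - i) * exp (- real i * B) * (2 * d)))"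
    proof -
      have "exp (2 * real i * B) * exp (- real i * B) = exp (real i * B)"
        by (simp flip: exp_add)
      moreover have "(g1 / g2) ^ (n - i) * g2 ^ (n - i) = g1 ^ (n - i)"
        using g2(3) by (simp flip: power_mult_distrib)
      moreover have "C * (g1 / g2) ^ (n - i) * (g2 ^ (n - i) * exp (- real i * B) * (2 * d)) =
          ((g1 / g2) ^ (n - i) * g2 ^ (n - i)) * (exp (2 * real i * B) * exp (- real i * B))"
        using d(1) by (simp add: C_def)
      ultimately show ?thesis by simp
    qed
    also have "\<dots> = ennreal (C * (g1 / g2) ^ (n - i)) * (\<integral>\<^sup>+p. ennreal (g2 ^ (n - i) * exp (- real i * B)) * indicator (ball s d) p \<partial>lborel)"
    proof -
      have "emeasure lborel (ball s d) = ennreal (2 * d)"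
        using d(1) by (simp add: ball_eq_greaterThanLessThan)
      then have i: "(\<integral>\<^sup>+p. ennreal (g2 ^ (n - i) * exp (- real i * B)) * indicator (ball s d) p \<partial>lborel) =
         ennreal (g2 ^ (n - i) * exp (- real i * B) * (2 * d))"
        using g2 d(1) by (subst nn_integral_cmult_indicator) (simp_all flip: ennreal_mult)
      show ?thesis
        unfolding i using g1 g2 d(1) by (intro ennreal_mult) (auto simp: C_def)
    qed
    also have "\<dots> \<le> ennreal (C * (g1 / g2) ^ (n - i)) * (\<integral>\<^sup>+p. coord_weight V n i p \<partial>lborel)"
    proof (intro mult_left_mono nn_integral_mono)
      fix p :: real
      show "ennreal (g2 ^ (n - i) * exp (- real i * B)) * indicator (ball s d) p \<le> coord_weight V n i p"
      proof (cases "p \<in> ball s d")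
        case True
        then have p: "p \<in> {0<..<1}" "g2 < g p" using d(2) by auto
        then have "g2 ^ (n - i) * exp (- real i * B) \<le> g p ^ (n - i) * exp (- real i * V p)"
          using ebound[of p] g2(3) by (intro mult_mono power_mono) auto
        then show ?thesis
          using p True unfolding coord_weight_def split by (auto intro: ennreal_leI)
      qed simp
    qed simp
    finally show "(\<integral>\<^sup>+p. coord_weight V n i p * indicator {p. e \<le> \<bar>p - s\<bar>} p \<partial>lborel) \<le>
      ennreal (C * (g1 / g2) ^ (n - i)) * (\<integral>\<^sup>+p. coord_weight V n i p \<partial>lborel)" .
  qed (use g1 g2 d in \<open>auto simp: C_def\<close>)
qed

section \<open>The law of the canonical moments\<close>

lemma sum_odd_even:
  fixes g :: "nat \<Rightarrow> real"
  shows "(\<Sum>i=1..n. g i) = (\<Sum>j=1..(n + 1) div 2. g (2 * j - 1)) + (\<Sum>j=1..n div 2. g (2 * j))"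
proof (induction n)
  case (Suc n)
  show ?case
  proof (cases "even n")
    case True
    then obtain k where "n = 2 * k" by blast
    then show ?thesis using Suc by simp
  next
    case False
    then obtain k where "n = 2 * k + 1" using oddE by blast
    then show ?thesis using Suc by simp
  qed
qed simp

text \<open>The periodic sequence \<open>x, y, x, y, \<dots>\<close> starting at index \<open>1\<close>.\<close>

definition alternate :: "'a \<Rightarrow> 'a \<Rightarrow> nat \<Rightarrow> 'a" where
  "alternate x y i = (if odd i then x else y)"

text \<open>The potentials are evaluated only on the open unit interval, so they may be replaced by functions
  \<open>U1\<close>, \<open>U2\<close> that are continuous on the whole line.\<close>

lemma moment_weight_eq:
  assumes "a < b" and m: "m \<in> space (Rn_leb n)"
    and U: "\<And>p. p \<in> {0<..<1} \<Longrightarrow> U1 p = V1 p" "\<And>p. p \<in> {0<..<1} \<Longrightarrow> U2 p = V2 p"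
  shows "moment_weight n a b V1 V2 m = indicator {m. in_cube a b n m} m *
    ennreal (\<Prod>i\<in>{1..n}. exp (- real n * alternate U1 U2 i (params a b m n i)))"
proof (cases "in_cube a b n m")
  case True
  have "m \<in> topspace (Rn_top n)" using m by (auto simp: space_PiM)
  then have mi: "m \<in> Rn_top n interior_of moment_space n a b"
    using True unfolding interior_moment_space[OF assms(1)] by simp
  let ?g = "\<lambda>i. alternate U1 U2 i (params a b m n i)"
  have c: "canonical_moment a b i m = params a b m n i" "params a b m n i \<in> {0<..<1}" if "i \<in> {1..n}" for i
    using canonical_moment_params[OF assms(1) True, of i] True that by (auto simp: in_cube_def)
  have s1: "(\<Sum>j=1..(n + 1) div 2. V1 (canonical_moment a b (2 * j - 1) m)) = (\<Sum>j=1..(n + 1) div 2. ?g (2 * j - 1))"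
  proof (rule sum.cong)
    fix j assume "j \<in> {1..(n + 1) div 2}"
    then have j: "2 * j - 1 \<in> {1..n}" "odd (2 * j - 1)" by auto
    show "V1 (canonical_moment a b (2 * j - 1) m) = ?g (2 * j - 1)"
      using c[OF j(1)] U(1)[OF c(2)[OF j(1)]] j(2) by (simp only: alternate_def if_True not_False_eq_True)
  qed simp
  have s2: "(\<Sum>j=1..n div 2. V2 (canonical_moment a b (2 * j) m)) = (\<Sum>j=1..n div 2. ?g (2 * j))"
  proof (rule sum.cong)
    fix j assume "j \<in> {1..n div 2}"
    then have j: "2 * j \<in> {1..n}" "even (2 * j)" by auto
    show "V2 (canonical_moment a b (2 * j) m) = ?g (2 * j)"
      using c[OF j(1)] U(2)[OF c(2)[OF j(1)]] j(2) by (simp add: alternate_def)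
  qed simp
  have "- real n * (\<Sum>j=1..(n + 1) div 2. V1 (canonical_moment a b (2 * j - 1) m))
      - real n * (\<Sum>j=1..n div 2. V2 (canonical_moment a b (2 * j) m)) = (\<Sum>i=1..n. - real n * ?g i)"
    unfolding s1 s2 sum_distrib_left[symmetric] sum_odd_even[of ?g n] by (simp add: algebra_simps)
  then show ?thesis using True mi by (simp add: moment_weight_def exp_sum)
next
  case False
  then have "m \<notin> Rn_top n interior_of moment_space n a b"
    unfolding interior_moment_space[OF assms(1)] by simp
  then show ?thesis using False by (simp add: moment_weight_def)
qed

lemma prod_slope:
  "(\<Prod>j\<in>{1..n}. slope a b p j) = (\<Prod>i\<in>{1..n}. (b - a) ^ i * (p i * (1 - p i)) ^ (n - i))"
proof -
  have *: "(\<Prod>j\<in>{1..n}. \<Prod>i=1..<j. x i) = (\<Prod>i\<in>{1..n}. x i ^ (n - i))" for x :: "nat \<Rightarrow> real"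
  proof (induction n)
    case (Suc n)
    have "(\<Prod>j\<in>{1..Suc n}. \<Prod>i=1..<j. x i) = (\<Prod>i\<in>{1..n}. x i ^ (n - i)) * (\<Prod>i\<in>{1..n}. x i)"
      using Suc by (simp add: atLeastLessThanSuc_atLeastAtMost)
    also have "\<dots> = (\<Prod>i\<in>{1..n}. x i ^ (Suc n - i))"
      unfolding prod.distrib[symmetric] by (intro prod.cong) (auto simp: Suc_diff_le)
    finally show ?case by simp
  qed simp
  show ?thesis
    unfolding slope_def prod.distrib[of "\<lambda>i. (b - a) ^ i"] * ..
qed

text \<open>Both the weight and the Jacobian are products over the canonical moments, so the integral
  factorizes. This is the independence of the canonical moments.\<close>

lemma weight_integral_coord:
  assumes "a < b" and U: "continuous_on UNIV U1" "continuous_on UNIV U2"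
    and UV: "\<And>p. p \<in> {0<..<1} \<Longrightarrow> U1 p = V1 p" "\<And>p. p \<in> {0<..<1} \<Longrightarrow> U2 p = V2 p"
    and B: "\<And>i. B i \<in> sets borel"
  shows "(\<integral>\<^sup>+m. moment_weight n a b V1 V2 m * (\<Prod>i\<in>{1..n}. indicator (B i) (params a b m n i)) \<partial>Rn_leb n) =
    (\<Prod>i\<in>{1..n}. ennreal ((b - a) ^ i) * (\<integral>\<^sup>+p. coord_weight (alternate U1 U2 i) n i p * indicator (B i) p \<partial>lborel))"
proof -
  interpret product_sigma_finite "\<lambda>_. lborel :: real measure" by standard
  let ?U = "alternate U1 U2"
  have Uc: "continuous_on UNIV (?U i)" for i using U by (simp add: alternate_def)
  have Um: "?U i \<in> borel_measurable borel" for i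
    by (rule borel_measurable_continuous_onI[OF Uc])
  let ?f = "\<lambda>m. ennreal (\<Prod>i\<in>{1..n}. exp (- real n * ?U i (params a b m n i))) *
       (\<Prod>i\<in>{1..n}. indicator (B i) (params a b m n i))"
  have fm: "?f \<in> borel_measurable (Rn_leb n)"
  proof (intro borel_measurable_times_ennreal borel_measurable_prod_ennreal)
    have 1: "(\<lambda>m. ?U i (params a b m n i)) \<in> borel_measurable (Rn_leb n)" for i
      using measurable_compose[OF params_measurable Um] by blast
    show "(\<lambda>m. ennreal (\<Prod>i\<in>{1..n}. exp (- real n * ?U i (params a b m n i)))) \<in> borel_measurable (Rn_leb n)"
      by (intro measurable_compose[OF _ measurable_ennreal] borel_measurable_prod
           measurable_compose[OF _ borel_measurable_exp] borel_measurable_times borel_measurable_const 1)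
    show "(\<lambda>m. indicator (B i) (params a b m n i) :: ennreal) \<in> borel_measurable (Rn_leb n)" for i
      by (rule measurable_compose[OF params_measurable borel_measurable_indicator[OF B]]) simp
  qed
  have "(\<integral>\<^sup>+m. moment_weight n a b V1 V2 m * (\<Prod>i\<in>{1..n}. indicator (B i) (params a b m n i)) \<partial>Rn_leb n) =
     (\<integral>\<^sup>+m. indicator {m. in_cube a b n m} m * ?f m \<partial>Rn_leb n)"
    by (intro nn_integral_cong) (simp only: moment_weight_eq[OF assms(1) _ UV] mult.assoc)
  also have "\<dots> = (\<integral>\<^sup>+p. cube_density a b n p * ?f (cmom_vec a b n p) \<partial>Rn_leb n)"
    by (rule nn_integral_cube[OF assms(1) fm])
  also have "\<dots> = (\<integral>\<^sup>+p. (\<Prod>i\<in>{1..n}. ennreal ((b - a) ^ i) * (coord_weight (?U i) n i (p i) * indicator (B i) (p i))) \<partial>Rn_leb n)"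
  proof (rule nn_integral_cong)
    fix p :: "nat \<Rightarrow> real"
    show "cube_density a b n p * ?f (cmom_vec a b n p) =
      (\<Prod>i\<in>{1..n}. ennreal ((b - a) ^ i) * (coord_weight (?U i) n i (p i) * indicator (B i) (p i)))"
    proof (cases "\<forall>i\<in>{1..n}. p i \<in> {0<..<1}")
      case False
      then obtain i where i: "i \<in> {1..n}" "p i \<notin> {0<..<1}" by blast
      then have "cube_density a b n p = 0"
        unfolding cube_density_def by (intro prod_zero) (auto intro!: bexI[of _ i])
      moreover have "(\<Prod>i\<in>{1..n}. ennreal ((b - a) ^ i) * (coord_weight (?U i) n i (p i) * indicator (B i) (p i))) = 0"
        using i by (intro prod_zero) (auto intro!: bexI[of _ i] simp: coord_weight_def)
      ultimately show ?thesis by simp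
    next
      case True
      have pe: "params a b (cmom_vec a b n p) n i = p i" if "i \<in> {1..n}" for i
        by (rule params_cmom[OF assms(1)]) (use True that in \<open>auto simp: cmom_vec_def\<close>)
      have sl: "0 \<le> slope a b p j" if "j \<in> {1..n}" for j
        by (rule less_imp_le, rule slope_pos[OF assms(1)]) (use True that in auto)
      have pq: "0 \<le> p i * (1 - p i)" if "i \<in> {1..n}" for i
      proof -
        have "0 < p i" "p i < 1" using True that by auto
        then show ?thesis by simp
      qed
      have "cube_density a b n p = ennreal (\<Prod>j\<in>{1..n}. slope a b p j)"
        unfolding cube_density_def using True sl
        by (subst prod_ennreal[symmetric]) (auto intro!: prod.cong)
      also have "\<dots> = (\<Prod>i\<in>{1..n}. ennreal ((b - a) ^ i) * ennreal ((p i * (1 - p i)) ^ (n - i)))"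
        unfolding prod_slope using assms(1) pq
        by (subst prod_ennreal[symmetric]) (auto intro!: prod.cong ennreal_mult)
      finally have c: "cube_density a b n p = \<dots>" .
      have f: "?f (cmom_vec a b n p) = (\<Prod>i\<in>{1..n}. ennreal (exp (- real n * ?U i (p i))) * indicator (B i) (p i))"
        using pe by (simp add: prod_ennreal[symmetric] prod.distrib)
      show ?thesis
        unfolding c f prod.distrib[symmetric]
      proof (rule prod.cong)
        fix i assume i: "i \<in> {1..n}"
        have "ennreal ((p i * (1 - p i)) ^ (n - i) * exp (- real n * ?U i (p i))) =
            ennreal ((p i * (1 - p i)) ^ (n - i)) * ennreal (exp (- real n * ?U i (p i)))"
          using pq[OF i] by (intro ennreal_mult) auto
        then show "ennreal ((b - a) ^ i) * ennreal ((p i * (1 - p i)) ^ (n - i)) *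
            (ennreal (exp (- real n * ?U i (p i))) * indicator (B i) (p i)) =
            ennreal ((b - a) ^ i) * (coord_weight (?U i) n i (p i) * indicator (B i) (p i))"
          using True i by (simp add: coord_weight_def mult.assoc)
      qed simp
    qed
  qed
  also have "\<dots> = (\<Prod>i\<in>{1..n}. \<integral>\<^sup>+p. ennreal ((b - a) ^ i) * (coord_weight (?U i) n i p * indicator (B i) p) \<partial>lborel)"
    by (rule product_nn_integral_prod)
       (auto intro!: borel_measurable_times_ennreal coord_weight_measurable Uc borel_measurable_indicator B)
  also have "\<dots> = (\<Prod>i\<in>{1..n}. ennreal ((b - a) ^ i) * (\<integral>\<^sup>+p. coord_weight (?U i) n i p * indicator (B i) p \<partial>lborel))"
    by (intro prod.cong nn_integral_cmult refl)
       (auto intro!: borel_measurable_times_ennreal coord_weight_measurable Uc borel_measurable_indicator B)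
  finally show ?thesis .
qed

lemma moment_weight_measurable:
  assumes "a < b" and U: "continuous_on UNIV U1" "continuous_on UNIV U2"
    and UV: "\<And>p. p \<in> {0<..<1} \<Longrightarrow> U1 p = V1 p" "\<And>p. p \<in> {0<..<1} \<Longrightarrow> U2 p = V2 p"
  shows "moment_weight n a b V1 V2 \<in> borel_measurable (Rn_leb n)"
proof -
  let ?U = "alternate U1 U2"
  have "continuous_on UNIV (?U i)" for i using U by (simp add: alternate_def)
  then have Um: "?U i \<in> borel_measurable borel" for i
    by (rule borel_measurable_continuous_onI)
  have 1: "(\<lambda>m. ?U i (params a b m n i)) \<in> borel_measurable (Rn_leb n)" for i
    using measurable_compose[OF params_measurable Um] by blast
  have "(\<lambda>m. indicator {m. in_cube a b n m} m *
    ennreal (\<Prod>i\<in>{1..n}. exp (- real n * ?U i (params a b m n i)))) \<in> borel_measurable (Rn_leb n)"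
  proof (intro borel_measurable_times_ennreal borel_measurable_indicator')
    show "{x \<in> space (Rn_leb n). x \<in> {m. in_cube a b n m}} \<in> sets (Rn_leb n)"
      using in_cube_measurable[of n n a b] by (simp add: pred_def)
    show "(\<lambda>m. ennreal (\<Prod>i\<in>{1..n}. exp (- real n * ?U i (params a b m n i)))) \<in> borel_measurable (Rn_leb n)"
      by (intro measurable_compose[OF _ measurable_ennreal] borel_measurable_prod
           measurable_compose[OF _ borel_measurable_exp] borel_measurable_times borel_measurable_const 1)
  qed
  then show ?thesis
    by (subst measurable_cong[OF moment_weight_eq[OF assms(1) _ UV]]) auto
qed

lemma ennreal_divide_le_of_le_mult: "x \<le> k * z \<Longrightarrow> x / z \<le> (k::ennreal)"
proof (cases "z = 0 \<or> z = \<top>")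
  case True
  assume "x \<le> k * z"
  with True show ?thesis by (auto simp: ennreal_divide_top)
next
  case False
  assume "x \<le> k * z"
  then have "x / z \<le> k * z / z" by (rule divide_right_mono_ennreal)
  also have "\<dots> = k" using False by (simp add: ennreal_mult_divide_eq)
  finally show ?thesis .
qed

text \<open>All one-dimensional factors except the \<open>i\<close>-th cancel against the normalization constant.\<close>

lemma ensemble_tail:
  assumes "a < b" and U: "continuous_on UNIV U1" "continuous_on UNIV U2"
    and UV: "\<And>p. p \<in> {0<..<1} \<Longrightarrow> U1 p = V1 p" "\<And>p. p \<in> {0<..<1} \<Longrightarrow> U2 p = V2 p"
    and i: "i \<in> {1..n}" and D: "D \<in> sets borel"
    and K: "(\<integral>\<^sup>+p. coord_weight (alternate U1 U2 i) n i p * indicator D p \<partial>lborel) \<le>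
      K * (\<integral>\<^sup>+p. coord_weight (alternate U1 U2 i) n i p \<partial>lborel)"
  shows "emeasure (moment_ensemble n a b V1 V2) {m \<in> space (Rn_leb n). params a b m n i \<in> D} \<le> K"
proof -
  let ?w = "moment_weight n a b V1 V2" and ?Z = "moment_norm_const n a b V1 V2"
  let ?S = "{m \<in> space (Rn_leb n). params a b m n i \<in> D}"
  define I where "I B j = ennreal ((b - a) ^ j) * (\<integral>\<^sup>+p. coord_weight (alternate U1 U2 j) n j p * indicator (B :: real set) p \<partial>lborel)" for B j
  have wm: "?w \<in> borel_measurable (Rn_leb n)"
    by (rule moment_weight_measurable[OF assms(1) U UV])
  have S: "?S \<in> sets (Rn_leb n)"
    by (rule measurable_sets_Collect[OF params_measurable]) (use D in \<open>auto simp: pred_def\<close>)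
  have "emeasure (moment_ensemble n a b V1 V2) ?S = (\<integral>\<^sup>+m. ?w m / ?Z * indicator ?S m \<partial>Rn_leb n)"
    unfolding moment_ensemble_def using wm S by (intro emeasure_density) auto
  also have "\<dots> = (\<integral>\<^sup>+m. ?w m * indicator ?S m / ?Z \<partial>Rn_leb n)"
    by (intro nn_integral_cong) (simp add: divide_ennreal_def mult_ac)
  also have "\<dots> = (\<integral>\<^sup>+m. ?w m * indicator ?S m \<partial>Rn_leb n) / ?Z"
    using wm S by (intro nn_integral_divide) auto
  also have "(\<integral>\<^sup>+m. ?w m * indicator ?S m \<partial>Rn_leb n) =
      (\<integral>\<^sup>+m. ?w m * (\<Prod>j\<in>{1..n}. indicator (if j = i then D else UNIV) (params a b m n j)) \<partial>Rn_leb n)"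
  proof (rule nn_integral_cong)
    fix m assume m: "m \<in> space (Rn_leb n)"
    have "(\<Prod>j\<in>{1..n}. indicator (if j = i then D else UNIV) (params a b m n j)) =
        (\<Prod>j\<in>{1..n}. if j = i then indicator D (params a b m n i) else (1::ennreal))"
      by (intro prod.cong) auto
    also have "\<dots> = indicator D (params a b m n i)"
      using i by (subst prod.delta) auto
    finally show "?w m * indicator ?S m = ?w m * (\<Prod>j\<in>{1..n}. indicator (if j = i then D else UNIV) (params a b m n j))"
      using m by (simp add: indicator_def)
  qed
  also have "\<dots> = (\<Prod>j\<in>{1..n}. I (if j = i then D else UNIV) j)"
    unfolding I_def by (rule weight_integral_coord[OF assms(1) U UV]) (use D in auto)
  also have "\<dots> = I D i * (\<Prod>j\<in>{1..n} - {i}. I UNIV j)"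
    using i by (subst prod.remove[of _ i]) (auto intro!: prod.cong arg_cong2[where f="(*)"])
  also have "\<dots> / ?Z \<le> K"
  proof (rule ennreal_divide_le_of_le_mult)
    have Z: "?Z = (\<Prod>j\<in>{1..n}. I UNIV j)"
      using weight_integral_coord[OF assms(1) U UV, of "\<lambda>_. UNIV" n]
      by (simp add: moment_norm_const_def I_def)
    have "I D i \<le> K * I UNIV i"
      unfolding I_def using mult_left_mono[OF K, of "ennreal ((b - a) ^ i)"] by (simp add: mult_ac)
    then have "I D i * (\<Prod>j\<in>{1..n} - {i}. I UNIV j) \<le> K * I UNIV i * (\<Prod>j\<in>{1..n} - {i}. I UNIV j)"
      by (rule mult_right_mono) simp
    also have "\<dots> = K * (\<Prod>j\<in>{1..n}. I UNIV j)"
      using i by (subst prod.remove[of "{1..n}" i]) (auto simp: mult.assoc)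
    finally show "I D i * (\<Prod>j\<in>{1..n} - {i}. I UNIV j) \<le> K * ?Z" unfolding Z .
  qed
  finally show ?thesis .
qed

section \<open>Almost sure and mean convergence\<close>

lemma abs_moment_le:
  assumes \<mu>: "\<mu> \<in> borel_prob_on a b"
  shows "\<bar>moment j \<mu>\<bar> \<le> max \<bar>a\<bar> \<bar>b\<bar> ^ j"
proof -
  interpret prob_space \<mu> by (rule borel_prob_onD[OF \<mu>])
  have "\<bar>moment j \<mu>\<bar> \<le> (\<integral>x. \<bar>x ^ j\<bar> \<partial>\<mu>)" unfolding moment_def by (rule integral_abs_bound)
  also have "\<dots> \<le> (\<integral>x. max \<bar>a\<bar> \<bar>b\<bar> ^ j \<partial>\<mu>)"
  proof (rule integral_mono)
    show "integrable \<mu> (\<lambda>x. \<bar>x ^ j\<bar>)"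
      by (rule borel_prob_on_integrable[OF \<mu>]) (intro continuous_intros)
    show "\<bar>x ^ j\<bar> \<le> max \<bar>a\<bar> \<bar>b\<bar> ^ j" if "x \<in> space \<mu>" for x
      unfolding power_abs using that borel_prob_onD(3)[OF \<mu>] by (intro power_mono) auto
  qed simp
  finally show ?thesis by (simp add: prob_space)
qed

text \<open>The tails of \<open>laplace_tail\<close> are summable in \<open>n\<close>, so the Borel-Cantelli lemma applies to every
  canonical moment and each of countably many radii. Mean convergence is dominated convergence, as moment vectors are bounded.\<close>

theorem random_moments_converge:
  fixes X :: "nat \<Rightarrow> 'w \<Rightarrow> nat \<Rightarrow> real"
  assumes "a < b" and V: "continuous_on {0..1} V1" "continuous_on {0..1} V2"
    and min: "unique_minimizer (W_of V1) {0<..<1} p1" "unique_minimizer (W_of V2) {0<..<1} p2"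
    and \<Omega>: "prob_space \<Omega>"
    and X: "\<And>n. 1 \<le> n \<Longrightarrow> X n \<in> measurable \<Omega> (Rn_leb n)"
      "\<And>n. 1 \<le> n \<Longrightarrow> distr \<Omega> (Rn_leb n) (X n) = moment_ensemble n a b V1 V2"
    and L: "\<And>j. 1 \<le> j \<Longrightarrow> L j = cmom a b (alternate p1 p2) j" and k: "1 \<le> k"
  shows "AE \<omega> in \<Omega>. \<forall>j\<in>{1..k}. (\<lambda>n. X n \<omega> j) \<longlonglongrightarrow> L j"
    and "\<And>n. k \<le> n \<Longrightarrow> integrable \<Omega> (\<lambda>\<omega>. L2_set (\<lambda>j. X n \<omega> j - L j) {1..k})"
    and "(\<lambda>n. \<integral>\<omega>. L2_set (\<lambda>j. X n \<omega> j - L j) {1..k} \<partial>\<Omega>) \<longlonglongrightarrow> 0"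
proof -
  interpret prob_space \<Omega> by (rule \<Omega>)
  \<comment> \<open>The potentials are continuous on the closed unit interval only; composing with the projection
    onto it extends them continuously.\<close>
  define clamp where "clamp x = max 0 (min 1 x)" for x :: real
  define U1 where "U1 = V1 \<circ> clamp"
  define U2 where "U2 = V2 \<circ> clamp"
  have cl: "continuous_on UNIV clamp" "range clamp \<subseteq> {0..1}"
    unfolding clamp_def by (auto intro!: continuous_intros)
  have U: "continuous_on UNIV U1" "continuous_on UNIV U2"
    unfolding U1_def U2_def
    by (rule continuous_on_compose[OF cl(1) continuous_on_subset[OF V(1) cl(2)]],
        rule continuous_on_compose[OF cl(1) continuous_on_subset[OF V(2) cl(2)]])
  have UV: "\<And>p. p \<in> {0<..<1} \<Longrightarrow> U1 p = V1 p" "\<And>p. p \<in> {0<..<1} \<Longrightarrow> U2 p = V2 p"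
    by (simp_all add: U1_def U2_def clamp_def)
  have W: "unique_minimizer (W_of U) {0<..<1} s" if "unique_minimizer (W_of V) {0<..<1} s"
    "\<And>p. p \<in> {0<..<1} \<Longrightarrow> U p = V p" for U V s
  proof -
    have eq: "W_of U p = W_of V p" if "p \<in> {0<..<1}" for p
      using \<open>\<And>p. p \<in> {0<..<1} \<Longrightarrow> U p = V p\<close>[OF that] by (simp add: W_of_def)
    have "is_arg_min (W_of U) (\<lambda>z. z \<in> {0<..<1}) y \<longleftrightarrow> is_arg_min (W_of V) (\<lambda>z. z \<in> {0<..<1}) y" for y
      unfolding is_arg_min_def using eq by metis
    then show ?thesis using that(1) unfolding unique_minimizer_def by simp
  qed
  have minU: "unique_minimizer (W_of (alternate U1 U2 i)) {0<..<1} (alternate p1 p2 i)" for i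
    using W[OF min(1) UV(1)] W[OF min(2) UV(2)] by (simp add: alternate_def)
  let ?P = "\<lambda>n \<omega> i. params a b (X n \<omega>) n i"
  have Pm: "(\<lambda>\<omega>. ?P n \<omega> i) \<in> borel_measurable \<Omega>" if "1 \<le> n" for n i
    by (rule measurable_compose[OF X(1)[OF that] params_measurable]) simp
  have tail: "AE \<omega> in \<Omega>. \<forall>\<^sub>F n in sequentially. \<bar>?P n \<omega> i - alternate p1 p2 i\<bar> < e"
    if i: "1 \<le> i" and e: "0 < e" for i e
  proof -
    have Uc: "continuous_on UNIV (alternate U1 U2 i)" using U by (simp add: alternate_def)
    let ?D = "{p. e \<le> \<bar>p - alternate p1 p2 i\<bar>}"
    have D: "?D \<in> sets borel" by (intro borel_closed closed_Collect_le continuous_intros)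
    from laplace_tail[OF Uc minU e, of i] obtain C \<kappa> where C: "0 \<le> C" "0 \<le> \<kappa>" "\<kappa> < 1"
      and bound: "\<And>n. i \<le> n \<Longrightarrow> (\<integral>\<^sup>+p. coord_weight (alternate U1 U2 i) n i p * indicator ?D p \<partial>lborel) \<le>
        ennreal (C * \<kappa> ^ (n - i)) * (\<integral>\<^sup>+p. coord_weight (alternate U1 U2 i) n i p \<partial>lborel)"
      by blast
    \<comment> \<open>Shifted by \<open>i\<close>, since the \<open>i\<close>-th canonical moment exists only from dimension \<open>i\<close> on.\<close>
    define A where "A n = {\<omega> \<in> space \<Omega>. ?P (n + i) \<omega> i \<in> ?D}" for n
    have Am: "A n \<in> sets \<Omega>" for n
      unfolding A_def by (rule measurable_sets_Collect[OF Pm]) (use i D in \<open>auto simp: pred_def\<close>)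
    have AP: "measure \<Omega> (A n) \<le> C * \<kappa> ^ n" for n
    proof -
      let ?S = "{m \<in> space (Rn_leb (n + i)). params a b m (n + i) i \<in> ?D}"
      have ni: "1 \<le> n + i" using i by simp
      have S: "?S \<in> sets (Rn_leb (n + i))"
        by (rule measurable_sets_Collect[OF params_measurable]) (use D in \<open>auto simp: pred_def\<close>)
      have "A n = X (n + i) -` ?S \<inter> space \<Omega>"
        using measurable_space[OF X(1)[OF ni]] by (auto simp: A_def)
      then have "emeasure \<Omega> (A n) = emeasure (moment_ensemble (n + i) a b V1 V2) ?S"
        using emeasure_distr[OF X(1)[OF ni] S] by (simp only: X(2)[OF ni])
      also have "\<dots> \<le> ennreal (C * \<kappa> ^ (n + i - i))"
        by (rule ensemble_tail[OF assms(1) U UV _ D bound]) (use i in auto)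
      finally show ?thesis
        using C by (simp add: emeasure_eq_measure)
    qed
    have "summable (\<lambda>n. C * \<kappa> ^ n)" using C by (intro summable_mult summable_geometric) auto
    then have "summable (\<lambda>n. measure \<Omega> (A n))"
      by (rule summable_comparison_test'[of _ 0]) (use AP in auto)
    then have "AE \<omega> in \<Omega>. \<forall>\<^sub>F n in sequentially. \<omega> \<in> space \<Omega> - A n"
      by (intro borel_cantelli_AE1 Am) (auto simp: emeasure_eq_measure)
    then show ?thesis
    proof eventually_elim
      fix \<omega> assume "\<forall>\<^sub>F n in sequentially. \<omega> \<in> space \<Omega> - A n"
      then have "\<forall>\<^sub>F n in sequentially. \<bar>?P (n + i) \<omega> i - alternate p1 p2 i\<bar> < e"
        by eventually_elim (auto simp: A_def)
      then show "\<forall>\<^sub>F n in sequentially. \<bar>?P n \<omega> i - alternate p1 p2 i\<bar> < e"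
        by (rule eventually_sequentially_seg[THEN iffD1])
    qed
  qed
  have conv: "AE \<omega> in \<Omega>. \<forall>i l. 1 \<le> i \<longrightarrow> (\<forall>\<^sub>F n in sequentially. \<bar>?P n \<omega> i - alternate p1 p2 i\<bar> < 1 / real (Suc l))"
    unfolding AE_all_countable by (auto intro!: tail)
  have cube: "AE \<omega> in \<Omega>. \<forall>n. 1 \<le> n \<longrightarrow> in_cube a b n (X n \<omega>)"
    unfolding AE_all_countable
  proof (intro allI AE_impI)
    fix n :: nat assume n: "1 \<le> n"
    have "AE m in moment_ensemble n a b V1 V2. in_cube a b n m"
      unfolding moment_ensemble_def
    proof (subst AE_density)
      show "(\<lambda>m. moment_weight n a b V1 V2 m / moment_norm_const n a b V1 V2) \<in> borel_measurable (Rn_leb n)"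
        using moment_weight_measurable[OF assms(1) U UV, of n] by (intro borel_measurable_divide_ennreal) auto
      show "AE m in Rn_leb n. 0 < moment_weight n a b V1 V2 m / moment_norm_const n a b V1 V2 \<longrightarrow> in_cube a b n m"
      proof (rule AE_I2)
        fix m assume m: "m \<in> space (Rn_leb n)"
        show "0 < moment_weight n a b V1 V2 m / moment_norm_const n a b V1 V2 \<longrightarrow> in_cube a b n m"
        proof (cases "in_cube a b n m")
          case False
          then have "moment_weight n a b V1 V2 m = 0"
            by (subst moment_weight_eq[OF assms(1) m UV]) simp_all
          then show ?thesis by simp
        qed simp
      qed
    qed
    then show "AE \<omega> in \<Omega>. in_cube a b n (X n \<omega>)"
      unfolding X(2)[OF n, symmetric]
      by (rule AE_distrD[OF X(1)[OF n]])
  qed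
  have coords: "m j = cmom a b (params a b m n) j" if "in_cube a b n m" "1 \<le> j" "j \<le> n" for m n j
  proof -
    have "m j = cmom a b (params a b m (Suc n)) j"
      using cmom_params[OF assms(1) that(1), of j] that by simp
    also have "\<dots> = cmom a b (params a b m n) j"
      by (rule cmom_cong) (use that in auto)
    finally show ?thesis .
  qed
  have lim: "AE \<omega> in \<Omega>. \<forall>j. 1 \<le> j \<longrightarrow> (\<lambda>n. X n \<omega> j) \<longlonglongrightarrow> L j"
    using conv cube
  proof eventually_elim
    fix \<omega> assume c: "\<forall>i l. 1 \<le> i \<longrightarrow> (\<forall>\<^sub>F n in sequentially. \<bar>?P n \<omega> i - alternate p1 p2 i\<bar> < 1 / real (Suc l))"
      and q: "\<forall>n. 1 \<le> n \<longrightarrow> in_cube a b n (X n \<omega>)"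
    have "(\<lambda>n. ?P n \<omega> i) \<longlonglongrightarrow> alternate p1 p2 i" if "1 \<le> i" for i
    proof (rule tendstoI)
      fix e :: real assume "0 < e"
      then obtain l where l: "1 / real (Suc l) < e" by (meson nat_approx_posE)
      have "\<forall>\<^sub>F n in sequentially. \<bar>?P n \<omega> i - alternate p1 p2 i\<bar> < 1 / real (Suc l)"
        using c that by blast
      then show "\<forall>\<^sub>F n in sequentially. dist (?P n \<omega> i) (alternate p1 p2 i) < e"
        by eventually_elim (use l in \<open>simp add: dist_real_def\<close>)
    qed
    then have t: "(\<lambda>n. cmom a b (?P n \<omega>) j) \<longlonglongrightarrow> cmom a b (alternate p1 p2) j" for j
      by (rule tendsto_cmom)
    show "\<forall>j. 1 \<le> j \<longrightarrow> (\<lambda>n. X n \<omega> j) \<longlonglongrightarrow> L j"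
    proof (intro allI impI)
      fix j :: nat assume j: "1 \<le> j"
      have "\<forall>\<^sub>F n in sequentially. cmom a b (?P n \<omega>) j = X n \<omega> j"
        using eventually_ge_at_top[of j]
        by eventually_elim (use q coords j in auto)
      then show "(\<lambda>n. X n \<omega> j) \<longlonglongrightarrow> L j"
        using t[of j] unfolding L[OF j] by (rule Lim_transform_eventually[rotated])
    qed
  qed
  then show "AE \<omega> in \<Omega>. \<forall>j\<in>{1..k}. (\<lambda>n. X n \<omega> j) \<longlonglongrightarrow> L j"
    by eventually_elim auto
  define E where "E n \<omega> = L2_set (\<lambda>j. X n \<omega> j - L j) {1..k}" for n \<omega>
  define B where "B = (\<Sum>j\<in>{1..k}. max \<bar>a\<bar> \<bar>b\<bar> ^ j + \<bar>L j\<bar>)"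
  have Em: "E n \<in> borel_measurable \<Omega>" if "k \<le> n" for n
  proof -
    have "(\<lambda>\<omega>. X n \<omega> j) \<in> borel_measurable \<Omega>" if "j \<in> {1..k}" for j
      by (rule measurable_compose[OF X(1) coord_measurable]) (use that \<open>k \<le> n\<close> in auto)
    then show ?thesis
      unfolding E_def L2_set_def
      by (intro measurable_compose[OF _ borel_measurable_sqrt] borel_measurable_sum borel_measurable_power borel_measurable_diff) auto
  qed
  have Eb: "AE \<omega> in \<Omega>. norm (E n \<omega>) \<le> B" if n: "k \<le> n" for n
    using cube AE_space
  proof eventually_elim
    fix \<omega> assume q: "\<forall>n. 1 \<le> n \<longrightarrow> in_cube a b n (X n \<omega>)" and \<omega>: "\<omega> \<in> space \<Omega>"
    have n1: "1 \<le> n" using n k by simp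
    have "X n \<omega> \<in> topspace (Rn_top n)"
      using measurable_space[OF X(1)[OF n1] \<omega>] by (simp add: space_PiM)
    then have "X n \<omega> \<in> moment_space n a b"
      using q n1 interior_moment_space[OF assms(1), of n] interior_of_subset[of "Rn_top n" "moment_space n a b"] by blast
    then obtain \<mu> where \<mu>: "\<mu> \<in> borel_prob_on a b" "X n \<omega> = (\<lambda>j\<in>{1..n}. moment j \<mu>)"
      by (auto simp: moment_space_def)
    have "norm (E n \<omega>) = E n \<omega>" by (simp add: E_def L2_set_nonneg)
    also have "\<dots> \<le> (\<Sum>j\<in>{1..k}. \<bar>X n \<omega> j - L j\<bar>)" unfolding E_def by (rule L2_set_le_sum_abs)
    also have "\<dots> \<le> B"
      unfolding B_def
    proof (rule sum_mono)
      fix j assume "j \<in> {1..k}"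
      then have "X n \<omega> j = moment j \<mu>" using \<mu>(2) n by auto
      then show "\<bar>X n \<omega> j - L j\<bar> \<le> max \<bar>a\<bar> \<bar>b\<bar> ^ j + \<bar>L j\<bar>"
        using abs_moment_le[OF \<mu>(1), of j] abs_triangle_ineq4[of "X n \<omega> j" "L j"] by simp
    qed
    finally show "norm (E n \<omega>) \<le> B" .
  qed
  show "integrable \<Omega> (\<lambda>\<omega>. L2_set (\<lambda>j. X n \<omega> j - L j) {1..k})" if "k \<le> n" for n
    using integrable_const_bound[OF Eb[OF that] Em[OF that]] unfolding E_def .
  have Elim: "AE \<omega> in \<Omega>. (\<lambda>n. E (n + k) \<omega>) \<longlonglongrightarrow> 0"
    using lim
  proof eventually_elim
    fix \<omega> assume l: "\<forall>j. 1 \<le> j \<longrightarrow> (\<lambda>n. X n \<omega> j) \<longlonglongrightarrow> L j"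
    have "(\<lambda>n. \<Sum>j\<in>{1..k}. \<bar>X n \<omega> j - L j\<bar>) \<longlonglongrightarrow> (\<Sum>j\<in>{1..k}. \<bar>L j - L j\<bar>)"
      by (intro tendsto_intros) (use l in auto)
    then have "(\<lambda>n. \<Sum>j\<in>{1..k}. \<bar>X n \<omega> j - L j\<bar>) \<longlonglongrightarrow> 0" by simp
    then have "(\<lambda>n. E n \<omega>) \<longlonglongrightarrow> 0"
      by (rule Lim_null_comparison[rotated])
         (auto simp: E_def L2_set_nonneg intro!: always_eventually L2_set_le_sum_abs)
    then show "(\<lambda>n. E (n + k) \<omega>) \<longlonglongrightarrow> 0" by (rule LIMSEQ_ignore_initial_segment)
  qed
  have "(\<lambda>n. \<integral>\<omega>. E (n + k) \<omega> \<partial>\<Omega>) \<longlonglongrightarrow> (\<integral>\<omega>. 0 \<partial>\<Omega>)"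
    by (rule integral_dominated_convergence[where w="\<lambda>_. B"]) (use Em Eb Elim in auto)
  then have "(\<lambda>n. \<integral>\<omega>. E (n + k) \<omega> \<partial>\<Omega>) \<longlonglongrightarrow> 0" by simp
  then show "(\<lambda>n. \<integral>\<omega>. L2_set (\<lambda>j. X n \<omega> j - L j) {1..k} \<partial>\<Omega>) \<longlonglongrightarrow> 0"
    unfolding E_def by (rule LIMSEQ_offset)
qed

section \<open>Integrals over the half circle\<close>

text \<open>Lebesgue measure on \<open>[0, \<pi>]\<close>, the angle space of the upper half circle.\<close>

definition halfcircle :: "real measure" where
  "halfcircle = restrict_space lborel {0..pi}"

lemma space_halfcircle [simp]: "space halfcircle = {0..pi}"
  by (simp add: halfcircle_def space_restrict_space)

lemma halfcircle_measurable: "f \<in> measurable borel M \<Longrightarrow> f \<in> measurable halfcircle M"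
  unfolding halfcircle_def by (rule measurable_restrict_space1) simp

lemma finite_halfcircle: "finite_measure halfcircle"
proof
  have "emeasure halfcircle (space halfcircle) = emeasure lborel {0..pi}"
    unfolding halfcircle_def by (simp add: emeasure_restrict_space space_restrict_space)
  then show "emeasure halfcircle (space halfcircle) \<noteq> \<infinity>" by simp
qed

lemma halfcircle_integrable:
  fixes f :: "real \<Rightarrow> real"
  assumes "f \<in> borel_measurable borel" "\<And>t. \<bar>f t\<bar> \<le> B"
  shows "integrable halfcircle f"
  by (rule finite_measure.integrable_const_bound[OF finite_halfcircle, of _ B])
     (use assms in \<open>auto intro: halfcircle_measurable\<close>)

lemma halfcircle_FTC:
  fixes f F :: "real \<Rightarrow> real"
  assumes "\<And>t. (F has_real_derivative f t) (at t)" "\<And>t. isCont f t"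
  shows "(\<integral>t. f t \<partial>halfcircle) = F pi - F 0"
proof -
  have "(\<integral>t. f t \<partial>halfcircle) = (\<integral>t. f t * indicator {0..pi} t \<partial>lborel)"
    unfolding halfcircle_def by (subst integral_restrict_space) (auto simp: mult.commute)
  also have "\<dots> = F pi - F 0" by (rule integral_FTC_Icc_real) (use assms in auto)
  finally show ?thesis .
qed

lemma halfcircle_cos: "(\<integral>t. cos (real k * t) \<partial>halfcircle) = (if k = 0 then pi else 0)"
proof (cases "k = 0")
  case True
  then show ?thesis using halfcircle_FTC[of "\<lambda>t. t" "\<lambda>t. 1"] by simp
next
  case False
  then have "(\<integral>t. cos (real k * t) \<partial>halfcircle) = sin (real k * pi) / real k - sin (real k * 0) / real k"
    by (intro halfcircle_FTC) (auto intro!: derivative_eq_intros)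
  then show ?thesis using False by simp
qed

lemma halfcircle_cos_integrable: "integrable halfcircle (\<lambda>t. cos (c * t))"
  by (rule halfcircle_integrable[of _ 1]) auto

lemma sin_Suc_times_sin:
  "sin (real (Suc k) * t) * sin t = (cos (real k * t) - cos (real (Suc (Suc k)) * t)) / 2"
proof -
  have "real (Suc k) * t - t = real k * t" "real (Suc k) * t + t = real (Suc (Suc k)) * t"
    by (simp_all add: algebra_simps)
  then show ?thesis using sin_times_sin[of "real (Suc k) * t" t] by simp
qed

lemma halfcircle_sin_sin: "(\<integral>t. sin (real (Suc k) * t) * sin t \<partial>halfcircle) = (if k = 0 then pi / 2 else 0)"
  unfolding sin_Suc_times_sin
  using halfcircle_cos[of k] halfcircle_cos[of "Suc (Suc k)"] halfcircle_cos_integrable by simp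

text \<open>The squared modulus of \<open>1 - \<rho> exp (i t)\<close>, the denominator of the Poisson kernel.\<close>

definition poisson_den :: "real \<Rightarrow> real \<Rightarrow> real" where
  "poisson_den \<rho> t = 1 - 2 * \<rho> * cos t + \<rho>\<^sup>2"

text \<open>The difference is \<open>(\<rho> - cos t)\<^sup>2\<close>. The bound is uniform in \<open>\<rho>\<close>, which allows to let \<open>\<rho>\<close> tend to the
  unit circle.\<close>

lemma sin_squared_le_poisson: "(sin t)\<^sup>2 \<le> poisson_den \<rho> t"
proof -
  have "poisson_den \<rho> t - (sin t)\<^sup>2 = (\<rho> - cos t)\<^sup>2"
    by (simp add: poisson_den_def sin_squared_eq power2_eq_square algebra_simps)
  then show ?thesis using zero_le_power2[of "\<rho> - cos t"] by linarith
qed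

lemma poisson_den_pos:
  assumes "\<bar>\<rho>\<bar> < 1"
  shows "(1 - \<bar>\<rho>\<bar>)\<^sup>2 \<le> poisson_den \<rho> t" "0 < poisson_den \<rho> t"
proof -
  have "\<rho> * cos t \<le> \<bar>\<rho>\<bar> * 1"
    using mult_left_mono[OF abs_cos_le_one[of t] abs_ge_zero[of \<rho>]] abs_ge_self[of "\<rho> * cos t"]
    by (simp add: abs_mult)
  then show "(1 - \<bar>\<rho>\<bar>)\<^sup>2 \<le> poisson_den \<rho> t"
    by (simp add: poisson_den_def power2_eq_square algebra_simps)
  moreover have "0 < (1 - \<bar>\<rho>\<bar>)\<^sup>2" using assms by simp
  ultimately show "0 < poisson_den \<rho> t" by linarith
qed

lemma abs_sin_mult_le: "\<bar>sin (real m * t)\<bar> \<le> real m * \<bar>sin t\<bar>"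
proof (induction m)
  case (Suc m)
  have "real (Suc m) * t = real m * t + t" by (simp add: algebra_simps)
  then have "\<bar>sin (real (Suc m) * t)\<bar> \<le> \<bar>sin (real m * t)\<bar> * \<bar>cos t\<bar> + \<bar>cos (real m * t)\<bar> * \<bar>sin t\<bar>"
    by (simp add: sin_add abs_mult[symmetric] abs_triangle_ineq)
  also have "\<dots> \<le> \<bar>sin (real m * t)\<bar> * 1 + 1 * \<bar>sin t\<bar>"
    by (intro add_mono mult_left_mono mult_right_mono) auto
  finally show ?case using Suc by (simp add: algebra_simps)
qed simp

lemma poisson_quotient_bound: "\<bar>sin (real m * t) * sin t / poisson_den \<rho> t\<bar> \<le> real m"
proof (cases "sin t = 0")
  case False
  have pos: "0 < poisson_den \<rho> t"
    using sin_squared_le_poisson[of t \<rho>] False by (smt (verit) zero_less_power2)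
  have "\<bar>sin (real m * t) * sin t\<bar> \<le> (real m * \<bar>sin t\<bar>) * \<bar>sin t\<bar>"
    unfolding abs_mult by (rule mult_right_mono[OF abs_sin_mult_le]) simp
  also have "\<dots> = real m * (sin t)\<^sup>2" by (simp add: power2_eq_square)
  also have "\<dots> \<le> real m * poisson_den \<rho> t"
    by (rule mult_left_mono[OF sin_squared_le_poisson]) simp
  finally show ?thesis using pos by (simp add: abs_divide divide_le_eq)
qed simp

lemma poisson_quotient_measurable:
  "(\<lambda>t. sin (real m * t) * sin t / poisson_den \<rho> t) \<in> borel_measurable borel"
  unfolding poisson_den_def by measurable

lemma poisson_quotient_integrable: "integrable halfcircle (\<lambda>t. sin (real m * t) * sin t / poisson_den \<rho> t)"
  by (rule halfcircle_integrable[OF poisson_quotient_measurable poisson_quotient_bound])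

text \<open>The integrals satisfy a linear recurrence with characteristic roots \<open>\<rho>\<close> and \<open>1/\<rho>\<close>, and they stay
  bounded, so only the root \<open>\<rho>\<close> occurs.\<close>

lemma halfcircle_poisson_aux:
  assumes "\<bar>\<rho>\<bar> < 1"
  shows "(\<integral>t. sin (real (Suc k) * t) * sin t / poisson_den \<rho> t \<partial>halfcircle) = pi / 2 * \<rho> ^ k"
proof -
  define I where "I m = (\<integral>t. sin (real m * t) * sin t / poisson_den \<rho> t \<partial>halfcircle)" for m
  have rec: "\<rho> * (I (Suc (Suc m)) + I m) = (1 + \<rho>\<^sup>2) * I (Suc m) - (if m = 0 then pi / 2 else 0)" for m
  proof -
    have pw: "\<rho> * (sin (real (Suc (Suc m)) * t) * sin t / poisson_den \<rho> t + sin (real m * t) * sin t / poisson_den \<rho> t) =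
        (1 + \<rho>\<^sup>2) * (sin (real (Suc m) * t) * sin t / poisson_den \<rho> t) - sin (real (Suc m) * t) * sin t" for t
    proof -
      have "sin (real (Suc (Suc m)) * t) + sin (real m * t) = 2 * cos t * sin (real (Suc m) * t)"
      proof -
        have "real (Suc (Suc m)) * t = real (Suc m) * t + t" "real m * t = real (Suc m) * t - t"
          by (simp_all add: algebra_simps)
        then show ?thesis by (simp only: sin_add sin_diff) simp
      qed
      then have "\<rho> * (sin (real (Suc (Suc m)) * t) * sin t + sin (real m * t) * sin t) =
         (1 + \<rho>\<^sup>2 - poisson_den \<rho> t) * (sin (real (Suc m) * t) * sin t)"
        by (simp only: distrib_right[symmetric] poisson_den_def) (simp add: algebra_simps)
      then show ?thesis
        using poisson_den_pos(2)[OF assms, of t] by (simp add: field_simps)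
    qed
    have "\<rho> * (I (Suc (Suc m)) + I m) = (\<integral>t. \<rho> * (sin (real (Suc (Suc m)) * t) * sin t / poisson_den \<rho> t + sin (real m * t) * sin t / poisson_den \<rho> t) \<partial>halfcircle)"
      unfolding I_def
      by (simp only: integral_mult_right_zero
            Bochner_Integration.integral_add[OF poisson_quotient_integrable poisson_quotient_integrable])
    also have "\<dots> = (1 + \<rho>\<^sup>2) * I (Suc m) - (\<integral>t. sin (real (Suc m) * t) * sin t \<partial>halfcircle)"
      unfolding pw I_def
    proof -
      have i: "integrable halfcircle (\<lambda>t. sin (real (Suc m) * t) * sin t)"
        unfolding sin_Suc_times_sin using halfcircle_cos_integrable by simp
      show "(\<integral>t. (1 + \<rho>\<^sup>2) * (sin (real (Suc m) * t) * sin t / poisson_den \<rho> t) - sin (real (Suc m) * t) * sin t \<partial>halfcircle) =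
         (1 + \<rho>\<^sup>2) * (\<integral>t. sin (real (Suc m) * t) * sin t / poisson_den \<rho> t \<partial>halfcircle) - (\<integral>t. sin (real (Suc m) * t) * sin t \<partial>halfcircle)"
        by (simp only: Bochner_Integration.integral_diff[OF integrable_mult_right[OF poisson_quotient_integrable] i]
              integral_mult_right_zero)
    qed
    finally show ?thesis using halfcircle_sin_sin[of m] by simp
  qed
  have I0: "I 0 = 0" by (simp add: I_def)
  obtain C where C: "\<And>m. \<bar>I m\<bar> \<le> C"
  proof
    fix m
    have "\<bar>I m\<bar> \<le> (\<integral>t. \<bar>sin (real m * t) * sin t / poisson_den \<rho> t\<bar> \<partial>halfcircle)"
      unfolding I_def by (rule integral_abs_bound)
    also have "\<dots> \<le> (\<integral>t. 1 / (1 - \<bar>\<rho>\<bar>)\<^sup>2 \<partial>halfcircle)"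
    proof (rule integral_mono)
      show "integrable halfcircle (\<lambda>t. \<bar>sin (real m * t) * sin t / poisson_den \<rho> t\<bar>)"
        by (rule integrable_abs, rule poisson_quotient_integrable)
      show "integrable halfcircle (\<lambda>t. 1 / (1 - \<bar>\<rho>\<bar>)\<^sup>2)"
        by (rule halfcircle_integrable[of _ "1 / (1 - \<bar>\<rho>\<bar>)\<^sup>2"]) auto
      show "\<bar>sin (real m * t) * sin t / poisson_den \<rho> t\<bar> \<le> 1 / (1 - \<bar>\<rho>\<bar>)\<^sup>2" for t
        unfolding abs_divide abs_mult
        using poisson_den_pos[OF assms, of t] assms
        by (intro frac_le mult_le_one) (auto simp: abs_of_pos)
    qed
    finally show "\<bar>I m\<bar> \<le> (\<integral>t. 1 / (1 - \<bar>\<rho>\<bar>)\<^sup>2 \<partial>halfcircle)" .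
  qed
  \<comment> \<open>Taking this combination removes the root \<open>\<rho>\<close>. What is left would grow like \<open>1/\<rho>\<^sup>m\<close>, so it
    vanishes.\<close>
  define J where "J m = I (Suc (Suc m)) - \<rho> * I (Suc m)" for m
  have Jrec: "J m = \<rho> * J (Suc m)" for m
    using rec[of "Suc m"] by (simp add: J_def power2_eq_square algebra_simps)
  have J0: "J m = 0" for m
  proof -
    have "J m = \<rho> ^ n * J (m + n)" for n
      by (induction n) (auto simp: Jrec[of "m + _"])
    moreover have "(\<lambda>n. \<rho> ^ n * J (m + n)) \<longlonglongrightarrow> 0"
    proof (rule Lim_null_comparison)
      have "norm (\<rho> ^ n * J (m + n)) \<le> \<bar>\<rho>\<bar> ^ n * (C + \<bar>\<rho>\<bar> * C)" for n
      proof -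
        have "\<bar>J (m + n)\<bar> \<le> \<bar>I (Suc (Suc (m + n)))\<bar> + \<bar>\<rho>\<bar> * \<bar>I (Suc (m + n))\<bar>"
          unfolding J_def by (metis abs_mult abs_triangle_ineq4)
        also have "\<dots> \<le> C + \<bar>\<rho>\<bar> * C" by (intro add_mono mult_left_mono C) simp
        finally show ?thesis by (simp add: abs_mult power_abs mult_left_mono)
      qed
      then show "\<forall>\<^sub>F n in sequentially. norm (\<rho> ^ n * J (m + n)) \<le> \<bar>\<rho>\<bar> ^ n * (C + \<bar>\<rho>\<bar> * C)" by simp
      show "(\<lambda>n. \<bar>\<rho>\<bar> ^ n * (C + \<bar>\<rho>\<bar> * C)) \<longlonglongrightarrow> 0"
        using assms by (intro tendsto_mult_left_zero LIMSEQ_realpow_zero) auto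
    qed
    ultimately have "(\<lambda>n. J m) \<longlonglongrightarrow> 0" by simp
    then show ?thesis by (simp add: LIMSEQ_const_iff)
  qed
  have step: "I (Suc (Suc m)) = \<rho> * I (Suc m)" for m using J0[of m] by (simp add: J_def)
  have "I (Suc 0) = pi / 2"
    using rec[of 0] step[of 0] I0 by (simp add: power2_eq_square algebra_simps)
  then have "I (Suc k) = pi / 2 * \<rho> ^ k"
    by (induction k) (simp_all add: step)
  then show ?thesis by (simp only: I_def)
qed

text \<open>The case \<open>\<bar>\<rho>\<bar> = 1\<close>, which occurs when the support reaches an end point of \<open>[a,b]\<close>, follows by
  dominated convergence.\<close>

lemma halfcircle_poisson:
  assumes "\<bar>\<rho>\<bar> \<le> 1"
  shows "(\<integral>t. sin (real (Suc k) * t) * sin t / poisson_den \<rho> t \<partial>halfcircle) = pi / 2 * \<rho> ^ k"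
proof -
  let ?r = "\<lambda>n. \<rho> * (1 - 1 / real (n + 2))"
  have r: "?r \<longlonglongrightarrow> \<rho>"
  proof -
    have "(\<lambda>n. 1 / real (n + 2)) \<longlonglongrightarrow> 0"
      using LIMSEQ_ignore_initial_segment[OF lim_1_over_n, of 2] by simp
    then have "(\<lambda>n. \<rho> * (1 - 1 / real (n + 2))) \<longlonglongrightarrow> \<rho> * (1 - 0)" by (intro tendsto_intros)
    then show ?thesis by simp
  qed
  have r1: "\<bar>?r n\<bar> < 1" for n
  proof -
    have "\<bar>?r n\<bar> = \<bar>\<rho>\<bar> * (1 - 1 / real (n + 2))" by (simp add: abs_mult)
    also have "\<dots> \<le> 1 * (1 - 1 / real (n + 2))" using assms by (intro mult_right_mono) auto
    also have "\<dots> < 1" by simp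
    finally show ?thesis .
  qed
  have "(\<lambda>n. \<integral>t. sin (real (Suc k) * t) * sin t / poisson_den (?r n) t \<partial>halfcircle) \<longlonglongrightarrow>
      (\<integral>t. sin (real (Suc k) * t) * sin t / poisson_den \<rho> t \<partial>halfcircle)"
  proof (rule integral_dominated_convergence[where w="\<lambda>_. real (Suc k)"])
    show "AE t in halfcircle. (\<lambda>n. sin (real (Suc k) * t) * sin t / poisson_den (?r n) t) \<longlonglongrightarrow>
       sin (real (Suc k) * t) * sin t / poisson_den \<rho> t"
    proof (rule AE_I2)
      fix t
      show "(\<lambda>n. sin (real (Suc k) * t) * sin t / poisson_den (?r n) t) \<longlonglongrightarrow>
       sin (real (Suc k) * t) * sin t / poisson_den \<rho> t"
      proof (cases "sin t = 0")
        case False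
        then have "poisson_den \<rho> t \<noteq> 0"
          using sin_squared_le_poisson[of t \<rho>] by (smt (verit) zero_less_power2)
        then show ?thesis
          unfolding poisson_den_def by (intro tendsto_intros r)
      qed simp
    qed
    show "AE t in halfcircle. norm (sin (real (Suc k) * t) * sin t / poisson_den (?r n) t) \<le> real (Suc k)" for n
      by (rule AE_I2) (simp only: real_norm_def poisson_quotient_bound)
    show "integrable halfcircle (\<lambda>_. real (Suc k))"
      by (rule halfcircle_integrable[of _ "real (Suc k)"]) auto
  qed (rule halfcircle_measurable, rule poisson_quotient_measurable)+
  then have "(\<lambda>n. pi / 2 * ?r n ^ k) \<longlonglongrightarrow> (\<integral>t. sin (real (Suc k) * t) * sin t / poisson_den \<rho> t \<partial>halfcircle)"
    unfolding halfcircle_poisson_aux[OF r1] .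
  moreover have "(\<lambda>n. pi / 2 * ?r n ^ k) \<longlonglongrightarrow> pi / 2 * \<rho> ^ k"
    by (intro tendsto_intros r)
  ultimately show ?thesis using LIMSEQ_unique by blast
qed

text \<open>A quadratic form in two square roots is a multiple of a Poisson denominator whose parameter is the
  ratio of the smaller to the larger root.\<close>

lemma quad_poisson:
  assumes "0 < t" "t \<le> s" "\<sigma> = 1 \<or> \<sigma> = - 1"
  shows "s + t - 2 * \<sigma> * sqrt (s * t) * cos x = s * poisson_den (\<sigma> * sqrt (t / s)) x"
proof -
  have "s * sqrt (t / s) = sqrt (s * t)"
  proof -
    have "s * sqrt (t / s) = sqrt (s\<^sup>2) * sqrt (t / s)" using assms by simp
    also have "\<dots> = sqrt (s\<^sup>2 * (t / s))" by (simp only: real_sqrt_mult)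
    also have "s\<^sup>2 * (t / s) = s * t" using assms by (simp add: power2_eq_square)
    finally show ?thesis .
  qed
  moreover have "s * (sqrt (t / s))\<^sup>2 = t" using assms by simp
  moreover have "\<sigma>\<^sup>2 = 1" using assms(3) by auto
  ultimately show ?thesis
    unfolding poisson_den_def power_mult_distrib by (simp add: algebra_simps)
qed

lemma halfcircle_quad:
  assumes "0 < s" "0 < t" "\<sigma> = 1 \<or> \<sigma> = - 1"
  shows "(\<integral>x. sin (real (Suc k) * x) * sin x / (s + t - 2 * \<sigma> * sqrt (s * t) * cos x) \<partial>halfcircle) =
    pi / (2 * max s t) * (\<sigma> * sqrt (min s t / max s t)) ^ k"
proof -
  have *: "(\<integral>x. sin (real (Suc k) * x) * sin x / (s + t - 2 * \<sigma> * sqrt (s * t) * cos x) \<partial>halfcircle) =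
    pi / (2 * s) * (\<sigma> * sqrt (t / s)) ^ k" if "0 < t" "t \<le> s" for s t :: real
  proof -
    have le: "\<bar>\<sigma> * sqrt (t / s)\<bar> \<le> 1" using that assms(3) by (auto simp: abs_mult)
    have "(\<integral>x. sin (real (Suc k) * x) * sin x / (s + t - 2 * \<sigma> * sqrt (s * t) * cos x) \<partial>halfcircle) =
      (\<integral>x. 1 / s * (sin (real (Suc k) * x) * sin x / poisson_den (\<sigma> * sqrt (t / s)) x) \<partial>halfcircle)"
      unfolding quad_poisson[OF that assms(3)] by simp
    also have "\<dots> = 1 / s * (pi / 2 * (\<sigma> * sqrt (t / s)) ^ k)"
      by (simp only: integral_mult_right_zero halfcircle_poisson[OF le])
    finally show ?thesis by simp
  qed
  show ?thesis
  proof (cases "t \<le> s")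
    case True
    then show ?thesis using *[OF assms(2) True] by (simp add: max_def min_def)
  next
    case False
    then show ?thesis using *[OF assms(1), of t]
      by (simp add: max_def min_def add.commute mult.commute[of t s])
  qed
qed

section \<open>Sums of measures\<close>

lemma add_measure_simps [simp]:
  "sets (add_measure M N) = sets M" "space (add_measure M N) = space M"
  by (simp_all add: add_measure_def sets.space_closed)

lemma emeasure_add_measure:
  assumes "sets M = sets N" "A \<in> sets M"
  shows "emeasure (add_measure M N) A = emeasure M A + emeasure N A"
  unfolding add_measure_def
proof (rule emeasure_measure_of_sigma[OF _ _ _ assms(2)])
  show "sigma_algebra (space M) (sets M)" by (rule sets.sigma_algebra_axioms)
  show "positive (sets M) (\<lambda>A. emeasure M A + emeasure N A)"
    by (simp add: positive_def)
  show "countably_additive (sets M) (\<lambda>A. emeasure M A + emeasure N A)"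
  proof (rule countably_additiveI)
    fix F :: "nat \<Rightarrow> 'a set"
    assume F: "range F \<subseteq> sets M" "disjoint_family F" "(\<Union>i. F i) \<in> sets M"
    have "(\<Sum>i. emeasure M (F i) + emeasure N (F i)) = (\<Sum>i. emeasure M (F i)) + (\<Sum>i. emeasure N (F i))"
      by (simp add: suminf_add)
    also have "\<dots> = emeasure M (\<Union>i. F i) + emeasure N (\<Union>i. F i)"
      using F assms(1) by (simp add: suminf_emeasure)
    finally show "(\<Sum>i. emeasure M (F i) + emeasure N (F i)) = emeasure M (\<Union>i. F i) + emeasure N (\<Union>i. F i)" .
  qed
qed

lemma nn_integral_add_measure:
  assumes "sets M = sets N" "f \<in> borel_measurable M"
  shows "(\<integral>\<^sup>+x. f x \<partial>add_measure M N) = (\<integral>\<^sup>+x. f x \<partial>M) + (\<integral>\<^sup>+x. f x \<partial>N)"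
  using assms(2)
proof (induction rule: borel_measurable_induct)
  case (cong f g)
  have "space N = space M" using sets_eq_imp_space_eq[OF assms(1)] by simp
  then have "(\<integral>\<^sup>+x. f x \<partial>L) = (\<integral>\<^sup>+x. g x \<partial>L)" if "L \<in> {M, N, add_measure M N}" for L
    using that cong(3) by (intro nn_integral_cong) auto
  with cong show ?case by simp
next
  case (set A)
  then show ?case using emeasure_add_measure[OF assms(1) set] assms(1) by simp
next
  case (mult u c)
  have "u \<in> borel_measurable N" "u \<in> borel_measurable (add_measure M N)"
    using mult(2) assms(1) by (simp_all cong: measurable_cong_sets)
  then show ?case using mult by (simp add: nn_integral_cmult distrib_left)
next
  case (add u v)
  have "u \<in> borel_measurable N" "u \<in> borel_measurable (add_measure M N)"
    "v \<in> borel_measurable N" "v \<in> borel_measurable (add_measure M N)"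
    using add.hyps(1,3) assms(1) by (simp_all cong: measurable_cong_sets)
  then show ?case using add by (simp add: nn_integral_add ac_simps)
next
  case (seq U)
  have m: "U i \<in> borel_measurable N" "U i \<in> borel_measurable (add_measure M N)" for i
    using seq.hyps(1)[of i] assms(1) by (simp_all cong: measurable_cong_sets)
  have inc: "incseq (\<lambda>i. \<integral>\<^sup>+x. U i x \<partial>L)" for L
    using seq.hyps(3) by (auto simp: incseq_def le_fun_def intro!: nn_integral_mono)
  have "(\<integral>\<^sup>+x. (SUP i. U i) x \<partial>add_measure M N) = (SUP i. \<integral>\<^sup>+x. U i x \<partial>add_measure M N)"
    unfolding SUP_apply by (rule nn_integral_monotone_convergence_SUP[OF seq.hyps(3) m(2)])
  also have "\<dots> = (SUP i. (\<integral>\<^sup>+x. U i x \<partial>M) + (\<integral>\<^sup>+x. U i x \<partial>N))"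
    using seq.IH by simp
  also have "\<dots> = (SUP i. \<integral>\<^sup>+x. U i x \<partial>M) + (SUP i. \<integral>\<^sup>+x. U i x \<partial>N)"
    by (rule ennreal_SUP_add[OF inc inc])
  also have "\<dots> = (\<integral>\<^sup>+x. (SUP i. U i) x \<partial>M) + (\<integral>\<^sup>+x. (SUP i. U i) x \<partial>N)"
    unfolding SUP_apply
    using nn_integral_monotone_convergence_SUP[OF seq.hyps(3) seq.hyps(1)] nn_integral_monotone_convergence_SUP[OF seq.hyps(3) m(1)] by simp
  finally show ?case .
qed

section \<open>The limit measure in the angular coordinate\<close>

text \<open>The limit measure with parameters \<open>p1, p2\<close>, regarded as the image of a measure on the half
  circle.\<close>

locale jacobi_law =
  fixes a b p1 p2 :: real
  assumes ab: "a < b" and p1: "0 < p1" "p1 < 1" and p2: "0 < p2" "p2 < 1"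
begin

text \<open>The numbers \<open>wA, wB\<close> are the recurrence coefficients of the dual chain of the periodic parameters,
  and \<open>wE, wD\<close> play the same role after the reflection that exchanges \<open>a\<close> and \<open>b\<close>.\<close>

definition wA where "wA = p1 * (1 - p2)"
definition wB where "wB = p2 * (1 - p1)"
definition wE where "wE = (1 - p1) * (1 - p2)"
definition wD where "wD = p1 * p2"

text \<open>The relative position in \<open>[a,b]\<close> at the angle \<open>t\<close>: the squared length of the third side of a triangle
  with sides \<open>\<surd> wA\<close> and \<open>\<surd> wB\<close>. The angle runs through \<open>[0, \<pi>]\<close> as the position
  runs through the support.\<close>

definition uang :: "real \<Rightarrow> real" where
  "uang t = wA + wB - 2 * sqrt (wA * wB) * cos t"

definition xang :: "real \<Rightarrow> real" where
  "xang t = a + (b - a) * uang t"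

text \<open>The density of the absolutely continuous part in the angle. The factor \<open>1 / (uang t * (1 - uang t))\<close>
  is split into partial fractions, because each summand has a Poisson denominator.\<close>

definition angw :: "real \<Rightarrow> real" where
  "angw t = 2 * (wA * wB) / (pi * p2) * ((sin t)\<^sup>2 / uang t + (sin t)\<^sup>2 / (1 - uang t))"

definition atom_a where "atom_a = max (1 - p1 / p2) 0"
definition atom_b where "atom_b = max ((p1 + p2 - 1) / p2) 0"

lemma w_pos: "0 < wA" "0 < wB" "0 < wE" "0 < wD"
  using p1 p2 by (simp_all add: wA_def wB_def wE_def wD_def)

lemma AB_ED: "wA * wB = wE * wD"
  by (simp add: wA_def wB_def wE_def wD_def)

lemma one_minus_uang: "1 - uang t = wE + wD + 2 * sqrt (wE * wD) * cos t"
proof -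
  have "1 - wA - wB = wE + wD"
    by (simp add: wA_def wB_def wE_def wD_def algebra_simps)
  then show ?thesis by (simp add: uang_def AB_ED)
qed

text \<open>In a triangle with sides \<open>\<surd> s\<close> and \<open>\<surd> r\<close> that enclose the angle \<open>t\<close>, the third side is at least the
  height \<open>\<surd> r * sin t\<close>; the sign \<open>\<sigma>\<close> replaces the angle by its supplement.\<close>

lemma quad_ge:
  assumes "0 \<le> s" "0 \<le> r" "\<sigma> = 1 \<or> \<sigma> = - 1"
  shows "r * (sin t)\<^sup>2 \<le> s + r - 2 * \<sigma> * sqrt (s * r) * cos t"
proof -
  have "s + r - 2 * \<sigma> * sqrt (s * r) * cos t - r * (sin t)\<^sup>2 = (sqrt s - \<sigma> * sqrt r * cos t)\<^sup>2"
  proof -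
    have "\<sigma>\<^sup>2 = 1" using assms(3) by auto
    then have "(sqrt s - \<sigma> * sqrt r * cos t)\<^sup>2 = s - 2 * \<sigma> * (sqrt s * sqrt r) * cos t + r * (cos t)\<^sup>2"
      using assms by (simp add: power2_diff power_mult_distrib)
    then show ?thesis by (simp add: real_sqrt_mult sin_squared_eq algebra_simps)
  qed
  then show ?thesis using zero_le_power2[of "sqrt s - \<sigma> * sqrt r * cos t"] by linarith
qed

lemma uang_ge: "wB * (sin t)\<^sup>2 \<le> uang t" "wD * (sin t)\<^sup>2 \<le> 1 - uang t"
  using quad_ge[of wA wB 1 t] quad_ge[of wE wD "-1" t] w_pos unfolding one_minus_uang
  by (simp_all add: uang_def)

lemma uang_nonneg: "0 \<le> uang t" and uang_le_1: "uang t \<le> 1"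
proof -
  have "0 \<le> wB * (sin t)\<^sup>2" "0 \<le> wD * (sin t)\<^sup>2" using w_pos by simp_all
  then show "0 \<le> uang t" "uang t \<le> 1" using uang_ge[of t] by linarith+
qed

lemma uang_pos:
  assumes "sin t \<noteq> 0"
  shows "0 < uang t" "uang t < 1"
proof -
  have "0 < wB * (sin t)\<^sup>2" "0 < wD * (sin t)\<^sup>2" using w_pos assms by simp_all
  then show "0 < uang t" "uang t < 1" using uang_ge[of t] by linarith+
qed

lemma xang_in: "xang t \<in> {a..b}"
proof -
  have "0 \<le> (b - a) * uang t" "(b - a) * uang t \<le> (b - a) * 1"
    using ab uang_nonneg uang_le_1 by (auto intro: mult_left_mono)
  then show ?thesis by (simp add: xang_def)
qed

lemma ucoord_xang: "ucoord a b (xang t) = uang t"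
  using ab by (simp add: ucoord_def xang_def)

lemma xang_continuous: "continuous_on S xang"
  unfolding xang_def uang_def by (intro continuous_intros)

lemma xang_measurable: "xang \<in> borel_measurable borel"
  by (rule borel_measurable_continuous_onI[OF xang_continuous])

lemma uang_measurable: "uang \<in> borel_measurable borel"
  unfolding uang_def by (intro borel_measurable_continuous_onI continuous_intros)

lemma angw_measurable: "angw \<in> borel_measurable borel"
  unfolding angw_def using uang_measurable by measurable

lemma angw_nonneg: "0 \<le> angw t"
  unfolding angw_def using w_pos p2 uang_nonneg[of t] uang_le_1[of t]
  by (intro mult_nonneg_nonneg add_nonneg_nonneg divide_nonneg_nonneg) auto

definition angw_bound where "angw_bound = 2 * (wA * wB) / (pi * p2) * (1 / wB + 1 / wD)"

lemma sin_quotient_bounds: "(sin t)\<^sup>2 / uang t \<le> 1 / wB" "(sin t)\<^sup>2 / (1 - uang t) \<le> 1 / wD"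
proof -
  show "(sin t)\<^sup>2 / uang t \<le> 1 / wB"
    using uang_ge(1)[of t] w_pos uang_pos[of t] by (cases "sin t = 0") (auto simp: field_simps)
  show "(sin t)\<^sup>2 / (1 - uang t) \<le> 1 / wD"
    using uang_ge(2)[of t] w_pos uang_pos[of t] by (cases "sin t = 0") (auto simp: field_simps)
qed

lemma angw_le: "angw t \<le> angw_bound"
  unfolding angw_def angw_bound_def using w_pos p2
  by (intro mult_left_mono add_mono sin_quotient_bounds) auto

lemma angw_abs_le: "\<bar>angw t\<bar> \<le> angw_bound"
  using angw_le angw_nonneg by (simp add: abs_of_nonneg)

lemma l_minus_eq: "l_minus a b p1 p2 = xang 0"
  and l_plus_eq: "l_plus a b p1 p2 = xang pi"
  using w_pos by (simp_all add: l_minus_def l_plus_def xang_def uang_def power2_diff power2_sum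
      real_sqrt_mult wA_def[symmetric] wB_def[symmetric])

lemma xang_deriv: "(xang has_real_derivative (2 * (b - a) * sqrt (wA * wB) * sin t)) (at t)"
  unfolding xang_def uang_def by (auto intro!: derivative_eq_intros)

text \<open>The derivative of the substitution turns the square root in the density into \<open>sin\<^sup>2\<close>.\<close>

lemma density_times_derivative:
  assumes "0 \<le> sin t"
  shows "sqrt ((xang t - xang 0) * (xang pi - xang t)) / (2 * pi * p2 * (xang t - a) * (b - xang t)) *
    (2 * (b - a) * sqrt (wA * wB) * sin t) = angw t"
proof (cases "sin t = 0")
  case True
  then show ?thesis by (simp add: angw_def)
next
  case False
  define r where "r = sqrt (wA * wB)"
  have r2: "r * r = wA * wB" using w_pos by (simp add: r_def)
  have r0: "0 \<le> r" using w_pos by (simp add: r_def)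
  have "(xang t - xang 0) * (xang pi - xang t) = (2 * (b - a) * r * sin t)\<^sup>2"
  proof -
    have d: "xang t - xang 0 = 2 * (b - a) * r * (1 - cos t)" "xang pi - xang t = 2 * (b - a) * r * (1 + cos t)"
      by (simp_all add: xang_def uang_def r_def algebra_simps)
    have "(xang t - xang 0) * (xang pi - xang t) = (2 * (b - a) * r)\<^sup>2 * (1 - (cos t)\<^sup>2)"
      unfolding d by (simp add: power2_eq_square algebra_simps)
    then show ?thesis by (simp only: sin_squared_eq[symmetric] power_mult_distrib)
  qed
  then have s: "sqrt ((xang t - xang 0) * (xang pi - xang t)) = 2 * (b - a) * r * sin t"
    using ab r0 assms by (simp add: real_sqrt_abs)
  have u: "uang t \<noteq> 0" "1 - uang t \<noteq> 0" using uang_pos[OF False] by auto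
  have x: "xang t - a = (b - a) * uang t" "b - xang t = (b - a) * (1 - uang t)"
    by (simp_all add: xang_def algebra_simps)
  have gen: "2 * c * r * s / (2 * pi * p2 * (c * u) * (c * v)) * (2 * c * r * s) = 2 * (r * r) / (pi * p2) * s\<^sup>2 * (1 / (u * v))"
    if "c \<noteq> 0" "u \<noteq> 0" "v \<noteq> 0" for c s u v :: real
    using that p2 by (simp add: field_simps power2_eq_square)
  have "2 * (b - a) * r * sin t / (2 * pi * p2 * ((b - a) * uang t) * ((b - a) * (1 - uang t))) * (2 * (b - a) * r * sin t) =
      2 * (r * r) / (pi * p2) * (sin t)\<^sup>2 * (1 / (uang t * (1 - uang t)))"
    by (rule gen) (use ab u in auto)
  also have "1 / (uang t * (1 - uang t)) = 1 / uang t + 1 / (1 - uang t)"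
    using u by (simp add: divide_simps)
  also have "2 * (r * r) / (pi * p2) * (sin t)\<^sup>2 * (1 / uang t + 1 / (1 - uang t)) = angw t"
    unfolding angw_def r2 by (simp only: mult.assoc distrib_left times_divide_eq_right mult_1_right)
  finally show ?thesis
    unfolding s x r_def[symmetric] .
qed

lemma angw_alt:
  assumes "sin t \<noteq> 0"
  shows "angw t = 2 * (wA * wB) / (pi * p2) * ((sin t)\<^sup>2 / (uang t * (1 - uang t)))"
proof -
  have "uang t \<noteq> 0" "1 - uang t \<noteq> 0" using uang_pos[OF assms] by auto
  then have "(sin t)\<^sup>2 / uang t + (sin t)\<^sup>2 / (1 - uang t) = (sin t)\<^sup>2 / (uang t * (1 - uang t))"
    by (simp add: divide_simps) (simp add: algebra_simps)
  then show ?thesis by (simp only: angw_def)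
qed

lemma xang_measurable_restrict: "xang \<in> measurable halfcircle (restrict_space borel {a..b})"
  by (rule measurable_restrict_space2) (use xang_in halfcircle_measurable[OF xang_measurable] in auto)

theorem mu_ac_eq_distr:
  "mu_ac a b p1 p2 = distr (density halfcircle (\<lambda>t. ennreal (angw t))) (restrict_space borel {a..b}) xang"
proof (rule measure_eqI)
  let ?l = "xang 0" and ?L = "xang pi"
  let ?h = "\<lambda>x. sqrt ((x - ?l) * (?L - x)) / (2 * pi * p2 * (x - a) * (b - x))"
  have sets: "sets (restrict_space lborel {a..b}) = sets (restrict_space borel {a..b :: real})"
    by (rule sets_restrict_space_cong) simp
  show "sets (mu_ac a b p1 p2) =
      sets (distr (density halfcircle (\<lambda>t. ennreal (angw t))) (restrict_space borel {a..b}) xang)"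
    by (simp add: mu_ac_def sets)
  fix S assume "S \<in> sets (mu_ac a b p1 p2)"
  then have S: "S \<in> sets (restrict_space lborel {a..b})" "S \<in> sets (restrict_space borel {a..b})"
    by (simp_all add: mu_ac_def sets)
  then have Sb: "S \<in> sets borel" "S \<subseteq> {a..b}"
    using S(2) by (auto simp: sets_restrict_space)
  have hm: "?h \<in> borel_measurable borel" by measurable
  have dm: "(\<lambda>x. indicator {?l..?L} x * ennreal (?h x)) \<in> borel_measurable borel"
    using hm by measurable
  have deq: "mu_ac a b p1 p2 = density (restrict_space lborel {a..b}) (\<lambda>x. indicator {?l..?L} x * ennreal (?h x))"
    by (simp add: mu_ac_def l_minus_eq l_plus_eq)
  have dm': "(\<lambda>x. indicator {?l..?L} x * ennreal (?h x)) \<in> borel_measurable (restrict_space lborel {a..b})"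
    by (rule measurable_restrict_space1) (use dm in simp)
  have "emeasure (mu_ac a b p1 p2) S =
      (\<integral>\<^sup>+x. indicator {?l..?L} x * ennreal (?h x) * indicator S x \<partial>restrict_space lborel {a..b})"
    unfolding deq by (rule emeasure_density[OF dm' S(1)])
  also have "\<dots> = (\<integral>\<^sup>+x. indicator {?l..?L} x * ennreal (?h x) * indicator S x * indicator {a..b} x \<partial>lborel)"
    by (rule nn_integral_restrict_space) simp
  also have "\<dots> = (\<integral>\<^sup>+x. (ennreal (?h x) * indicator S x) * indicator {?l..?L} x \<partial>lborel)"
    using Sb(2) by (intro nn_integral_cong) (auto simp: indicator_def)
  also have "\<dots> = (\<integral>\<^sup>+t. (ennreal (?h (xang t)) * indicator S (xang t)) *
      ennreal (2 * (b - a) * sqrt (wA * wB) * sin t) * indicator {0..pi} t \<partial>lborel)"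
  proof (rule nn_integral_substitution_aux)
    show "(\<lambda>x. ennreal (?h x) * indicator S x) \<in> borel_measurable borel"
      using hm Sb(1) by measurable
    show "0 \<le> 2 * (b - a) * sqrt (wA * wB) * sin t" if "t \<in> {0..pi}" for t
      using that ab w_pos by (intro mult_nonneg_nonneg sin_ge_zero) auto
    show "continuous_on {0..pi} (\<lambda>t. 2 * (b - a) * sqrt (wA * wB) * sin t)"
      by (intro continuous_intros)
    show "(xang has_real_derivative 2 * (b - a) * sqrt (wA * wB) * sin t) (at t)" for t
      by (rule xang_deriv)
  qed simp_all
  also have "\<dots> = (\<integral>\<^sup>+t. ennreal (angw t) * indicator S (xang t) * indicator {0..pi} t \<partial>lborel)"
  proof (rule nn_integral_cong)
    fix t :: real
    show "(ennreal (?h (xang t)) * indicator S (xang t)) *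
      ennreal (2 * (b - a) * sqrt (wA * wB) * sin t) * indicator {0..pi} t =
      ennreal (angw t) * indicator S (xang t) * indicator {0..pi} t"
    proof (cases "t \<in> {0..pi}")
      case True
      then have s: "0 \<le> sin t" by (simp add: sin_ge_zero)
      have "0 \<le> 2 * (b - a) * sqrt (wA * wB) * sin t"
        using s ab w_pos by (intro mult_nonneg_nonneg) auto
      then have e: "ennreal (?h (xang t)) * ennreal (2 * (b - a) * sqrt (wA * wB) * sin t) = ennreal (angw t)"
        unfolding density_times_derivative[OF s, symmetric] by (rule ennreal_mult''[symmetric])
      show ?thesis unfolding e[symmetric] by (simp only: mult_ac)
    qed simp
  qed
  also have "\<dots> = (\<integral>\<^sup>+t. ennreal (angw t) * indicator S (xang t) \<partial>halfcircle)"
    unfolding halfcircle_def by (rule nn_integral_restrict_space[symmetric]) simp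
  also have "\<dots> = (\<integral>\<^sup>+t. ennreal (angw t) * indicator (xang -` S \<inter> space halfcircle) t \<partial>halfcircle)"
    by (intro nn_integral_cong) (auto simp: indicator_def)
  also have "\<dots> = emeasure (density halfcircle (\<lambda>t. ennreal (angw t))) (xang -` S \<inter> space halfcircle)"
    using measurable_sets[OF xang_measurable_restrict S(2)]
    by (intro emeasure_density[symmetric]) (auto intro!: halfcircle_measurable measurable_compose[OF angw_measurable])
  also have "\<dots> = emeasure (distr (density halfcircle (\<lambda>t. ennreal (angw t))) (restrict_space borel {a..b}) xang) S"
    using xang_measurable_restrict S(2) by (subst emeasure_distr) auto
  finally show "emeasure (mu_ac a b p1 p2) S =
     emeasure (distr (density halfcircle (\<lambda>t. ennreal (angw t))) (restrict_space borel {a..b}) xang) S" .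
qed

lemma nn_integral_mu_ac:
  assumes "f \<in> borel_measurable borel"
  shows "(\<integral>\<^sup>+x. f x \<partial>mu_ac a b p1 p2) = (\<integral>\<^sup>+t. ennreal (angw t) * f (xang t) \<partial>halfcircle)"
proof -
  have f: "f \<in> borel_measurable (restrict_space borel {a..b})"
    by (rule measurable_restrict_space1[OF assms])
  have "(\<integral>\<^sup>+x. f x \<partial>mu_ac a b p1 p2) = (\<integral>\<^sup>+t. f (xang t) \<partial>density halfcircle (\<lambda>t. ennreal (angw t)))"
    unfolding mu_ac_eq_distr using xang_measurable_restrict f by (intro nn_integral_distr) auto
  also have "\<dots> = (\<integral>\<^sup>+t. ennreal (angw t) * f (xang t) \<partial>halfcircle)"
    by (intro nn_integral_density halfcircle_measurable measurable_compose[OF angw_measurable measurable_ennreal]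
        measurable_compose[OF xang_measurable assms])
  finally show ?thesis .
qed

lemma mu_d_sets: "sets (mu_d a b p1 p2) = sets (restrict_space borel {a..b})"
  by (simp add: mu_d_def)

lemma mu_ac_sets: "sets (mu_ac a b p1 p2) = sets (restrict_space borel {a..b})"
  by (simp add: mu_ac_eq_distr)

text \<open>Every integral against the limit measure is an integral over angles plus two atoms.\<close>

lemma nn_integral_mu_lim:
  assumes "f \<in> borel_measurable borel"
  shows "(\<integral>\<^sup>+x. f x \<partial>mu_lim a b p1 p2) =
    (\<integral>\<^sup>+t. ennreal (angw t) * f (xang t) \<partial>halfcircle) + ennreal atom_a * f a + ennreal atom_b * f b"
proof -
  let ?R = "restrict_space borel {a..b}"
  have f: "f \<in> borel_measurable ?R"
    by (rule measurable_restrict_space1[OF assms])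
  have sp: "space ?R = {a..b}" by (simp add: space_restrict_space)
  have m: "f \<in> borel_measurable (scale_measure c (return ?R x))" for c x
    by (subst measurable_cong_sets[of _ ?R _ borel]) (use f in simp_all)
  have "(\<integral>\<^sup>+x. f x \<partial>mu_d a b p1 p2) = ennreal atom_a * f a + ennreal atom_b * f b"
    unfolding mu_d_def atom_a_def atom_b_def
    using f ab sp by (subst nn_integral_add_measure[OF _ m]) (auto simp: nn_integral_scale_measure nn_integral_return)
  moreover have "(\<integral>\<^sup>+x. f x \<partial>mu_lim a b p1 p2) = (\<integral>\<^sup>+x. f x \<partial>mu_ac a b p1 p2) + (\<integral>\<^sup>+x. f x \<partial>mu_d a b p1 p2)"
    unfolding mu_lim_def
    by (rule nn_integral_add_measure) (use f mu_ac_sets mu_d_sets in \<open>auto cong: measurable_cong_sets\<close>)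
  ultimately show ?thesis using nn_integral_mu_ac[OF assms] by (simp add: add.assoc)
qed

lemma angw_mult_integrable:
  assumes "f \<in> borel_measurable borel" "\<And>t. \<bar>f t\<bar> \<le> B"
  shows "integrable halfcircle (\<lambda>t. angw t * f t)"
proof (rule halfcircle_integrable)
  show "(\<lambda>t. angw t * f t) \<in> borel_measurable borel"
    using assms(1) angw_measurable by measurable
  show "\<bar>angw t * f t\<bar> \<le> angw_bound * B" for t
    unfolding abs_mult using angw_abs_le[of t] assms(2)[of t] by (intro mult_mono) auto
qed

lemma sin_quotient_integrals:
  "(\<integral>t. (sin t)\<^sup>2 / uang t \<partial>halfcircle) = pi / (2 * max wA wB)"
  "(\<integral>t. (sin t)\<^sup>2 / (1 - uang t) \<partial>halfcircle) = pi / (2 * max wE wD)"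
  using halfcircle_quad[of wA wB 1 0] halfcircle_quad[of wE wD "-1" 0] w_pos
  by (simp_all add: one_minus_uang) (simp_all add: uang_def power2_eq_square)

lemma sin_quotient_integrable:
  "integrable halfcircle (\<lambda>t. (sin t)\<^sup>2 / uang t)"
  "integrable halfcircle (\<lambda>t. (sin t)\<^sup>2 / (1 - uang t))"
proof -
  show "integrable halfcircle (\<lambda>t. (sin t)\<^sup>2 / uang t)"
    using uang_measurable sin_quotient_bounds uang_nonneg
    by (intro halfcircle_integrable[of _ "1 / wB"]) (measurable, auto)
  show "integrable halfcircle (\<lambda>t. (sin t)\<^sup>2 / (1 - uang t))"
    using uang_measurable sin_quotient_bounds uang_le_1
    by (intro halfcircle_integrable[of _ "1 / wD"]) (measurable, auto)
qed

lemma mass_pieces: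
  "2 * (wA * wB) / (pi * p2) * (pi / (2 * max wA wB)) = min wA wB / p2"
  "2 * (wA * wB) / (pi * p2) * (pi / (2 * max wE wD)) = min wE wD / p2"
proof -
  have "x * y / max x y = min x y" if "0 < x" "0 < y" for x y :: real
    using that by (auto simp: max_def min_def)
  from this[OF w_pos(1,2)] this[OF w_pos(3,4)] show
    "2 * (wA * wB) / (pi * p2) * (pi / (2 * max wA wB)) = min wA wB / p2"
    "2 * (wA * wB) / (pi * p2) * (pi / (2 * max wE wD)) = min wE wD / p2"
    using p2 by (simp_all add: AB_ED[symmetric] divide_simps)
qed

lemma atoms:
  "min wA wB / p2 = 1 - p1 - atom_a" "min wE wD / p2 = p1 - atom_b"
proof -
  have "min wA wB = p2 * (1 - p1) - p2 * atom_a"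
  proof -
    have "p2 * atom_a = max (p2 - p1) 0"
      unfolding atom_a_def using p2 by (simp add: max_mult_distrib_left algebra_simps max_def)
    moreover have "wA = wB + (p1 - p2)" by (simp add: wA_def wB_def algebra_simps)
    ultimately show ?thesis by (auto simp: wB_def[symmetric] min_def max_def)
  qed
  then show "min wA wB / p2 = 1 - p1 - atom_a" using p2 by (simp add: field_simps)
  have "min wE wD = p2 * p1 - p2 * atom_b"
  proof -
    have "p2 * atom_b = max (p1 + p2 - 1) 0"
      unfolding atom_b_def using p2 by (auto simp: max_def divide_simps)
    moreover have "wE = wD - (p1 + p2 - 1)" by (simp add: wE_def wD_def algebra_simps)
    moreover have "p2 * p1 = wD" by (simp add: wD_def)
    ultimately show ?thesis by (auto simp: min_def max_def)
  qed
  then show "min wE wD / p2 = p1 - atom_b" using p2 by (simp add: field_simps)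
qed

lemma angw_mass: "(\<integral>t. angw t \<partial>halfcircle) = 1 - atom_a - atom_b"
proof -
  have "(\<integral>t. angw t \<partial>halfcircle) =
     2 * (wA * wB) / (pi * p2) * (pi / (2 * max wA wB) + pi / (2 * max wE wD))"
    unfolding angw_def using sin_quotient_integrable sin_quotient_integrals by simp
  also have "\<dots> = 1 - atom_a - atom_b"
    unfolding distrib_left mass_pieces atoms by simp
  finally show ?thesis .
qed

lemma atoms_nonneg: "0 \<le> atom_a" "0 \<le> atom_b"
  by (simp_all add: atom_a_def atom_b_def)

lemma angw_integrable: "integrable halfcircle angw"
  by (rule halfcircle_integrable[OF angw_measurable angw_abs_le])

text \<open>The two Poisson integrals depend on which of \<open>wA, wB\<close> and which of \<open>wE, wD\<close> is larger; the positive
  parts in the weights of the atoms compensate this.\<close>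

theorem mu_lim_in: "mu_lim a b p1 p2 \<in> borel_prob_on a b"
proof -
  have "(\<integral>\<^sup>+t. ennreal (angw t) \<partial>halfcircle) = ennreal (1 - atom_a - atom_b)"
    unfolding angw_mass[symmetric] by (rule nn_integral_eq_integral[OF angw_integrable]) (simp add: angw_nonneg)
  then have "(\<integral>\<^sup>+x. 1 \<partial>mu_lim a b p1 p2) = ennreal (1 - atom_a - atom_b) + ennreal atom_a + ennreal atom_b"
    using nn_integral_mu_lim[of "\<lambda>_. 1"] by simp
  also have "\<dots> = ennreal 1"
  proof -
    have "0 \<le> 1 - atom_a - atom_b"
      unfolding angw_mass[symmetric] by (simp add: angw_nonneg)
    then show ?thesis using atoms_nonneg by (simp flip: ennreal_plus)
  qed
  finally have "emeasure (mu_lim a b p1 p2) (space (mu_lim a b p1 p2)) = 1" by simp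
  then have "prob_space (mu_lim a b p1 p2)" by (rule prob_spaceI)
  then show ?thesis
    unfolding borel_prob_on_def by (simp add: mu_lim_def mu_ac_sets)
qed

theorem mu_lim_integral:
  assumes f: "continuous_on UNIV f"
  shows "(\<integral>x. f x \<partial>mu_lim a b p1 p2) =
    (\<integral>t. angw t * f (xang t) \<partial>halfcircle) + atom_a * f a + atom_b * f b"
proof -
  let ?\<mu> = "mu_lim a b p1 p2"
  interpret prob_space ?\<mu> by (rule borel_prob_onD[OF mu_lim_in])
  have fm: "f \<in> borel_measurable borel" by (rule borel_measurable_continuous_onI[OF f])
  have "compact (f ` {a..b})"
    by (rule compact_continuous_image[OF continuous_on_subset[OF f]]) auto
  then obtain B where B': "\<forall>y\<in>f ` {a..b}. norm y \<le> B"
    using compact_imp_bounded[of "f ` {a..b}"] unfolding bounded_iff by blast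
  then have B: "\<bar>f x\<bar> \<le> B" if "x \<in> {a..b}" for x using that by simp
  have fx: "integrable halfcircle (\<lambda>t. angw t * f (xang t))"
    by (rule angw_mult_integrable[of _ B]) (use B[OF xang_in] measurable_compose[OF xang_measurable fm] in auto)
  have int: "integrable ?\<mu> f" by (rule borel_prob_on_integrable[OF mu_lim_in f])
  have eq: "(\<integral>t. angw t * (f (xang t) + B) \<partial>halfcircle) = (\<integral>t. angw t * f (xang t) \<partial>halfcircle) + B * (1 - atom_a - atom_b)"
    unfolding distrib_left using fx angw_integrable by (simp add: angw_mass mult.commute)
  have pos: "0 \<le> f x + B" if "x \<in> {a..b}" for x using B[OF that] by (simp add: abs_le_iff)
  have "ennreal (\<integral>x. f x + B \<partial>?\<mu>) = (\<integral>\<^sup>+x. ennreal (f x + B) \<partial>?\<mu>)"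
    using int pos borel_prob_onD(3)[OF mu_lim_in]
    by (intro nn_integral_eq_integral[symmetric] AE_I2) auto
  also have "\<dots> = (\<integral>\<^sup>+t. ennreal (angw t) * ennreal (f (xang t) + B) \<partial>halfcircle) + ennreal atom_a * ennreal (f a + B) + ennreal atom_b * ennreal (f b + B)"
    by (rule nn_integral_mu_lim) (use fm in measurable)
  also have "(\<integral>\<^sup>+t. ennreal (angw t) * ennreal (f (xang t) + B) \<partial>halfcircle) = (\<integral>\<^sup>+t. ennreal (angw t * (f (xang t) + B)) \<partial>halfcircle)"
    using pos xang_in angw_nonneg by (intro nn_integral_cong) (simp add: ennreal_mult)
  also have "\<dots> = ennreal (\<integral>t. angw t * (f (xang t) + B) \<partial>halfcircle)"
  proof (rule nn_integral_eq_integral)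
    show "integrable halfcircle (\<lambda>t. angw t * (f (xang t) + B))"
      unfolding distrib_left using fx angw_integrable by simp
    show "AE t in halfcircle. 0 \<le> angw t * (f (xang t) + B)"
      using pos xang_in angw_nonneg by simp
  qed
  also have "\<dots> + ennreal atom_a * ennreal (f a + B) + ennreal atom_b * ennreal (f b + B) =
     ennreal ((\<integral>t. angw t * (f (xang t) + B) \<partial>halfcircle) + atom_a * (f a + B) + atom_b * (f b + B))"
  proof -
    have "0 \<le> f a + B" "0 \<le> f b + B" using pos ab by auto
    moreover have "0 \<le> (\<integral>t. angw t * (f (xang t) + B) \<partial>halfcircle)"
      using pos xang_in angw_nonneg by (intro Bochner_Integration.integral_nonneg) simp
    ultimately show ?thesis using atoms_nonneg by (simp add: ennreal_mult)
  qed
  finally have "(\<integral>x. f x + B \<partial>?\<mu>) = (\<integral>t. angw t * (f (xang t) + B) \<partial>halfcircle) + atom_a * (f a + B) + atom_b * (f b + B)"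
  proof (rule ennreal_inj[THEN iffD1, rotated 2])
    show "0 \<le> (\<integral>x. f x + B \<partial>?\<mu>)"
      using pos borel_prob_onD(3)[OF mu_lim_in] by (intro Bochner_Integration.integral_nonneg) auto
    have "0 \<le> f a + B" "0 \<le> f b + B" using pos ab by auto
    moreover have "0 \<le> (\<integral>t. angw t * (f (xang t) + B) \<partial>halfcircle)"
      using pos xang_in angw_nonneg by (intro Bochner_Integration.integral_nonneg) simp
    ultimately show "0 \<le> (\<integral>t. angw t * (f (xang t) + B) \<partial>halfcircle) + atom_a * (f a + B) + atom_b * (f b + B)"
      using atoms_nonneg by simp
  qed
  moreover have "(\<integral>x. f x + B \<partial>?\<mu>) = (\<integral>x. f x \<partial>?\<mu>) + B"
    using int by (simp add: prob_space)
  ultimately show ?thesis unfolding eq by (simp add: algebra_simps)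
qed

section \<open>The canonical moments of the limit measure\<close>

lemma sin_step: "sin (real (Suc (Suc k)) * t) = 2 * cos t * sin (real (Suc k) * t) - sin (real k * t)"
proof -
  have "real (Suc (Suc k)) * t = real (Suc k) * t + t" "real k * t = real (Suc k) * t - t"
    by (simp_all add: algebra_simps)
  then show ?thesis by (simp only: sin_add sin_diff) simp
qed

lemma dual_chain_alternate:
  "dual_chain (alternate p1 p2) (Suc (2 * k)) = wA" "dual_chain (alternate p1 p2) (Suc (Suc (2 * k))) = wB"
  by (simp_all add: dual_chain_def qc_def alternate_def wA_def wB_def)

text \<open>On the support the dual orthogonal polynomials are combinations of Chebyshev polynomials of the
  second kind, since the dual recurrence has period two.\<close>

lemma dual_orth_angle:
  fixes t :: real
  defines "\<gamma> \<equiv> dual_chain (alternate p1 p2)" and "y \<equiv> sqrt (uang t)" and "r \<equiv> sqrt (wA * wB)"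
  shows "sin t * poly (orth \<gamma> (2 * k)) y = (- r) ^ k * (sin (real (Suc k) * t) - sqrt wB / sqrt wA * sin (real k * t)) \<and>
    sin t * poly (orth \<gamma> (Suc (2 * k))) y = y * (- r) ^ k * sin (real (Suc k) * t)"
proof (induction k)
  case 0
  then show ?case by simp
next
  case (Suc k)
  define \<beta> where "\<beta> = sqrt wB / sqrt wA"
  have Ab: "wA * \<beta> = r" "r * \<beta> = wB"
    using w_pos by (simp_all add: \<beta>_def r_def real_sqrt_mult field_simps)
  have y2: "y * y = wA + wB - 2 * r * cos t"
    using uang_nonneg[of t] by (simp add: y_def r_def) (simp add: uang_def)
  let ?s = "\<lambda>k. sin (real k * t)"
  have E: "sin t * poly (orth \<gamma> (Suc (Suc (2 * k)))) y = (- r) ^ Suc k * (?s (Suc (Suc k)) - \<beta> * ?s (Suc k))"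
  proof -
    have "sin t * poly (orth \<gamma> (Suc (Suc (2 * k)))) y =
       y * (sin t * poly (orth \<gamma> (Suc (2 * k))) y) - wA * (sin t * poly (orth \<gamma> (2 * k)) y)"
      using dual_chain_alternate(1)[of k] by (simp add: \<gamma>_def algebra_simps)
    also have "\<dots> = (- r) ^ k * ((y * y) * ?s (Suc k) - wA * ?s (Suc k) + (wA * \<beta>) * ?s k)"
      unfolding Suc[THEN conjunct1] Suc[THEN conjunct2] \<beta>_def[symmetric] by (simp add: algebra_simps)
    also have "\<dots> = (- r) ^ k * (wB * ?s (Suc k) - r * ?s (Suc (Suc k)))"
      unfolding y2 Ab sin_step[of k] by (simp add: algebra_simps)
    also have "\<dots> = (- r) ^ Suc k * (?s (Suc (Suc k)) - \<beta> * ?s (Suc k))"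
      unfolding Ab(2)[symmetric] by (simp add: algebra_simps)
    finally show ?thesis .
  qed
  have O: "sin t * poly (orth \<gamma> (Suc (Suc (Suc (2 * k))))) y = y * (- r) ^ Suc k * ?s (Suc (Suc k))"
  proof -
    have "sin t * poly (orth \<gamma> (Suc (Suc (Suc (2 * k))))) y =
       y * (sin t * poly (orth \<gamma> (Suc (Suc (2 * k)))) y) - wB * (sin t * poly (orth \<gamma> (Suc (2 * k))) y)"
      using dual_chain_alternate(2)[of k] by (simp add: \<gamma>_def algebra_simps)
    also have "\<dots> = y * (- r) ^ Suc k * (?s (Suc (Suc k)) - \<beta> * ?s (Suc k)) - wB * (y * (- r) ^ k * ?s (Suc k))"
      unfolding E Suc[THEN conjunct2] by (simp add: algebra_simps)
    also have "\<dots> = y * (- r) ^ Suc k * ?s (Suc (Suc k))"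
      unfolding Ab(2)[symmetric] by (simp add: algebra_simps)
    finally show ?thesis .
  qed
  show ?case using E O by (simp only: \<beta>_def mult_Suc_right add_2_eq_Suc)
qed

text \<open>The polynomials \<open>(1 - t\<^sup>2) t T(t)\<close> with \<open>T\<close> a dual orthogonal polynomial of odd degree. They vanish at
  the images of both end points, so the atoms do not contribute, and their other factors cancel the
  denominator of the density.\<close>

definition test_poly :: "nat \<Rightarrow> real poly" where
  "test_poly k = edge_weight * pCons 0 (orth (dual_chain (alternate p1 p2)) (Suc (2 * k)))"

lemma test_poly_degree: "degree (test_poly k) \<le> 2 * k + 4" "coeff (test_poly k) (2 * k + 4) = - 1"
proof -
  let ?P = "pCons 0 (orth (dual_chain (alternate p1 p2)) (Suc (2 * k)))"
  have d: "degree ?P \<le> 2 * k + 2"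
    using degree_pCons_le[of 0 "orth (dual_chain (alternate p1 p2)) (Suc (2 * k))"] by simp
  have e: "2 * k + 4 = 2 + (2 * k + 2)" by simp
  show "degree (test_poly k) \<le> 2 * k + 4"
    using degree_mult_le[of edge_weight ?P] d unfolding test_poly_def e by (simp add: edge_weight_def del: mult_pCons_left mult_pCons_right)
  have "coeff ?P (2 * k + 2) = 1"
    using coeff_orth_top[of "dual_chain (alternate p1 p2)" "Suc (2 * k)"] by simp
  then show "coeff (test_poly k) (2 * k + 4) = - 1"
    unfolding test_poly_def e using d
    by (subst coeff_mult_top) (auto simp: edge_weight_def numeral_2_eq_2)
qed

text \<open>Orthogonality of the dual polynomials.\<close>

lemma favard_test_poly: "favard (chain (alternate p1 p2)) (test_poly k) = (if k = 0 then (1 - p1) * wA else 0)"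
  unfolding test_poly_def favard_dual
  using dual_chain_alternate(1)[of 0]
  by (simp add: favard_def ocoeff_shift_0 ocoeff_orth qc_def alternate_def del: orth.simps)

text \<open>Orthogonality of the functions \<open>sin (k t)\<close> on the half circle.\<close>

lemma lin_test_poly: "lin (sym_moment a b (mu_lim a b p1 p2)) (test_poly k) = (if k = 0 then (1 - p1) * wA else 0)"
proof -
  let ?T = "orth (dual_chain (alternate p1 p2)) (Suc (2 * k))"
  let ?f = "\<lambda>x. (poly (test_poly k) (sqrt (ucoord a b x)) + poly (test_poly k) (- sqrt (ucoord a b x))) / 2"
  let ?r = "sqrt (wA * wB)"
  have "poly (test_poly k) (- y) = poly (test_poly k) y" for y
    using poly_orth_minus[of "dual_chain (alternate p1 p2)" "Suc (2 * k)" y]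
    by (simp add: test_poly_def edge_weight_def algebra_simps del: orth.simps)
  then have f: "?f x = poly (test_poly k) (sqrt (ucoord a b x))" for x by simp
  have fa: "?f a = 0" "?f b = 0"
    unfolding f using ab by (simp_all add: test_poly_def ucoord_def edge_weight_def)
  have fang: "angw t * ?f (xang t) = 2 * (wA * wB) / (pi * p2) * (- ?r) ^ k * (sin (real (Suc k) * t) * sin t)" for t
  proof (cases "sin t = 0")
    case False
    let ?y = "sqrt (uang t)"
    have u: "uang t \<noteq> 0" "1 - uang t \<noteq> 0" using uang_pos[OF False] by auto
    have y2: "?y * ?y = uang t" using uang_nonneg by simp
    have "poly (test_poly k) y = (1 - y * y) * (y * poly ?T y)" for y
      by (simp add: test_poly_def edge_weight_def algebra_simps del: orth.simps)
    then have "?f (xang t) = (1 - uang t) * (?y * poly ?T ?y)"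
      unfolding f unfolding ucoord_xang by (simp only: y2)
    with angw_alt[OF False] have "angw t * ?f (xang t) = 2 * (wA * wB) / (pi * p2) * (sin t * (sin t * poly ?T ?y) * ?y / uang t)"
      using u by (simp add: power2_eq_square) (simp add: mult_ac)
    also have "\<dots> = 2 * (wA * wB) / (pi * p2) * (sin t * ((- ?r) ^ k * sin (real (Suc k) * t)) * (?y * ?y) / uang t)"
      using dual_orth_angle[of t k] by (simp only: mult_ac)
    also have "\<dots> = 2 * (wA * wB) / (pi * p2) * (- ?r) ^ k * (sin (real (Suc k) * t) * sin t)"
      unfolding y2 using u by simp
    finally show ?thesis .
  qed (simp add: angw_def)
  have "continuous_on UNIV ?f"
    unfolding f ucoord_def using ab by (intro continuous_intros) auto
  then have "lin (sym_moment a b (mu_lim a b p1 p2)) (test_poly k) = (\<integral>t. angw t * ?f (xang t) \<partial>halfcircle)"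
    unfolding lin_sym_moment[OF ab mu_lim_in] using fa by (subst mu_lim_integral) auto
  also have "\<dots> = 2 * (wA * wB) / (pi * p2) * (- ?r) ^ k * (if k = 0 then pi / 2 else 0)"
    unfolding fang by (simp only: integral_mult_right_zero halfcircle_sin_sin)
  also have "\<dots> = (if k = 0 then (1 - p1) * wA else 0)"
    using p2 by (simp add: wB_def)
  finally show ?thesis .
qed

text \<open>The mass and the first moment are computed directly. From there on, agreement on the test
  polynomials determines one even power after the other, by \<open>lin_diff_top\<close>.\<close>

lemma sym_moment_mu_lim: "sym_moment a b (mu_lim a b p1 p2) i = path_weight (chain (alternate p1 p2)) i 0"
proof (induction i rule: less_induct)
  case (less i)
  let ?\<mu> = "mu_lim a b p1 p2"
  interpret prob_space ?\<mu> by (rule borel_prob_onD[OF mu_lim_in])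
  consider "odd i" | "i = 0" | "i = 2" | k where "i = 2 * k + 4"
  proof -
    have "even i \<Longrightarrow> \<exists>l. i = 2 * l" by blast
    moreover have "l = 0 \<or> l = 1 \<or> (\<exists>k. l = k + 2)" for l :: nat by presburger
    ultimately show ?thesis using that by (metis add_mult_distrib2 mult_0_right mult.right_neutral numeral_Bit0 mult_2)
  qed
  then show ?case
  proof cases
    case 1
    then show ?thesis by (simp add: sym_moment_def path_weight_odd)
  next
    case 2
    then show ?thesis by (simp add: sym_moment_def prob_space)
  next
    case 3
    have "continuous_on UNIV (\<lambda>x. 1 - ucoord a b x)"
      using ab unfolding ucoord_def by (intro continuous_intros) auto
    from mu_lim_integral[OF this]
    have "(\<integral>x. 1 - ucoord a b x \<partial>?\<mu>) = (\<integral>t. angw t * (1 - uang t) \<partial>halfcircle) +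
        atom_a * (1 - ucoord a b a) + atom_b * (1 - ucoord a b b)"
      unfolding ucoord_xang .
    also have "\<dots> = (\<integral>t. angw t * (1 - uang t) \<partial>halfcircle) + atom_a"
      using ab by (simp add: ucoord_def)
    also have "(\<integral>t. angw t * (1 - uang t) \<partial>halfcircle) = (\<integral>t. 2 * (wA * wB) / (pi * p2) * ((sin t)\<^sup>2 / uang t) \<partial>halfcircle)"
    proof (rule Bochner_Integration.integral_cong)
      fix t
      show "angw t * (1 - uang t) = 2 * (wA * wB) / (pi * p2) * ((sin t)\<^sup>2 / uang t)"
      proof (cases "sin t = 0")
        case False
        then have "1 - uang t \<noteq> 0" using uang_pos[of t] by auto
        then show ?thesis unfolding angw_alt[OF False] by simp
      qed (simp add: angw_def)
    qed simp
    also have "\<dots> = 1 - p1 - atom_a"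
      by (simp only: integral_mult_right_zero sin_quotient_integrals mass_pieces atoms)
    finally have "(\<integral>x. 1 - ucoord a b x \<partial>?\<mu>) = 1 - p1" by simp
    moreover have "integrable ?\<mu> (ucoord a b)"
      by (rule borel_prob_on_integrable[OF mu_lim_in]) (use ab in \<open>auto simp: ucoord_def intro!: continuous_intros\<close>)
    ultimately have "(\<integral>x. ucoord a b x \<partial>?\<mu>) = p1" by (simp add: prob_space)
    moreover have "path_weight (chain (alternate p1 p2)) 2 0 = p1"
      by (simp add: numeral_2_eq_2 chain_def qc_def alternate_def)
    ultimately show ?thesis using 3 by (simp add: sym_moment_def)
  next
    case (4 k)
    \<comment> \<open>The test polynomial has degree \<open>2 * k + 4\<close>, hence it determines this moment from the lower ones.\<close>
    let ?f = "sym_moment a b ?\<mu>" and ?g = "\<lambda>i. path_weight (chain (alternate p1 p2)) i 0"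
    have "lin ?f (test_poly k) - lin ?g (test_poly k) = coeff (test_poly k) (2 * k + 4) * (?f (2 * k + 4) - ?g (2 * k + 4))"
      by (rule lin_diff_top) (use less 4 test_poly_degree in auto)
    then show ?thesis
      using favard_test_poly[of k] 4 by (simp add: lin_test_poly favard_lin test_poly_degree)
  qed
qed

theorem moment_mu_lim: "moment j (mu_lim a b p1 p2) = cmom a b (alternate p1 p2) j"
proof -
  have "sym_moment a b (mu_lim a b p1 p2) = (\<lambda>i. path_weight (chain (alternate p1 p2)) i 0)"
    by (rule ext) (rule sym_moment_mu_lim)
  then show ?thesis
    using lin_sym_moment_xpoly[OF ab mu_lim_in, of j] by (simp add: cmom_def favard_lin)
qed

end

section \<open>The regularized logarithmic kernel\<close>

text \<open>The real part of \<open>- log (1 - \<rho> exp (i x))\<close>.\<close>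

definition log_poisson :: "real \<Rightarrow> real \<Rightarrow> real" where
  "log_poisson \<rho> x = - ln (poisson_den \<rho> x) / 2"

text \<open>A regularization of \<open>log_kernel\<close> with an absolutely convergent Chebyshev expansion, see
  \<open>reg_log_kernel_sums\<close>.\<close>

definition reg_log_kernel :: "real \<Rightarrow> real \<Rightarrow> real \<Rightarrow> real" where
  "reg_log_kernel \<rho> x y = log_poisson \<rho> (x - y) + log_poisson \<rho> (x + y)"

text \<open>The logarithmic kernel \<open>- ln \<bar>u - v\<bar>\<close> at \<open>u = 2 cos x\<close> and \<open>v = 2 cos y\<close>.\<close>

definition log_kernel :: "real \<Rightarrow> real \<Rightarrow> real" where
  "log_kernel x y = - ln (2 * \<bar>cos x - cos y\<bar>)"

text \<open>The real part of the Mercator series.\<close>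

lemma log_poisson_sums:
  assumes "\<bar>\<rho>\<bar> < 1"
  shows "(\<lambda>k. \<rho> ^ k * cos (real k * x) / real k) sums log_poisson \<rho> x"
proof -
  define z where "z = - (complex_of_real \<rho> * cis x)"
  have nz: "cmod z < 1" using assms by (simp add: z_def norm_mult)
  have sq: "(cmod (1 + z))\<^sup>2 = poisson_den \<rho> x"
    by (simp add: cmod_power2 z_def poisson_den_def)
       (simp add: power2_eq_square algebra_simps sin_squared_eq[unfolded power2_eq_square])
  have n0: "1 + z \<noteq> 0" using poisson_den_pos(2)[OF assms, of x] sq by auto
  have "(\<lambda>n. Re (- ((- z) ^ n) / of_nat n)) sums Re (ln (1 + z))"
    by (rule sums_Re[OF Ln_series'[OF nz]])
  moreover have "Re (- ((- z) ^ n) / of_nat n) = - (\<rho> ^ n * cos (real n * x) / real n)" for n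
  proof -
    have "(- z) ^ n = complex_of_real (\<rho> ^ n) * cis (real n * x)"
      by (simp add: z_def power_mult_distrib Complex.DeMoivre)
    then show ?thesis by (simp add: Re_divide_of_nat)
  qed
  moreover have "Re (ln (1 + z)) = - log_poisson \<rho> x"
  proof -
    have "ln (poisson_den \<rho> x) = 2 * ln (cmod (1 + z))"
      unfolding sq[symmetric] using n0 by (simp add: ln_realpow)
    then show ?thesis using n0 by (simp add: log_poisson_def)
  qed
  ultimately have "(\<lambda>n. - (\<rho> ^ n * cos (real n * x) / real n)) sums (- log_poisson \<rho> x)" by (simp only:)
  from sums_minus[OF this] show ?thesis by simp
qed

lemma reg_log_kernel_sums:
  assumes "\<bar>\<rho>\<bar> < 1"
  shows "(\<lambda>k. 2 / real k * \<rho> ^ k * (cos (real k * x) * cos (real k * y))) sums reg_log_kernel \<rho> x y"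
proof -
  have "\<rho> ^ k * cos (real k * (x - y)) / real k + \<rho> ^ k * cos (real k * (x + y)) / real k =
      2 / real k * \<rho> ^ k * (cos (real k * x) * cos (real k * y))" for k
  proof -
    have e: "cos (real k * x) * cos (real k * y) = (cos (real k * (x - y)) + cos (real k * (x + y))) / 2"
      by (simp add: cos_times_cos right_diff_distrib distrib_left)
    show ?thesis unfolding e by (simp add: add_divide_distrib distrib_left)
  qed
  then show ?thesis
    using sums_add[OF log_poisson_sums[OF assms, of "x - y"] log_poisson_sums[OF assms, of "x + y"]]
    by (simp add: reg_log_kernel_def)
qed

lemma reg_log_kernel_zero: "reg_log_kernel \<rho> x 0 = 2 * log_poisson \<rho> x"
  by (simp add: reg_log_kernel_def)

text \<open>A sequence of radii in \<open>[1/2, 1)\<close> that tends to \<open>1\<close>.\<close>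

definition radius :: "nat \<Rightarrow> real" where
  "radius n = 1 - 1 / real (n + 2)"

lemma radius_bounds: "1 / 2 \<le> radius n" "radius n < 1" "\<bar>radius n\<bar> < 1"
  by (simp_all add: radius_def field_simps)

lemma radius_tendsto: "radius \<longlonglongrightarrow> 1"
proof -
  have "(\<lambda>n. 1 / real (n + 2)) \<longlonglongrightarrow> 0"
    using LIMSEQ_ignore_initial_segment[OF lim_1_over_n, of 2] by simp
  then have "(\<lambda>n. 1 - 1 / real (n + 2)) \<longlonglongrightarrow> 1 - 0" by (intro tendsto_intros)
  then show ?thesis by (simp add: radius_def[abs_def])
qed

lemma poisson_den_le_4: "\<bar>\<rho>\<bar> \<le> 1 \<Longrightarrow> poisson_den \<rho> x \<le> 4"
proof -
  assume "\<bar>\<rho>\<bar> \<le> 1"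
  then have "\<bar>\<rho> * cos x\<bar> \<le> 1" "\<rho>\<^sup>2 \<le> 1"
    by (simp_all add: abs_mult mult_le_one abs_square_le_1)
  then show ?thesis by (simp add: poisson_den_def abs_le_iff)
qed

text \<open>Twice the Poisson denominator exceeds \<open>poisson_den 1 x\<close> by
  \<open>2 ((1 - \<rho>)\<^sup>2 + (2 \<rho> - 1) (1 - cos x))\<close>. This bounds the regularized kernel by the kernel itself.\<close>

lemma poisson_den_half: "1 / 2 \<le> \<rho> \<Longrightarrow> poisson_den 1 x / 2 \<le> poisson_den \<rho> x"
proof -
  assume "1 / 2 \<le> \<rho>"
  then have "1 * (1 - cos x) \<le> (2 * \<rho>) * (1 - cos x)" by (intro mult_right_mono) auto
  moreover have "poisson_den \<rho> x = (1 - \<rho>)\<^sup>2 + (2 * \<rho>) * (1 - cos x)"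
    by (simp add: poisson_den_def power2_eq_square algebra_simps)
  moreover have "poisson_den 1 x / 2 = 1 * (1 - cos x)" by (simp add: poisson_den_def)
  ultimately show ?thesis using zero_le_power2[of "1 - \<rho>"] by linarith
qed

lemma poisson_den_one_mult: "poisson_den 1 (x - y) * poisson_den 1 (x + y) = (2 * (cos x - cos y))\<^sup>2"
proof -
  have s: "(sin x)\<^sup>2 = 1 - (cos x)\<^sup>2" "(sin y)\<^sup>2 = 1 - (cos y)\<^sup>2" by (simp_all add: sin_squared_eq)
  have "cos (x - y) * cos (x + y) = (cos x)\<^sup>2 * (cos y)\<^sup>2 - (sin x)\<^sup>2 * (sin y)\<^sup>2"
    by (simp add: cos_diff cos_add power2_eq_square algebra_simps)
  also have "\<dots> = (cos x)\<^sup>2 + (cos y)\<^sup>2 - 1" unfolding s by (simp add: algebra_simps)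
  finally have p: "cos (x - y) * cos (x + y) = (cos x)\<^sup>2 + (cos y)\<^sup>2 - 1" .
  have "poisson_den 1 (x - y) * poisson_den 1 (x + y) =
      4 * (1 - (cos (x - y) + cos (x + y)) + cos (x - y) * cos (x + y))"
    by (simp add: poisson_den_def algebra_simps)
  also have "\<dots> = (2 * (cos x - cos y))\<^sup>2"
    unfolding p by (simp add: cos_diff cos_add power2_eq_square algebra_simps)
  finally show ?thesis .
qed

lemma poisson_den_one_nonneg: "0 \<le> poisson_den 1 x"
  by (simp add: poisson_den_def)

lemma poisson_den_one_pos:
  assumes "cos x \<noteq> cos y"
  shows "0 < poisson_den 1 (x - y)" "0 < poisson_den 1 (x + y)"
proof -
  have "poisson_den 1 (x - y) * poisson_den 1 (x + y) \<noteq> 0"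
    unfolding poisson_den_one_mult using assms by simp
  then have "poisson_den 1 (x - y) \<noteq> 0" "poisson_den 1 (x + y) \<noteq> 0" by auto
  then show "0 < poisson_den 1 (x - y)" "0 < poisson_den 1 (x + y)"
    using poisson_den_one_nonneg[of "x - y"] poisson_den_one_nonneg[of "x + y"] by auto
qed

lemma log_kernel_eq:
  assumes "cos x \<noteq> cos y"
  shows "log_kernel x y = log_poisson 1 (x - y) + log_poisson 1 (x + y)"
proof -
  have "ln (poisson_den 1 (x - y)) + ln (poisson_den 1 (x + y)) = ln ((2 * (cos x - cos y))\<^sup>2)"
    unfolding poisson_den_one_mult[symmetric] using poisson_den_one_pos[OF assms] by (simp add: ln_mult)
  also have "(2 * (cos x - cos y))\<^sup>2 = (2 * \<bar>cos x - cos y\<bar>)\<^sup>2" by (simp only: power_mult_distrib power2_abs)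
  also have "ln \<dots> = 2 * ln (2 * \<bar>cos x - cos y\<bar>)"
    using assms ln_realpow[of "2 * \<bar>cos x - cos y\<bar>" 2] by simp
  finally show ?thesis by (simp add: log_kernel_def log_poisson_def)
qed

lemma log_poisson_lower: "\<bar>\<rho>\<bar> < 1 \<Longrightarrow> - ln 2 \<le> log_poisson \<rho> x"
proof -
  assume r: "\<bar>\<rho>\<bar> < 1"
  have "ln (poisson_den \<rho> x) \<le> ln 4"
    using poisson_den_pos(2)[OF r, of x] poisson_den_le_4[of \<rho> x] r by simp
  also have "ln 4 = 2 * ln (2::real)" using ln_realpow[of 2 2] by simp
  finally show ?thesis by (simp add: log_poisson_def)
qed

lemma reg_log_kernel_lower: "\<bar>\<rho>\<bar> < 1 \<Longrightarrow> - 2 * ln 2 \<le> reg_log_kernel \<rho> x y"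
  using log_poisson_lower[of \<rho> "x - y"] log_poisson_lower[of \<rho> "x + y"] by (simp add: reg_log_kernel_def)

lemma reg_log_kernel_upper:
  assumes "1 / 2 \<le> \<rho>" "\<rho> < 1" "cos x \<noteq> cos y"
  shows "reg_log_kernel \<rho> x y \<le> ln 2 + log_kernel x y"
proof -
  have "log_poisson \<rho> z \<le> ln 2 / 2 + log_poisson 1 z" if "0 < poisson_den 1 z" for z
  proof -
    have "ln (poisson_den 1 z) - ln 2 = ln (poisson_den 1 z / 2)" using that by (simp add: ln_div)
    also have "\<dots> \<le> ln (poisson_den \<rho> z)"
      using that poisson_den_half[OF assms(1), of z] by (intro ln_mono) auto
    finally show ?thesis by (simp add: log_poisson_def field_simps)
  qed
  from this[OF poisson_den_one_pos(1)[OF assms(3)]] this[OF poisson_den_one_pos(2)[OF assms(3)]]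
  show ?thesis by (simp add: reg_log_kernel_def log_kernel_eq[OF assms(3)])
qed

lemma log_kernel_lower: "cos x \<noteq> cos y \<Longrightarrow> - 2 * ln 2 \<le> log_kernel x y"
proof -
  assume ne: "cos x \<noteq> cos y"
  have "\<bar>cos x - cos y\<bar> \<le> 2"
    using abs_triangle_ineq4[of "cos x" "cos y"] abs_cos_le_one[of x] abs_cos_le_one[of y] by linarith
  then have "ln (2 * \<bar>cos x - cos y\<bar>) \<le> ln 4" using ne by simp
  also have "ln 4 = 2 * ln (2::real)" using ln_realpow[of 2 2] by simp
  finally show ?thesis by (simp add: log_kernel_def)
qed

lemma log_poisson_tendsto:
  assumes "0 < poisson_den c x"
  shows "(\<lambda>n. log_poisson (c * radius n) x) \<longlonglongrightarrow> log_poisson c x"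
proof -
  have "(\<lambda>n. c * radius n) \<longlonglongrightarrow> c * 1" by (intro tendsto_intros radius_tendsto)
  then have "(\<lambda>n. poisson_den (c * radius n) x) \<longlonglongrightarrow> poisson_den c x"
    unfolding poisson_den_def by (intro tendsto_intros) simp_all
  then show ?thesis
    unfolding log_poisson_def using assms by (intro tendsto_intros) auto
qed

lemma reg_log_kernel_tendsto:
  assumes "cos x \<noteq> cos y"
  shows "(\<lambda>n. reg_log_kernel (radius n) x y) \<longlonglongrightarrow> log_kernel x y"
  unfolding reg_log_kernel_def log_kernel_eq[OF assms]
  using log_poisson_tendsto[OF poisson_den_one_pos(1)[OF assms]] log_poisson_tendsto[OF poisson_den_one_pos(2)[OF assms]]
  by (intro tendsto_add) auto

lemma reg_log_kernel_measurable:
  assumes "f \<in> borel_measurable M" "g \<in> borel_measurable M"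
  shows "(\<lambda>x. reg_log_kernel \<rho> (f x) (g x)) \<in> borel_measurable M"
  unfolding reg_log_kernel_def log_poisson_def poisson_den_def using assms by measurable

lemma log_kernel_measurable:
  assumes "f \<in> borel_measurable M" "g \<in> borel_measurable M"
  shows "(\<lambda>x. log_kernel (f x) (g x)) \<in> borel_measurable M"
  unfolding log_kernel_def using assms by measurable

lemma reg_log_kernel_term_bound:
  "\<bar>2 / real k * \<rho> ^ k * (cos x * cos y)\<bar> \<le> 2 * \<bar>\<rho>\<bar> ^ k"
proof -
  have c: "\<bar>cos x * cos y\<bar> \<le> 1" unfolding abs_mult by (intro mult_le_one) auto
  have "\<bar>2 / real k\<bar> \<le> 2" by (cases "k = 0") (auto simp: divide_le_eq)
  then have "\<bar>2 / real k\<bar> * \<bar>\<rho>\<bar> ^ k * \<bar>cos x * cos y\<bar> \<le> 2 * \<bar>\<rho>\<bar> ^ k * 1"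
    using c by (intro mult_mono) auto
  then show ?thesis by (simp add: abs_mult power_abs)
qed

lemma reg_log_kernel_integral_sums:
  assumes M: "finite_measure M" and m: "f \<in> borel_measurable M" "g \<in> borel_measurable M" and r: "\<bar>\<rho>\<bar> < 1"
  shows "integrable M (\<lambda>x. reg_log_kernel \<rho> (f x) (g x))"
    and "(\<lambda>k. 2 / real k * \<rho> ^ k * (\<integral>x. cos (real k * f x) * cos (real k * g x) \<partial>M)) sums (\<integral>x. reg_log_kernel \<rho> (f x) (g x) \<partial>M)"
proof -
  interpret finite_measure M by (rule M)
  let ?t = "\<lambda>k x. 2 / real k * \<rho> ^ k * (cos (real k * f x) * cos (real k * g x))"
  have cm: "(\<lambda>x. cos (real k * f x) * cos (real k * g x)) \<in> borel_measurable M" for k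
    using m by measurable
  have ti: "integrable M (?t k)" for k
    by (rule integrable_const_bound[of _ "2 * \<bar>\<rho>\<bar> ^ k"]) (use reg_log_kernel_term_bound m in auto)
  have sum: "summable (\<lambda>k. 2 * \<bar>\<rho>\<bar> ^ k)" using r by (intro summable_mult summable_geometric) auto
  have eq: "(\<Sum>k. ?t k x) = reg_log_kernel \<rho> (f x) (g x)" for x
    using sums_unique[OF reg_log_kernel_sums[OF r]] by simp
  have s1: "AE x in M. summable (\<lambda>k. norm (?t k x))"
    by (rule AE_I2, rule summable_comparison_test'[OF sum, of 0]) (use reg_log_kernel_term_bound in auto)
  have s2: "summable (\<lambda>k. \<integral>x. norm (?t k x) \<partial>M)"
  proof (rule summable_comparison_test'[of "\<lambda>k. 2 * \<bar>\<rho>\<bar> ^ k * measure M (space M)" 0])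
    show "summable (\<lambda>k. 2 * \<bar>\<rho>\<bar> ^ k * measure M (space M))" by (rule summable_mult2[OF sum])
    fix k
    have "(\<integral>x. norm (?t k x) \<partial>M) \<le> (\<integral>x. 2 * \<bar>\<rho>\<bar> ^ k \<partial>M)"
      by (rule integral_mono[OF integrable_norm[OF ti]]) (use reg_log_kernel_term_bound in auto)
    then show "norm (\<integral>x. norm (?t k x) \<partial>M) \<le> 2 * \<bar>\<rho>\<bar> ^ k * measure M (space M)"
      by (simp add: mult_ac)
  qed
  show "integrable M (\<lambda>x. reg_log_kernel \<rho> (f x) (g x))"
    using integrable_suminf[OF ti s1 s2] unfolding eq .
  have "(\<lambda>k. \<integral>x. ?t k x \<partial>M) sums (\<integral>x. reg_log_kernel \<rho> (f x) (g x) \<partial>M)"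
    using sums_integral[OF ti s1 s2] unfolding eq .
  then show "(\<lambda>k. 2 / real k * \<rho> ^ k * (\<integral>x. cos (real k * f x) * cos (real k * g x) \<partial>M)) sums (\<integral>x. reg_log_kernel \<rho> (f x) (g x) \<partial>M)"
    by (simp only: integral_mult_right_zero)
qed

text \<open>Dominated convergence; the kernel is bounded below and the regularized kernels do not exceed it by
  more than a constant.\<close>

lemma log_kernel_limit:
  assumes M: "finite_measure M" and m: "f \<in> borel_measurable M" "g \<in> borel_measurable M"
    and ne: "AE x in M. cos (f x) \<noteq> cos (g x)" and int: "integrable M (\<lambda>x. log_kernel (f x) (g x))"
  shows "(\<lambda>n. \<integral>x. reg_log_kernel (radius n) (f x) (g x) \<partial>M) \<longlonglongrightarrow> (\<integral>x. log_kernel (f x) (g x) \<partial>M)"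
proof (rule integral_dominated_convergence[where w="\<lambda>x. log_kernel (f x) (g x) + 4 * ln 2"])
  interpret finite_measure M by (rule M)
  show "integrable M (\<lambda>x. log_kernel (f x) (g x) + 4 * ln 2)" using int by simp
  show "AE x in M. (\<lambda>n. reg_log_kernel (radius n) (f x) (g x)) \<longlonglongrightarrow> log_kernel (f x) (g x)"
    using ne by eventually_elim (rule reg_log_kernel_tendsto)
  show "AE x in M. norm (reg_log_kernel (radius n) (f x) (g x)) \<le> log_kernel (f x) (g x) + 4 * ln 2" for n
    using ne
  proof eventually_elim
    fix x assume ne: "cos (f x) \<noteq> cos (g x)"
    have "0 \<le> ln (2::real)" by simp
    then show "norm (reg_log_kernel (radius n) (f x) (g x)) \<le> log_kernel (f x) (g x) + 4 * ln 2"
      using reg_log_kernel_lower[OF radius_bounds(3)[of n], of "f x" "g x"] reg_log_kernel_upper[OF radius_bounds(1)[of n] radius_bounds(2)[of n] ne] log_kernel_lower[OF ne]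
      unfolding real_norm_def abs_le_iff by linarith
  qed
qed (use m in \<open>auto intro!: reg_log_kernel_measurable log_kernel_measurable\<close>)

text \<open>Fatou's lemma turns a limit of the regularized integrals into integrability of the
  logarithm.\<close>

lemma log_kernel_integral:
  assumes M: "finite_measure M" and m: "f \<in> borel_measurable M" "g \<in> borel_measurable M"
    and ne: "AE x in M. cos (f x) \<noteq> cos (g x)"
    and lim: "(\<lambda>n. \<integral>x. reg_log_kernel (radius n) (f x) (g x) \<partial>M) \<longlonglongrightarrow> L"
  shows "integrable M (\<lambda>x. log_kernel (f x) (g x))" and "(\<integral>x. log_kernel (f x) (g x) \<partial>M) = L"
proof -
  interpret finite_measure M by (rule M)
  let ?c = "2 * ln 2 :: real"
  let ?m = "measure M (space M)"
  have Gi: "integrable M (\<lambda>x. reg_log_kernel (radius n) (f x) (g x))" for n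
    by (rule reg_log_kernel_integral_sums(1)[OF M m radius_bounds(3)])
  have "(\<integral>\<^sup>+x. ennreal (log_kernel (f x) (g x) + ?c) \<partial>M) =
      (\<integral>\<^sup>+x. liminf (\<lambda>n. ennreal (reg_log_kernel (radius n) (f x) (g x) + ?c)) \<partial>M)"
  proof (rule nn_integral_cong_AE)
    show "AE x in M. ennreal (log_kernel (f x) (g x) + ?c) = liminf (\<lambda>n. ennreal (reg_log_kernel (radius n) (f x) (g x) + ?c))"
      using ne
    proof eventually_elim
      fix x assume "cos (f x) \<noteq> cos (g x)"
      from reg_log_kernel_tendsto[OF this] have "(\<lambda>n. ennreal (reg_log_kernel (radius n) (f x) (g x) + ?c)) \<longlonglongrightarrow> ennreal (log_kernel (f x) (g x) + ?c)"
        by (intro tendsto_ennrealI tendsto_intros)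
      then show "ennreal (log_kernel (f x) (g x) + ?c) = liminf (\<lambda>n. ennreal (reg_log_kernel (radius n) (f x) (g x) + ?c))"
        by (simp add: lim_imp_Liminf)
    qed
  qed
  also have "\<dots> \<le> liminf (\<lambda>n. \<integral>\<^sup>+x. ennreal (reg_log_kernel (radius n) (f x) (g x) + ?c) \<partial>M)"
    by (rule nn_integral_liminf) (intro measurable_compose[OF _ measurable_ennreal] borel_measurable_add reg_log_kernel_measurable m borel_measurable_const)
  also have "(\<lambda>n. \<integral>\<^sup>+x. ennreal (reg_log_kernel (radius n) (f x) (g x) + ?c) \<partial>M) = (\<lambda>n. ennreal ((\<integral>x. reg_log_kernel (radius n) (f x) (g x) \<partial>M) + ?c * ?m))"
  proof
    fix n
    have nn: "0 \<le> reg_log_kernel (radius n) (f x) (g x) + ?c" for x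
      using reg_log_kernel_lower[OF radius_bounds(3)[of n], of "f x" "g x"] by linarith
    have "(\<integral>\<^sup>+x. ennreal (reg_log_kernel (radius n) (f x) (g x) + ?c) \<partial>M) = ennreal (\<integral>x. reg_log_kernel (radius n) (f x) (g x) + ?c \<partial>M)"
      using Gi by (intro nn_integral_eq_integral AE_I2 nn) simp
    also have "\<dots> = ennreal ((\<integral>x. reg_log_kernel (radius n) (f x) (g x) \<partial>M) + ?c * ?m)"
      using Gi by (simp add: mult_ac)
    finally show "(\<integral>\<^sup>+x. ennreal (reg_log_kernel (radius n) (f x) (g x) + ?c) \<partial>M) = ennreal ((\<integral>x. reg_log_kernel (radius n) (f x) (g x) \<partial>M) + ?c * ?m)" .
  qed
  also have "liminf \<dots> = ennreal (L + ?c * ?m)"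
    by (intro lim_imp_Liminf tendsto_ennrealI tendsto_intros lim) simp
  also have "\<dots> < \<infinity>" by simp
  finally have fin: "(\<integral>\<^sup>+x. ennreal (log_kernel (f x) (g x) + ?c) \<partial>M) < \<infinity>" .
  have "integrable M (\<lambda>x. log_kernel (f x) (g x) + ?c)"
  proof (rule integrableI_nonneg[OF _ _ fin])
    show "(\<lambda>x. log_kernel (f x) (g x) + ?c) \<in> borel_measurable M"
      by (intro borel_measurable_add log_kernel_measurable m borel_measurable_const)
    show "AE x in M. 0 \<le> log_kernel (f x) (g x) + ?c"
      using ne by eventually_elim (use log_kernel_lower in fastforce)
  qed
  then have "integrable M (\<lambda>x. (log_kernel (f x) (g x) + ?c) - ?c)" by (intro Bochner_Integration.integrable_diff) auto
  then show int: "integrable M (\<lambda>x. log_kernel (f x) (g x))" by simp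
  show "(\<integral>x. log_kernel (f x) (g x) \<partial>M) = L"
    by (rule LIMSEQ_unique[OF log_kernel_limit[OF M m ne int] lim])
qed

section \<open>Determinacy on a compact interval\<close>

text \<open>Polynomials are uniformly dense in the continuous functions, so the measures have the same
  characteristic function.\<close>

lemma borel_prob_on_eqI:
  assumes ab: "a \<le> b" and \<mu>: "\<mu> \<in> borel_prob_on a b" and \<nu>: "\<nu> \<in> borel_prob_on a b"
    and mom: "\<And>n. (\<integral>x. x ^ n \<partial>\<mu>) = (\<integral>x. x ^ n \<partial>\<nu>)"
  shows "\<mu> = \<nu>"
proof -
  have cont: "(\<integral>x. f x \<partial>\<mu>) = (\<integral>x. f x \<partial>\<nu>)" if f: "continuous_on UNIV f" for f :: "real \<Rightarrow> real"
  proof -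
    have "\<bar>(\<integral>x. f x \<partial>\<mu>) - (\<integral>x. f x \<partial>\<nu>)\<bar> \<le> e" if e: "0 < e" for e :: real
    proof -
      have "0 < e / 2" using e by simp
      from Stone_Weierstrass_real_polynomial_function[OF compact_Icc continuous_on_subset[OF f subset_UNIV] this]
      obtain g where g: "real_polynomial_function g" "\<And>x. x \<in> {a..b} \<Longrightarrow> \<bar>f x - g x\<bar> < e / 2" by blast
      then obtain c n where gs: "g = (\<lambda>x. \<Sum>i\<le>n. c i * x ^ i)"
        using real_polynomial_function_iff_sum by blast
      have close: "\<bar>(\<integral>x. f x \<partial>L) - (\<Sum>i\<le>n. c i * (\<integral>x. x ^ i \<partial>L))\<bar> \<le> e / 2" if L: "L \<in> borel_prob_on a b" for L
      proof -
        interpret prob_space L by (rule borel_prob_onD[OF L])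
        have pi: "integrable L (\<lambda>x. x ^ i)" for i
          by (rule borel_prob_on_integrable[OF L]) (intro continuous_intros)
        have gi: "integrable L g" unfolding gs using pi by simp
        have fi: "integrable L f" by (rule borel_prob_on_integrable[OF L f])
        have "(\<Sum>i\<le>n. c i * (\<integral>x. x ^ i \<partial>L)) = (\<integral>x. g x \<partial>L)" unfolding gs using pi by simp
        then have "\<bar>(\<integral>x. f x \<partial>L) - (\<Sum>i\<le>n. c i * (\<integral>x. x ^ i \<partial>L))\<bar> = \<bar>\<integral>x. f x - g x \<partial>L\<bar>" using fi gi by simp
        also have "\<dots> \<le> (\<integral>x. \<bar>f x - g x\<bar> \<partial>L)" by (rule integral_abs_bound)
        also have "\<dots> \<le> (\<integral>x. e / 2 \<partial>L)"
          by (rule integral_mono) (use fi gi g(2) borel_prob_onD(3)[OF L] in \<open>auto intro: less_imp_le\<close>)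
        finally show ?thesis by (simp add: prob_space)
      qed
      have "(\<Sum>i\<le>n. c i * (\<integral>x. x ^ i \<partial>\<mu>)) = (\<Sum>i\<le>n. c i * (\<integral>x. x ^ i \<partial>\<nu>))" by (simp add: mom)
      then show ?thesis using close[OF \<mu>] close[OF \<nu>] by linarith
    qed
    then have "\<bar>(\<integral>x. f x \<partial>\<mu>) - (\<integral>x. f x \<partial>\<nu>)\<bar> \<le> 0" by (rule field_le_epsilon[of _ 0, simplified])
    then show ?thesis by simp
  qed
  let ?R = "\<lambda>L. distr L borel (\<lambda>x. x)"
  have idm: "(\<lambda>x. x) \<in> measurable L borel" if "L \<in> borel_prob_on a b" for L
    by (rule borel_prob_on_measurable[OF that]) simp
  have rd: "real_distribution (?R L)" if L: "L \<in> borel_prob_on a b" for L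
    by (rule prob_space.real_distribution_distr[OF borel_prob_onD(1)[OF L] idm[OF L]])
  have ch: "char (?R L) t = Complex (\<integral>x. cos (t * x) \<partial>L) (\<integral>x. sin (t * x) \<partial>L)" if L: "L \<in> borel_prob_on a b" for L t
  proof -
    have "char (?R L) t = (\<integral>x. iexp (t * x) \<partial>L)"
      unfolding char_def using idm[OF L] by (subst integral_distr) auto
    also have "\<dots> = Complex (\<integral>x. cos (t * x) \<partial>L) (\<integral>x. sin (t * x) \<partial>L)"
    proof (rule complex_eqI)
      interpret prob_space L by (rule borel_prob_onD[OF L])
      have i: "integrable L (\<lambda>x. iexp (t * x))"
        by (rule integrable_const_bound[of _ 1]) (use idm[OF L] in auto)
      show "Re (\<integral>x. iexp (t * x) \<partial>L) = Re (Complex (\<integral>x. cos (t * x) \<partial>L) (\<integral>x. sin (t * x) \<partial>L))"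
        using i by (simp add: integral_Re[symmetric] Re_exp)
      show "Im (\<integral>x. iexp (t * x) \<partial>L) = Im (Complex (\<integral>x. cos (t * x) \<partial>L) (\<integral>x. sin (t * x) \<partial>L))"
        using i by (simp add: integral_Im[symmetric] Im_exp)
    qed
    finally show ?thesis .
  qed
  have "char (?R \<mu>) = char (?R \<nu>)"
  proof
    fix t :: real
    have "continuous_on UNIV (\<lambda>x. cos (t * x))"
      by (intro continuous_intros)
    moreover have "continuous_on UNIV (\<lambda>x. sin (t * x))"
      by (intro continuous_intros)
    ultimately show "char (?R \<mu>) t = char (?R \<nu>) t" unfolding ch[OF \<mu>] ch[OF \<nu>] by (simp add: cont)
  qed
  then have eq: "?R \<mu> = ?R \<nu>" by (rule Levy_uniqueness[OF rd[OF \<mu>] rd[OF \<nu>]])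
  show ?thesis
  proof (rule measure_eqI)
    show "sets \<mu> = sets \<nu>" using borel_prob_onD(2)[OF \<mu>] borel_prob_onD(2)[OF \<nu>] by simp
    fix A assume A: "A \<in> sets \<mu>"
    then have A': "A \<in> sets borel" "A \<subseteq> {a..b}"
      unfolding borel_prob_onD(2)[OF \<mu>] by (auto simp: sets_restrict_space)
    have "emeasure L A = emeasure (?R L) A" if L: "L \<in> borel_prob_on a b" for L
      using A' idm[OF L] borel_prob_onD(3)[OF L] by (subst emeasure_distr) (auto simp: Int_absorb2)
    then show "emeasure \<mu> A = emeasure \<nu> A" using \<mu> \<nu> eq by simp
  qed
qed

section \<open>The logarithmic potential of the limit measure\<close>

lemma poisson_den_0: "poisson_den \<rho> 0 = (1 - \<rho>)\<^sup>2"
  by (simp add: poisson_den_def power2_eq_square algebra_simps)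

lemma log_poisson_0: "\<rho> < 1 \<Longrightarrow> log_poisson \<rho> 0 = - ln (1 - \<rho>)"
  using ln_realpow[of "1 - \<rho>" 2] by (simp add: log_poisson_def poisson_den_0)

text \<open>As a function of \<open>\<rho>\<close> the right-hand side decreases to \<open>0\<close> at \<open>\<rho> = 1\<close>: at \<open>s\<close> its derivative is \<open>- (1 + x y) (1 - s\<^sup>2)\<^sup>2\<close> divided by \<open>s\<close> and four positive factors.\<close>

lemma off_support_inequality:
  fixes x y \<alpha> \<beta> \<rho> :: real
  assumes x: "0 < x" and y: "0 < y" "y \<le> 1" and \<rho>: "x < \<rho>" "\<rho> < 1"
    and al: "\<alpha> * x * (x + y) = 1 - x\<^sup>2" and be: "\<beta> * y * (x + y) = 1 - y\<^sup>2"
  shows "0 \<le> 2 * ln \<rho> + \<alpha> * (ln (1 - x * \<rho>) - ln (1 - x / \<rho>)) + \<beta> * (ln (1 + y * \<rho>) - ln (1 + y / \<rho>))"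
proof -
  define h where "h s = 2 * ln s + \<alpha> * (ln (1 - x * s) - ln (1 - x / s)) + \<beta> * (ln (1 + y * s) - ln (1 + y / s))" for s
  have "h 1 \<le> h \<rho>"
  proof (rule DERIV_nonpos_imp_nonincreasing[of \<rho> 1 h])
    show "\<rho> \<le> 1" using \<rho> by simp
    fix s assume s: "\<rho> \<le> s" "s \<le> 1"
    have s0: "0 < s" "x < s" using s \<rho> x by auto
    have xs: "x * s < 1" using s \<rho> x by (smt (verit) mult_left_le)
    have xd: "x / s < 1" using s0 by simp
    have p: "0 < 1 - x * s" "0 < 1 - x / s" "0 < 1 + y * s" "0 < 1 + y / s"
      using xs xd y s0 by (auto intro: add_pos_pos)
    let ?d = "2 * (1 / s) + \<alpha> * (- x / (1 - x * s) - (x / s\<^sup>2) / (1 - x / s)) + \<beta> * (y / (1 + y * s) - (- y / s\<^sup>2) / (1 + y / s))"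
    have l: "((\<lambda>s. ln (f s)) has_real_derivative inverse (f s) * f') (at s)"
      if "(f has_real_derivative f') (at s)" "0 < f s" for f f'
      by (rule DERIV_chain2[OF DERIV_ln[OF that(2)] that(1)])
    have "((\<lambda>s. 1 - x * s) has_real_derivative - x) (at s)" "((\<lambda>s. 1 + y * s) has_real_derivative y) (at s)"
      "((\<lambda>s. 1 - x / s) has_real_derivative x / s\<^sup>2) (at s)" "((\<lambda>s. 1 + y / s) has_real_derivative - y / s\<^sup>2) (at s)"
      using s0 by (auto intro!: derivative_eq_intros simp: power2_eq_square)
    note ls = l[OF this(1) p(1)] l[OF this(2) p(3)] l[OF this(3) p(2)] l[OF this(4) p(4)]
    have "(h has_real_derivative 2 * inverse s + \<alpha> * (inverse (1 - x * s) * - x - inverse (1 - x / s) * (x / s\<^sup>2))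
        + \<beta> * (inverse (1 + y * s) * y - inverse (1 + y / s) * (- y / s\<^sup>2))) (at s)"
      unfolding h_def by (intro DERIV_add DERIV_diff DERIV_cmult ls DERIV_ln s0(1))
    then have d: "(h has_real_derivative ?d) (at s)"
      by (simp add: divide_inverse mult_ac)
    have X: "0 < (1 - x * s) * (s - x)" and Y: "0 < (1 + y * s) * (s + y)"
      using p s0 y by auto
    have e1: "- x / (1 - x * s) - (x / s\<^sup>2) / (1 - x / s) = - x * (1 - 2 * x * s + s\<^sup>2) / (s * ((1 - x * s) * (s - x)))"
      using p s0 by (simp add: field_simps power2_eq_square)
    have e2: "y / (1 + y * s) - (- y / s\<^sup>2) / (1 + y / s) = y * (1 + 2 * y * s + s\<^sup>2) / (s * ((1 + y * s) * (s + y)))"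
    proof -
      have n: "1 + y * s \<noteq> 0" "s \<noteq> 0" "s + y \<noteq> 0" using p s0 y by auto
      have "(- y / s\<^sup>2) / (1 + y / s) = - (y / (s * (s + y)))"
        using n by (simp add: divide_simps power2_eq_square)
      then have "y / (1 + y * s) - (- y / s\<^sup>2) / (1 + y / s) = y / (1 + y * s) + y / (s * (s + y))" by simp
      also have "\<dots> = (y * (s * (s + y)) + y * (1 + y * s)) / ((1 + y * s) * (s * (s + y)))"
        by (rule add_frac_eq) (use n in auto)
      also have "y * (s * (s + y)) + y * (1 + y * s) = y * (1 + 2 * y * s + s\<^sup>2)"
        by (simp add: power2_eq_square algebra_simps)
      finally show ?thesis by (simp only: mult_ac)
    qed
    have xy: "0 < x + y" using x y by simp
    have ax: "\<alpha> * x = (1 - x\<^sup>2) / (x + y)" and bY: "\<beta> * y = (1 - y\<^sup>2) / (x + y)"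
      using al be xy by (simp_all add: field_simps)
    have "s * ?d = 2 - (\<alpha> * x) * (1 - 2 * x * s + s\<^sup>2) / ((1 - x * s) * (s - x)) + (\<beta> * y) * (1 + 2 * y * s + s\<^sup>2) / ((1 + y * s) * (s + y))"
    proof -
      have "s * (2 * (1 / s) + \<alpha> * (- x * A / (s * B)) + \<beta> * (y * C / (s * D))) = 2 - (\<alpha> * x) * A / B + (\<beta> * y) * C / D"
        for A B C D using s0 by (simp add: distrib_left right_diff_distrib)
      then show ?thesis unfolding e1 e2 .
    qed
    also have "\<dots> = - (1 + x * y) * (1 - s\<^sup>2)\<^sup>2 / (((1 - x * s) * (s - x)) * ((1 + y * s) * (s + y)))"
    proof -
      have n: "(1 - x * s) * (s - x) \<noteq> 0" "(1 + y * s) * (s + y) \<noteq> 0" "x + y \<noteq> 0" using X Y xy by auto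
      have "2 * (x + y) * ((1 - x * s) * (s - x)) * ((1 + y * s) * (s + y))
         - (1 - x\<^sup>2) * (1 - 2 * x * s + s\<^sup>2) * ((1 + y * s) * (s + y))
         + (1 - y\<^sup>2) * (1 + 2 * y * s + s\<^sup>2) * ((1 - x * s) * (s - x)) =
         - (1 + x * y) * (1 - s\<^sup>2)\<^sup>2 * (x + y)"
        by algebra
      moreover have "2 - (1 - x\<^sup>2) / (x + y) * A / B + (1 - y\<^sup>2) / (x + y) * C / D =
         (2 * (x + y) * B * D - (1 - x\<^sup>2) * A * D + (1 - y\<^sup>2) * C * B) / ((x + y) * (B * D))"
        if "B \<noteq> 0" "D \<noteq> 0" for A B C D :: real
        using that n(3) by (simp add: divide_simps) (simp add: algebra_simps)
      ultimately show ?thesis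
        unfolding ax bY using n by simp
    qed
    also have "\<dots> \<le> 0"
    proof (rule divide_nonpos_pos)
      have "0 \<le> (1 + x * y) * (1 - s\<^sup>2)\<^sup>2"
        using x y by (intro mult_nonneg_nonneg add_nonneg_nonneg) auto
      then show "- (1 + x * y) * (1 - s\<^sup>2)\<^sup>2 \<le> 0" by (simp only: mult_minus_left neg_le_0_iff_le)
    qed (rule mult_pos_pos[OF X Y])
    finally have "?d \<le> 0" using s0 by (simp add: mult_le_0_iff)
    then show "\<exists>z. (h has_real_derivative z) (at s) \<and> z \<le> 0" using d by blast
  qed
  moreover have "h 1 = 0" by (simp add: h_def)
  ultimately show ?thesis by (simp add: h_def)
qed

text \<open>The smaller root of the quadratic equation. Points off the support are parametrized in this way
  by \<open>\<rho>\<close> in the unit interval.\<close>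

lemma joukowski_inverse:
  fixes h :: real
  assumes "1 < \<bar>h\<bar>"
  shows "\<exists>\<rho>. \<rho> \<noteq> 0 \<and> \<bar>\<rho>\<bar> < 1 \<and> \<rho> + 1 / \<rho> = 2 * h"
proof -
  have *: "\<exists>\<rho>. \<rho> \<noteq> 0 \<and> \<bar>\<rho>\<bar> < 1 \<and> \<rho> + 1 / \<rho> = 2 * h" if "1 < h" for h :: real
  proof -
    define w where "w = sqrt (h\<^sup>2 - 1)"
    have h2: "1 < h\<^sup>2" using that by (simp add: one_less_power)
    then have w2: "w * w = h\<^sup>2 - 1" and w0: "0 \<le> w" by (simp_all add: w_def)
    have m: "(h - w) * (h + w) = 1" using w2 by (simp add: power2_eq_square algebra_simps)
    have wh: "w < h"
      unfolding w_def using that by (intro real_less_lsqrt) auto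
    have hw: "h - 1 < w"
      unfolding w_def using that by (intro real_less_rsqrt) (simp add: power2_eq_square algebra_simps)
    have "1 / (h - w) = h + w" using m wh by (simp add: field_simps)
    then show ?thesis using wh hw by (intro exI[of _ "h - w"]) auto
  qed
  show ?thesis
  proof (cases "0 < h")
    case True
    then show ?thesis using * assms by auto
  next
    case False
    then obtain \<rho> where "\<rho> \<noteq> 0" "\<bar>\<rho>\<bar> < 1" "\<rho> + 1 / \<rho> = 2 * (- h)"
      using *[of "- h"] assms by auto
    then show ?thesis by (intro exI[of _ "- \<rho>"]) auto
  qed
qed

text \<open>The product formula \<open>2 sin t cos (n t) = sin ((n + 1) t) - sin ((n - 1) t)\<close> reduces this to
  \<open>halfcircle_poisson\<close>.\<close>

lemma halfcircle_sin_squared_cos: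
  assumes "\<bar>\<rho>\<bar> \<le> 1"
  shows "integrable halfcircle (\<lambda>t. (sin t)\<^sup>2 / poisson_den \<rho> t * cos (real (Suc m) * t))"
    and "(\<integral>t. (sin t)\<^sup>2 / poisson_den \<rho> t * cos (real (Suc m) * t) \<partial>halfcircle) =
      pi / 4 * (\<rho> ^ Suc m - (if m = 0 then 0 else \<rho> ^ (m - 1)))"
proof -
  let ?I = "\<lambda>m t. sin (real m * t) * sin t / poisson_den \<rho> t"
  have eq: "(sin t)\<^sup>2 / poisson_den \<rho> t * cos (real (Suc m) * t) = (?I (Suc (Suc m)) t - ?I m t) / 2" for t
  proof -
    have "real (Suc (Suc m)) * t = real (Suc m) * t + t" "real m * t = real (Suc m) * t - t"
      by (simp_all add: algebra_simps)
    then have "sin (real (Suc (Suc m)) * t) - sin (real m * t) = 2 * (cos (real (Suc m) * t) * sin t)"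
      by (simp only: sin_add sin_diff)
    then have "(sin (real (Suc (Suc m)) * t) - sin (real m * t)) * sin t / poisson_den \<rho> t =
        2 * (cos (real (Suc m) * t) * sin t) * sin t / poisson_den \<rho> t" by (simp only:)
    then show ?thesis
      by (simp only: left_diff_distrib diff_divide_distrib power2_eq_square) simp
  qed
  show "integrable halfcircle (\<lambda>t. (sin t)\<^sup>2 / poisson_den \<rho> t * cos (real (Suc m) * t))"
    unfolding eq by (intro integrable_divide_zero Bochner_Integration.integrable_diff poisson_quotient_integrable)
  have I: "(\<integral>t. ?I m t \<partial>halfcircle) = (if m = 0 then 0 else pi / 2 * \<rho> ^ (m - 1))"
    using halfcircle_poisson[OF assms, of "m - 1"] by (cases m) auto
  have "(\<integral>t. (?I (Suc (Suc m)) t - ?I m t) / 2 \<partial>halfcircle) = (pi / 2 * \<rho> ^ Suc m - (\<integral>t. ?I m t \<partial>halfcircle)) / 2"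
    by (simp only: integral_divide_zero Bochner_Integration.integral_diff[OF poisson_quotient_integrable poisson_quotient_integrable]
        halfcircle_poisson[OF assms])
  also have "\<dots> = pi / 4 * (\<rho> ^ Suc m - (if m = 0 then 0 else \<rho> ^ (m - 1)))"
    unfolding I by (cases "m = 0") (simp_all add: field_simps)
  finally show "(\<integral>t. (sin t)\<^sup>2 / poisson_den \<rho> t * cos (real (Suc m) * t) \<partial>halfcircle) =
      pi / 4 * (\<rho> ^ Suc m - (if m = 0 then 0 else \<rho> ^ (m - 1)))"
    unfolding eq .
qed

text \<open>The two inequalities say that neither end point of \<open>[a,b]\<close> is an atom.\<close>

locale jacobi_noatom = jacobi_law +
  assumes na: "p2 \<le> p1" "p1 + p2 \<le> 1"
begin

text \<open>The Poisson parameters of \<open>uang\<close> and \<open>1 - uang\<close>, see \<open>uang_poisson\<close>.\<close>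

definition "r1 = sqrt (wB / wA)"
definition "r2 = sqrt (wD / wE)"
text \<open>The charges of the external field at \<open>a\<close> and at \<open>b\<close>.\<close>

definition "al = p1 / p2 - 1"
definition "be = (1 - p1 - p2) / p2"

abbreviation "\<mu> \<equiv> mu_lim a b p1 p2"

definition angle_law :: "real measure" where
  "angle_law = density halfcircle (\<lambda>t. ennreal (angw t))"

lemma w_le: "wB \<le> wA" "wD \<le> wE"
  using na by (simp_all add: wA_def wB_def wD_def wE_def algebra_simps)

lemma r_bounds: "0 < r1" "r1 \<le> 1" "0 < r2" "r2 \<le> 1"
  using w_pos w_le by (simp_all add: r1_def r2_def)

lemma r_squares: "wA * r1\<^sup>2 = wB" "wE * r2\<^sup>2 = wD"
  using w_pos by (simp_all add: r1_def r2_def)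

lemma r_products: "wA * r1 = sqrt (wA * wB)" "wE * r2 = sqrt (wA * wB)"
proof -
  have "sqrt (wA * wB) = sqrt ((wA * r1)\<^sup>2)"
    using r_squares(1) by (simp add: power2_eq_square mult_ac)
  then show "wA * r1 = sqrt (wA * wB)" using w_pos r_bounds by simp
  have "sqrt (wE * wD) = sqrt ((wE * r2)\<^sup>2)"
    using r_squares(2) by (simp add: power2_eq_square mult_ac)
  then show "wE * r2 = sqrt (wA * wB)" using w_pos r_bounds by (simp add: AB_ED)
qed

lemma uang_poisson: "uang t = wA * poisson_den r1 t" "1 - uang t = wE * poisson_den (- r2) t"
proof -
  have "wA * poisson_den r1 t = wA + wA * r1\<^sup>2 - 2 * (wA * r1) * cos t"
    "wE * poisson_den (- r2) t = wE + wE * r2\<^sup>2 + 2 * (wE * r2) * cos t"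
    by (simp_all add: poisson_den_def algebra_simps)
  then show "uang t = wA * poisson_den r1 t" "1 - uang t = wE * poisson_den (- r2) t"
    unfolding r_squares r_products one_minus_uang by (simp_all add: uang_def AB_ED)
qed

lemma p_r: "p1 * (r1 + r2) = r2" "(1 - p1) * (r1 + r2) = r1"
proof -
  have "(p1 * r1)\<^sup>2 = ((1 - p1) * r2)\<^sup>2"
    unfolding power_mult_distrib r1_def r2_def
    using w_pos p1 p2 by (simp add: wA_def wB_def wD_def wE_def power2_eq_square divide_simps)
  then have "p1 * r1 = (1 - p1) * r2"
    using p1 r_bounds by (simp add: power2_eq_iff_nonneg)
  then show "p1 * (r1 + r2) = r2" "(1 - p1) * (r1 + r2) = r1" by (simp_all add: algebra_simps)
qed

lemma al_be_nonneg: "0 \<le> al" "0 \<le> be"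
  using na p2 by (simp_all add: al_def be_def)

lemma al_r: "al * r1\<^sup>2 = (1 - p1) * (1 - r1\<^sup>2)" and be_r: "be * r2\<^sup>2 = p1 * (1 - r2\<^sup>2)"
proof -
  have "r1\<^sup>2 = wB / wA" "r2\<^sup>2 = wD / wE" using w_pos by (simp_all add: r1_def r2_def)
  then show "al * r1\<^sup>2 = (1 - p1) * (1 - r1\<^sup>2)" "be * r2\<^sup>2 = p1 * (1 - r2\<^sup>2)"
    using p1 p2 by (simp_all add: al_def be_def wA_def wB_def wD_def wE_def divide_simps) (simp_all add: algebra_simps)
qed

text \<open>In terms of the Poisson parameters the charges have a symmetric form, the one in which
  \<open>off_support_inequality\<close> is stated.\<close>

lemma al_relation: "al * r1 * (r1 + r2) = 1 - r1\<^sup>2" and be_relation: "be * r2 * (r1 + r2) = 1 - r2\<^sup>2"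
proof -
  have "r1 * (al * r1 * (r1 + r2)) = (1 - p1) * (r1 + r2) * (1 - r1\<^sup>2)"
    using al_r by (simp add: power2_eq_square mult_ac)
  then show "al * r1 * (r1 + r2) = 1 - r1\<^sup>2" unfolding p_r(2) using r_bounds by simp
  have "r2 * (be * r2 * (r1 + r2)) = p1 * (r1 + r2) * (1 - r2\<^sup>2)"
    using be_r by (simp add: power2_eq_square mult_ac)
  then show "be * r2 * (r1 + r2) = 1 - r2\<^sup>2" unfolding p_r(1) using r_bounds by simp
qed

lemma no_atoms: "atom_a = 0" "atom_b = 0"
  using na p2 by (simp_all add: atom_a_def atom_b_def divide_le_0_iff)

lemma angw_ennreal_measurable: "(\<lambda>t. ennreal (angw t)) \<in> borel_measurable halfcircle"
  by (intro halfcircle_measurable measurable_compose[OF angw_measurable measurable_ennreal])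

lemma angle_law_integral:
  assumes "f \<in> borel_measurable borel"
  shows "(\<integral>t. f t \<partial>angle_law) = (\<integral>t. angw t * f t \<partial>halfcircle)"
  unfolding angle_law_def using assms angw_measurable angw_nonneg
  by (subst integral_density) (auto intro: halfcircle_measurable)

lemma prob_angle_law: "prob_space angle_law"
proof
  have "emeasure angle_law (space angle_law) = (\<integral>\<^sup>+t. 1 \<partial>angle_law)" by simp
  also have "\<dots> = (\<integral>\<^sup>+t. ennreal (angw t) \<partial>halfcircle)"
    unfolding angle_law_def using angw_ennreal_measurable
    by (subst nn_integral_density) simp_all
  also have "\<dots> = ennreal (\<integral>t. angw t \<partial>halfcircle)"
    by (rule nn_integral_eq_integral[OF angw_integrable]) (simp add: angw_nonneg)
  finally show "emeasure angle_law (space angle_law) = 1" by (simp add: angw_mass no_atoms)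
qed

lemma angle_law_measurable: "f \<in> borel_measurable borel \<Longrightarrow> f \<in> borel_measurable angle_law"
  unfolding angle_law_def using halfcircle_measurable by simp

lemma mu_eq_distr: "\<mu> = distr angle_law (restrict_space borel {a..b}) xang"
proof (rule measure_eqI)
  show s: "sets \<mu> = sets (distr angle_law (restrict_space borel {a..b}) xang)"
    by (simp add: mu_lim_def mu_ac_sets)
  fix A assume "A \<in> sets \<mu>"
  then have A: "A \<in> sets (restrict_space borel {a..b})" using s by simp
  then have "A \<in> sets borel" by (auto simp: sets_restrict_space)
  then have "emeasure \<mu> A = (\<integral>\<^sup>+x. indicator A x \<partial>mu_ac a b p1 p2)"
    using nn_integral_mu_lim[of "indicator A"] nn_integral_mu_ac[of "indicator A"] \<open>A \<in> sets \<mu>\<close>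
    by (simp add: no_atoms)
  also have "\<dots> = emeasure (mu_ac a b p1 p2) A" using A mu_ac_sets by simp
  finally show "emeasure \<mu> A = emeasure (distr angle_law (restrict_space borel {a..b}) xang) A"
    by (simp add: mu_ac_eq_distr angle_law_def)
qed

lemma xang_measurable_law: "xang \<in> measurable angle_law (restrict_space borel {a..b})"
  unfolding angle_law_def using xang_measurable_restrict by simp

lemma mu_integral:
  fixes f :: "real \<Rightarrow> real"
  assumes "f \<in> borel_measurable borel"
  shows "integrable \<mu> f \<longleftrightarrow> integrable angle_law (\<lambda>t. f (xang t))"
    and "(\<integral>x. f x \<partial>\<mu>) = (\<integral>t. f (xang t) \<partial>angle_law)"
  unfolding mu_eq_distr using xang_measurable_law measurable_restrict_space1[OF assms, of "{a..b}"]
  by (auto simp: integrable_distr_eq integral_distr)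

lemma angle_AE_ne: "AE t in angle_law. t \<in> {0..pi} \<and> t \<noteq> c"
proof -
  have "AE t in lborel. t \<noteq> c" by (rule AE_lborel_singleton)
  then have "AE t in halfcircle. t \<in> {0..pi} \<and> t \<noteq> c"
    unfolding halfcircle_def by (subst AE_restrict_space_iff) auto
  then show ?thesis
    unfolding angle_law_def using angw_ennreal_measurable by (subst AE_density) auto
qed

lemma angle_AE_interior: "AE t in angle_law. t \<in> {0<..<pi}"
  using angle_AE_ne[of 0] angle_AE_ne[of pi] by eventually_elim auto

text \<open>The Poisson integrals give powers of \<open>r1\<close> and \<open>- r2\<close>; the weights combine to the charges of the
  external field.\<close>

lemma angle_cos_moment:
  "(\<integral>t. cos (real (Suc m) * t) \<partial>angle_law) = - (al * r1 ^ Suc m + be * (- r2) ^ Suc m) / 2"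
proof -
  have le: "\<bar>r1\<bar> \<le> 1" "\<bar>- r2\<bar> \<le> 1" using r_bounds by auto
  have w: "angw t * c = 2 / pi * ((1 - p1) * ((sin t)\<^sup>2 / poisson_den r1 t * c) + p1 * ((sin t)\<^sup>2 / poisson_den (- r2) t * c))" for t c
  proof -
    have k1: "2 * (wA * wB) / (pi * p2) / wA = 2 / pi * (1 - p1)"
      using w_pos(1) p2 by (simp add: wB_def)
    have k2: "2 * (wA * wB) / (pi * p2) / wE = 2 / pi * p1"
      unfolding AB_ED using w_pos(3) p2 by (simp add: wD_def)
    have "angw t = 2 * (wA * wB) / (pi * p2) / wA * ((sin t)\<^sup>2 / poisson_den r1 t) +
       2 * (wA * wB) / (pi * p2) / wE * ((sin t)\<^sup>2 / poisson_den (- r2) t)"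
      unfolding angw_def uang_poisson(2) unfolding uang_poisson(1) by (simp add: distrib_left)
    then have aw: "angw t = 2 / pi * (1 - p1) * ((sin t)\<^sup>2 / poisson_den r1 t) + 2 / pi * p1 * ((sin t)\<^sup>2 / poisson_den (- r2) t)"
      unfolding k1 k2 .
    show ?thesis unfolding aw by (simp only: distrib_left distrib_right mult.assoc)
  qed
  have "(\<integral>t. cos (real (Suc m) * t) \<partial>angle_law) =
     2 / pi * ((1 - p1) * (pi / 4 * (r1 ^ Suc m - (if m = 0 then 0 else r1 ^ (m - 1)))) +
       p1 * (pi / 4 * ((- r2) ^ Suc m - (if m = 0 then 0 else (- r2) ^ (m - 1)))))"
    by (subst angle_law_integral)
       (simp_all only: w integral_mult_right_zero halfcircle_sin_squared_cos[OF le(1)] halfcircle_sin_squared_cos[OF le(2)]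
          Bochner_Integration.integral_add[OF integrable_mult_right[OF halfcircle_sin_squared_cos(1)[OF le(1)]]
             integrable_mult_right[OF halfcircle_sin_squared_cos(1)[OF le(2)]]],
        measurable)
  also have "\<dots> = ((1 - p1) * (r1 ^ Suc m - (if m = 0 then 0 else r1 ^ (m - 1))) +
       p1 * ((- r2) ^ Suc m - (if m = 0 then 0 else (- r2) ^ (m - 1)))) / 2"
    by (simp add: field_simps)
  also have "\<dots> = - (al * r1 ^ Suc m + be * (- r2) ^ Suc m) / 2"
  proof (cases m)
    case 0
    have "(r1 + r2) * ((1 - p1) * r1 - p1 * r2) = (r1 + r2) * (- (al * r1) + be * r2)"
    proof -
      have "(r1 + r2) * ((1 - p1) * r1 - p1 * r2) = ((1 - p1) * (r1 + r2)) * r1 - (p1 * (r1 + r2)) * r2"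
        by (simp add: algebra_simps)
      also have "\<dots> = - (al * r1 * (r1 + r2)) + be * r2 * (r1 + r2)"
        unfolding p_r al_relation be_relation by (simp add: power2_eq_square)
      finally show ?thesis by (simp add: algebra_simps)
    qed
    then have "(1 - p1) * r1 - p1 * r2 = - (al * r1) + be * r2"
      using r_bounds by simp
    then show ?thesis using 0 by simp
  next
    case (Suc k)
    have "(1 - p1) * (r1 ^ Suc (Suc k) - r1 ^ k) = - ((1 - p1) * (1 - r1\<^sup>2)) * r1 ^ k"
      by (simp add: power2_eq_square algebra_simps)
    also have "\<dots> = - (al * r1 ^ Suc (Suc k))"
      unfolding al_r[symmetric] by (simp add: power2_eq_square)
    finally have 1: "(1 - p1) * (r1 ^ Suc (Suc k) - r1 ^ k) = - (al * r1 ^ Suc (Suc k))" .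
    have "p1 * ((- r2) ^ Suc (Suc k) - (- r2) ^ k) = - (p1 * (1 - r2\<^sup>2)) * (- r2) ^ k"
      by (simp add: power2_eq_square algebra_simps)
    also have "\<dots> = - (be * (- r2) ^ Suc (Suc k))"
      unfolding be_r[symmetric] by (simp add: power2_eq_square)
    finally have 2: "p1 * ((- r2) ^ Suc (Suc k) - (- r2) ^ k) = - (be * (- r2) ^ Suc (Suc k))" .
    show ?thesis using 1 2 Suc by simp
  qed
  finally show ?thesis .
qed

text \<open>Integrating the Chebyshev expansion term by term produces two more Mercator series.\<close>

lemma reg_log_kernel_angle_law:
  assumes "\<bar>\<rho>\<bar> < 1"
  shows "integrable angle_law (\<lambda>t. reg_log_kernel \<rho> t \<phi>)"
    and "(\<integral>t. reg_log_kernel \<rho> t \<phi> \<partial>angle_law) = - al * log_poisson (r1 * \<rho>) \<phi> - be * log_poisson (- r2 * \<rho>) \<phi>"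
proof -
  interpret prob_space angle_law by (rule prob_angle_law)
  have m: "(\<lambda>t. t) \<in> borel_measurable angle_law" by (rule angle_law_measurable) simp
  note G = reg_log_kernel_integral_sums[OF finite_measure_axioms m borel_measurable_const[of \<phi>] assms]
  show "integrable angle_law (\<lambda>t. reg_log_kernel \<rho> t \<phi>)" by (rule G(1))
  have r: "\<bar>r1 * \<rho>\<bar> < 1" "\<bar>- r2 * \<rho>\<bar> < 1"
    using r_bounds assms mult_le_one[of r1 "\<bar>\<rho>\<bar>"]
    by (auto simp: abs_mult intro: le_less_trans[OF mult_left_le_one_le])
  have eq: "2 / real k * \<rho> ^ k * (\<integral>t. cos (real k * t) * cos (real k * \<phi>) \<partial>angle_law) =
      - al * ((r1 * \<rho>) ^ k * cos (real k * \<phi>) / real k) - be * ((- r2 * \<rho>) ^ k * cos (real k * \<phi>) / real k)" for k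
  proof (cases k)
    case (Suc m)
    have e: "(\<integral>t. cos (real k * t) * cos (real k * \<phi>) \<partial>angle_law) = - (al * r1 ^ k + be * (- r2) ^ k) / 2 * cos (real k * \<phi>)"
      unfolding Suc by (simp only: integral_mult_left_zero angle_cos_moment)
    have "2 / K * R * (- (A1 * x + B1 * y) / 2 * C) = - A1 * ((x * R) * C / K) - B1 * ((y * R) * C / K)"
      for K R A1 B1 x y C :: real
      by (cases "K = 0") (simp_all add: field_simps)
    then show ?thesis
      unfolding e power_mult_distrib .
  qed simp
  have "(\<lambda>k. - al * ((r1 * \<rho>) ^ k * cos (real k * \<phi>) / real k) - be * ((- r2 * \<rho>) ^ k * cos (real k * \<phi>) / real k)) sums
      (- al * log_poisson (r1 * \<rho>) \<phi> - be * log_poisson (- r2 * \<rho>) \<phi>)"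
    by (intro sums_diff sums_mult log_poisson_sums r)
  then show "(\<integral>t. reg_log_kernel \<rho> t \<phi> \<partial>angle_law) = - al * log_poisson (r1 * \<rho>) \<phi> - be * log_poisson (- r2 * \<rho>) \<phi>"
    using G(2) unfolding eq by (rule sums_unique2[rotated])
qed

definition rad where "rad = sqrt (wA * wB)"

lemma rad_pos: "0 < rad" using w_pos by (simp add: rad_def)

definition field :: "real \<Rightarrow> real" where
  "field t = - al * ln (t - a) - be * ln (b - t)"

text \<open>The constant value of twice the potential plus the field on the support, known as the modified
  Robin constant.\<close>

definition robin where
  "robin = - 2 * ln ((b - a) * rad) - al * ln ((b - a) * wA) - be * ln ((b - a) * wE)"

definition pot_bound where "pot_bound = - ln ((b - a) * rad) + (al + be) * ln 2"

definition pot :: "real \<Rightarrow> real" where "pot t = - (\<integral>s. ln \<bar>t - s\<bar> \<partial>\<mu>)"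

lemma log_dist_measurable: "(\<lambda>s. ln \<bar>t - s\<bar>) \<in> borel_measurable borel" for t :: real
  by measurable

text \<open>The limit \<open>\<rho> \<rightarrow> 1\<close> of \<open>reg_log_kernel_angle_law\<close> expresses the potential by \<open>ln (poisson_den r1)\<close> and
  \<open>ln (poisson_den (- r2))\<close>. These are \<open>ln (t - a)\<close> and \<open>ln (b - t)\<close> up to constants, because of
  \<open>uang_poisson\<close>.\<close>

lemma potential_inside:
  assumes \<phi>: "\<phi> \<in> {0<..<pi}"
  shows "integrable \<mu> (\<lambda>s. ln \<bar>xang \<phi> - s\<bar>)" and "pot (xang \<phi>) \<le> pot_bound"
    and "2 * pot (xang \<phi>) + field (xang \<phi>) = robin"
proof -
  interpret prob_space angle_law by (rule prob_angle_law)
  have s: "sin \<phi> \<noteq> 0" using sin_gt_zero[of \<phi>] \<phi> by auto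
  have pd: "0 < poisson_den r1 \<phi>" "0 < poisson_den (- r2) \<phi>"
  proof -
    have "0 < wA * poisson_den r1 \<phi>" "0 < wE * poisson_den (- r2) \<phi>"
      unfolding uang_poisson[symmetric] using uang_pos[OF s] by auto
    then show "0 < poisson_den r1 \<phi>" "0 < poisson_den (- r2) \<phi>"
      using w_pos by (simp_all only: zero_less_mult_iff) auto
  qed
  have m: "(\<lambda>t. t) \<in> borel_measurable angle_law" by (rule angle_law_measurable) simp
  have ne: "AE t in angle_law. cos t \<noteq> cos \<phi>"
    using angle_AE_ne[of \<phi>]
  proof eventually_elim
    fix t assume "t \<in> {0..pi} \<and> t \<noteq> \<phi>"
    then show "cos t \<noteq> cos \<phi>" using \<phi> cos_inj_pi[of t \<phi>] by auto
  qed
  have "(\<lambda>n. - al * log_poisson (r1 * radius n) \<phi> - be * log_poisson (- r2 * radius n) \<phi>) \<longlonglongrightarrow> - al * log_poisson r1 \<phi> - be * log_poisson (- r2) \<phi>"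
    by (intro tendsto_intros log_poisson_tendsto pd)
  then have lim: "(\<lambda>n. \<integral>t. reg_log_kernel (radius n) t \<phi> \<partial>angle_law) \<longlonglongrightarrow> - al * log_poisson r1 \<phi> - be * log_poisson (- r2) \<phi>"
    unfolding reg_log_kernel_angle_law(2)[OF radius_bounds(3)] .
  note L = log_kernel_integral[OF finite_measure_axioms m borel_measurable_const[of \<phi>] ne lim]
  have kern: "AE t in angle_law. ln \<bar>xang \<phi> - xang t\<bar> = ln ((b - a) * rad) - log_kernel t \<phi>"
    using ne
  proof eventually_elim
    fix t assume ne: "cos t \<noteq> cos \<phi>"
    have "\<bar>xang \<phi> - xang t\<bar> = \<bar>((b - a) * rad) * (2 * (cos t - cos \<phi>))\<bar>"
      by (simp add: xang_def uang_def rad_def algebra_simps)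
    also have "\<dots> = ((b - a) * rad) * (2 * \<bar>cos t - cos \<phi>\<bar>)"
      unfolding abs_mult using ab rad_pos by simp
    finally have e: "\<bar>xang \<phi> - xang t\<bar> = ((b - a) * rad) * (2 * \<bar>cos t - cos \<phi>\<bar>)" .
    have "0 < (b - a) * rad" "0 < 2 * \<bar>cos t - cos \<phi>\<bar>" using ab rad_pos ne by auto
    then show "ln \<bar>xang \<phi> - xang t\<bar> = ln ((b - a) * rad) - log_kernel t \<phi>"
      unfolding e log_kernel_def by (simp only: ln_mult_pos)
  qed
  have xm: "(\<lambda>t. ln \<bar>xang \<phi> - xang t\<bar>) \<in> borel_measurable angle_law"
    by (rule angle_law_measurable, rule measurable_compose[OF xang_measurable log_dist_measurable])
  have lm: "(\<lambda>t. ln ((b - a) * rad) - log_kernel t \<phi>) \<in> borel_measurable angle_law"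
    by (intro borel_measurable_diff log_kernel_measurable m borel_measurable_const)
  have "integrable angle_law (\<lambda>t. ln ((b - a) * rad) - log_kernel t \<phi>)"
    using L(1) by simp
  then show "integrable \<mu> (\<lambda>s. ln \<bar>xang \<phi> - s\<bar>)"
    unfolding mu_integral(1)[OF log_dist_measurable] using integrable_cong_AE[OF xm lm kern] by simp
  have "pot (xang \<phi>) = - (\<integral>t. ln ((b - a) * rad) - log_kernel t \<phi> \<partial>angle_law)"
    unfolding pot_def mu_integral(2)[OF log_dist_measurable] using integral_cong_AE[OF xm lm kern] by simp
  also have "\<dots> = - ln ((b - a) * rad) + (- al * log_poisson r1 \<phi> - be * log_poisson (- r2) \<phi>)"
    using L by (simp add: prob_space)
  finally have pot: "pot (xang \<phi>) = - ln ((b - a) * rad) + (- al * log_poisson r1 \<phi> - be * log_poisson (- r2) \<phi>)" .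
  have l2: "- log_poisson c \<phi> \<le> ln 2" if "0 < poisson_den c \<phi>" "\<bar>c\<bar> \<le> 1" for c
  proof -
    have "ln (poisson_den c \<phi>) \<le> ln 4" using that poisson_den_le_4[of c \<phi>] by simp
    also have "ln 4 = 2 * ln (2::real)" using ln_realpow[of 2 2] by simp
    finally show ?thesis by (simp add: log_poisson_def)
  qed
  have "- log_poisson r1 \<phi> \<le> ln 2" "- log_poisson (- r2) \<phi> \<le> ln 2"
    using l2[OF pd(1)] l2[OF pd(2)] r_bounds by auto
  from mult_left_mono[OF this(1) al_be_nonneg(1)] mult_left_mono[OF this(2) al_be_nonneg(2)]
  show "pot (xang \<phi>) \<le> pot_bound"
    unfolding pot pot_bound_def by (simp add: algebra_simps)
  have "xang \<phi> - a = (b - a) * uang \<phi>" "b - xang \<phi> = (b - a) * (1 - uang \<phi>)"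
    by (simp_all add: xang_def algebra_simps)
  then have "xang \<phi> - a = (b - a) * wA * poisson_den r1 \<phi>" "b - xang \<phi> = (b - a) * wE * poisson_den (- r2) \<phi>"
    unfolding uang_poisson(2) unfolding uang_poisson(1) mult.assoc .
  then have f: "field (xang \<phi>) = - al * (ln ((b - a) * wA) + ln (poisson_den r1 \<phi>)) - be * (ln ((b - a) * wE) + ln (poisson_den (- r2) \<phi>))"
    using ab w_pos pd by (simp add: field_def ln_mult_pos)
  show "2 * pot (xang \<phi>) + field (xang \<phi>) = robin"
    unfolding pot f robin_def log_poisson_def by (simp add: algebra_simps)
qed

text \<open>Off the support \<open>\<bar>t - s\<bar>\<close> is a multiple of the Poisson denominator with parameter \<open>\<rho>\<close>, so the potential is
  elementary and the claim becomes \<open>off_support_inequality\<close>.\<close>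

lemma potential_outside:
  assumes \<rho>: "\<rho> \<noteq> 0" "\<bar>\<rho>\<bar> < 1" and t: "t = a + (b - a) * (wA + wB - rad * (\<rho> + 1 / \<rho>))" and tab: "a < t" "t < b"
  shows "integrable \<mu> (\<lambda>s. ln \<bar>t - s\<bar>)" and "pot t \<le> pot_bound" and "robin \<le> 2 * pot t + field t"
proof -
  interpret prob_space angle_law by (rule prob_angle_law)
  have kern: "ln \<bar>t - xang x\<bar> = ln ((b - a) * rad) - ln \<bar>\<rho>\<bar> - reg_log_kernel \<rho> x 0" for x
  proof -
    have "t - xang x = - (((b - a) * rad) / \<rho> * poisson_den \<rho> x)"
      unfolding t xang_def uang_def rad_def[symmetric] poisson_den_def using \<rho>(1)
      by (simp add: field_simps power2_eq_square)
    then have "\<bar>t - xang x\<bar> = ((b - a) * rad) / \<bar>\<rho>\<bar> * poisson_den \<rho> x"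
      using ab rad_pos poisson_den_pos(2)[OF \<rho>(2), of x] by (simp add: abs_mult abs_divide)
    then show ?thesis
      using ab rad_pos poisson_den_pos(2)[OF \<rho>(2), of x] \<rho>(1)
      by (simp add: ln_mult_pos ln_div reg_log_kernel_zero log_poisson_def)
  qed
  have G: "integrable angle_law (\<lambda>x. reg_log_kernel \<rho> x 0)" by (rule reg_log_kernel_angle_law(1)[OF \<rho>(2)])
  show "integrable \<mu> (\<lambda>s. ln \<bar>t - s\<bar>)"
    unfolding mu_integral(1)[OF log_dist_measurable] kern using G by simp
  have rr: "r1 * \<rho> < 1" "- r2 * \<rho> < 1"
  proof -
    have "r1 * \<bar>\<rho>\<bar> < 1" "r2 * \<bar>\<rho>\<bar> < 1"
      using r_bounds \<rho>(2) by (auto intro: le_less_trans[OF mult_left_le_one_le])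
    moreover have "r1 * \<rho> \<le> r1 * \<bar>\<rho>\<bar>"
      by (rule mult_left_mono) (use r_bounds in auto)
    moreover have "r2 * - \<rho> \<le> r2 * \<bar>\<rho>\<bar>"
      by (rule mult_left_mono) (use r_bounds in auto)
    ultimately show "r1 * \<rho> < 1" "- r2 * \<rho> < 1" by auto
  qed
  have "pot t = - (ln ((b - a) * rad) - ln \<bar>\<rho>\<bar> - (\<integral>x. reg_log_kernel \<rho> x 0 \<partial>angle_law))"
    unfolding pot_def mu_integral(2)[OF log_dist_measurable] kern using G by (simp add: prob_space)
  also have "\<dots> = - ln ((b - a) * rad) + ln \<bar>\<rho>\<bar> + al * ln (1 - r1 * \<rho>) + be * ln (1 + r2 * \<rho>)"
    unfolding reg_log_kernel_angle_law(2)[OF \<rho>(2)] using log_poisson_0[OF rr(1)] log_poisson_0[OF rr(2)] by simp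
  finally have pot: "pot t = - ln ((b - a) * rad) + ln \<bar>\<rho>\<bar> + al * ln (1 - r1 * \<rho>) + be * ln (1 + r2 * \<rho>)" .
  have b2: "1 - r1 * \<rho> \<le> 2" "1 + r2 * \<rho> \<le> 2"
  proof -
    have "\<bar>r1 * \<rho>\<bar> \<le> 1" "\<bar>r2 * \<rho>\<bar> \<le> 1"
      using r_bounds \<rho>(2) by (auto simp: abs_mult intro!: mult_le_one)
    then show "1 - r1 * \<rho> \<le> 2" "1 + r2 * \<rho> \<le> 2" by (simp_all add: abs_le_iff)
  qed
  have "al * ln (1 - r1 * \<rho>) \<le> al * ln 2" "be * ln (1 + r2 * \<rho>) \<le> be * ln 2" "ln \<bar>\<rho>\<bar> \<le> 0"
    using al_be_nonneg b2 rr \<rho> by (auto intro!: mult_left_mono)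
  then show "pot t \<le> pot_bound"
    unfolding pot pot_bound_def by (simp add: algebra_simps)
  have ta: "t - a = (b - a) * wA * ((1 - r1 * \<rho>) * (1 - r1 / \<rho>))"
  proof -
    have "wA * ((1 - r1 * \<rho>) * (1 - r1 / \<rho>)) = wA + wA * r1\<^sup>2 - (wA * r1) * (\<rho> + 1 / \<rho>)"
      using \<rho>(1) by (simp add: field_simps power2_eq_square)
    also have "\<dots> = wA + wB - rad * (\<rho> + 1 / \<rho>)" unfolding r_squares r_products rad_def ..
    finally show ?thesis by (simp only: t mult.assoc)
  qed
  have tb: "b - t = (b - a) * wE * ((1 + r2 * \<rho>) * (1 + r2 / \<rho>))"
  proof -
    have "wE * ((1 + r2 * \<rho>) * (1 + r2 / \<rho>)) = wE + wE * r2\<^sup>2 + (wE * r2) * (\<rho> + 1 / \<rho>)"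
      using \<rho>(1) by (simp add: field_simps power2_eq_square)
    also have "\<dots> = wE + wD + rad * (\<rho> + 1 / \<rho>)" unfolding r_squares r_products rad_def ..
    also have "wE + wD = 1 - wA - wB" by (simp add: wA_def wB_def wE_def wD_def algebra_simps)
    finally have e: "wE * ((1 + r2 * \<rho>) * (1 + r2 / \<rho>)) = 1 - wA - wB + rad * (\<rho> + 1 / \<rho>)" .
    show ?thesis unfolding mult.assoc e by (simp add: t algebra_simps)
  qed
  have pa: "0 < 1 - r1 * \<rho>" "0 < 1 + r2 * \<rho>" using rr by auto
  have pb: "0 < 1 - r1 / \<rho>" "0 < 1 + r2 / \<rho>"
  proof -
    have "0 < (b - a) * wA * ((1 - r1 * \<rho>) * (1 - r1 / \<rho>))" "0 < (b - a) * wE * ((1 + r2 * \<rho>) * (1 + r2 / \<rho>))"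
      using tab by (simp_all flip: ta tb)
    moreover have "0 < (b - a) * wA" "0 < (b - a) * wE" using ab w_pos by auto
    ultimately have "0 < (1 - r1 * \<rho>) * (1 - r1 / \<rho>)" "0 < (1 + r2 * \<rho>) * (1 + r2 / \<rho>)"
      using zero_less_mult_pos by blast+
    then show "0 < 1 - r1 / \<rho>" "0 < 1 + r2 / \<rho>"
      using zero_less_mult_pos pa by blast+
  qed
  have f: "field t = - al * (ln ((b - a) * wA) + ln (1 - r1 * \<rho>) + ln (1 - r1 / \<rho>))
      - be * (ln ((b - a) * wE) + ln (1 + r2 * \<rho>) + ln (1 + r2 / \<rho>))"
    unfolding field_def ta tb using ab w_pos pa pb by (simp add: ln_mult_pos add_ac)
  have "2 * pot t + field t - robin =
      2 * ln \<bar>\<rho>\<bar> + al * (ln (1 - r1 * \<rho>) - ln (1 - r1 / \<rho>)) + be * (ln (1 + r2 * \<rho>) - ln (1 + r2 / \<rho>))"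
    unfolding pot f robin_def by (simp add: algebra_simps)
  also have "0 \<le> \<dots>"
  proof (cases "0 < \<rho>")
    case True
    then have "r1 < \<rho>" using pb(1) by (simp add: divide_less_eq)
    with off_support_inequality[of r1 r2 \<rho> al be] True \<rho>(2) r_bounds al_relation be_relation
    show ?thesis by simp
  next
    case False
    \<comment> \<open>Points to the right of the support: reflect \<open>[a,b]\<close>, which exchanges \<open>r1\<close> and \<open>r2\<close> and the two
      charges.\<close>
    then have neg: "\<rho> < 0" using \<rho>(1) by simp
    then have "r2 < - \<rho>" using pb(2) by (simp add: field_simps)
    with off_support_inequality[of r2 r1 "- \<rho>" be al] neg \<rho>(2) r_bounds al_relation be_relation
    show ?thesis by (simp add: add.commute add.left_commute)
  qed
  finally show "robin \<le> 2 * pot t + field t" by simp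
qed

text \<open>The end points of \<open>[a,b]\<close> and of the support, which no measure of finite energy charges.\<close>

definition exceptional :: "real set" where "exceptional = {a, b, xang 0, xang pi}"

lemma xang_strict:
  assumes "t \<in> {0<..<pi}"
  shows "xang t \<in> {xang 0<..<xang pi}"
proof -
  have "cos t < 1" "- 1 < cos t"
    using assms cos_monotone_0_pi[of 0 t] cos_monotone_0_pi[of t pi] by auto
  moreover have "xang t - xang 0 = (b - a) * rad * 2 * (1 - cos t)" "xang pi - xang t = (b - a) * rad * 2 * (1 + cos t)"
    by (simp_all add: xang_def uang_def rad_def algebra_simps)
  ultimately have "0 < xang t - xang 0" "0 < xang pi - xang t" using ab rad_pos by simp_all
  then show ?thesis by simp
qed

lemma mu_AE_interior: "AE s in \<mu>. \<exists>\<phi>\<in>{0<..<pi}. s = xang \<phi>"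
proof -
  have "AE t in angle_law. xang t \<in> {xang 0<..<xang pi}"
    using angle_AE_interior by eventually_elim (rule xang_strict)
  then have AE: "AE s in \<mu>. s \<in> {xang 0<..<xang pi}"
    unfolding mu_eq_distr using xang_measurable_law
    by (subst AE_distr_iff) (auto simp: space_restrict_space sets_restrict_space intro!: image_eqI[of _ _ "{xang 0<..<xang pi}"])
  then show ?thesis
  proof eventually_elim
    fix s assume s: "s \<in> {xang 0<..<xang pi}"
    have "\<exists>\<phi>. 0 \<le> \<phi> \<and> \<phi> \<le> pi \<and> xang \<phi> = s"
      by (rule IVT'[of xang]) (use s xang_continuous in auto)
    then obtain \<phi> where \<phi>: "0 \<le> \<phi>" "\<phi> \<le> pi" "xang \<phi> = s" by blast
    then have "\<phi> \<noteq> 0" "\<phi> \<noteq> pi" using s by auto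
    then show "\<exists>\<phi>\<in>{0<..<pi}. s = xang \<phi>" using \<phi> by (intro bexI[of _ \<phi>]) auto
  qed
qed

text \<open>The Euler-Lagrange inequality of the energy problem.\<close>

theorem potential:
  assumes "t \<in> {a..b}" "t \<notin> exceptional"
  shows "integrable \<mu> (\<lambda>s. ln \<bar>t - s\<bar>)" and "pot t \<le> pot_bound" and "robin \<le> 2 * pot t + field t"
proof -
  have t: "a < t" "t < b" using assms by (auto simp: exceptional_def)
  define u where "u = ucoord a b t"
  have tu: "t = a + (b - a) * u" using ab by (simp add: u_def ucoord_def)
  define h where "h = (wA + wB - u) / (2 * rad)"
  have uh: "u = wA + wB - rad * (2 * h)" using rad_pos by (simp add: h_def field_simps)
  have "(integrable \<mu> (\<lambda>s. ln \<bar>t - s\<bar>)) \<and> pot t \<le> pot_bound \<and> robin \<le> 2 * pot t + field t"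
  proof (cases "1 < \<bar>h\<bar>")
    case True
    then obtain \<rho> where \<rho>: "\<rho> \<noteq> 0" "\<bar>\<rho>\<bar> < 1" "\<rho> + 1 / \<rho> = 2 * h" using joukowski_inverse by blast
    have "t = a + (b - a) * (wA + wB - rad * (\<rho> + 1 / \<rho>))" unfolding \<rho>(3) tu uh ..
    from potential_outside[OF \<rho>(1,2) this t] show ?thesis by blast
  next
    case False
    then have h: "- 1 \<le> h" "h \<le> 1" by auto
    have tx: "t = xang (arccos h)"
      using h by (simp add: xang_def uang_def tu uh rad_def)
    have "arccos h \<noteq> 0" "arccos h \<noteq> pi" using assms(2) tx by (auto simp: exceptional_def)
    then have "arccos h \<in> {0<..<pi}" using arccos_lbound[OF h] arccos_ubound[OF h] by auto
    from potential_inside[OF this] show ?thesis unfolding tx by simp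
  qed
  then show "integrable \<mu> (\<lambda>s. ln \<bar>t - s\<bar>)" "pot t \<le> pot_bound" "robin \<le> 2 * pot t + field t" by auto
qed

text \<open>The Euler-Lagrange equality on the support.\<close>

lemma potential_AE: "AE t in \<mu>. t \<in> {a..b} \<and> t \<notin> exceptional \<and> 2 * pot t + field t = robin"
  using mu_AE_interior AE_space
proof eventually_elim
  fix t assume t: "\<exists>\<phi>\<in>{0<..<pi}. t = xang \<phi>" "t \<in> space \<mu>"
  then obtain \<phi> where \<phi>: "\<phi> \<in> {0<..<pi}" "t = xang \<phi>" by blast
  have s: "sin \<phi> \<noteq> 0" using sin_gt_zero[of \<phi>] \<phi>(1) by auto
  have "xang \<phi> - a = (b - a) * uang \<phi>" "b - xang \<phi> = (b - a) * (1 - uang \<phi>)"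
    by (simp_all add: xang_def algebra_simps)
  then have "0 < xang \<phi> - a" "0 < b - xang \<phi>"
    using uang_pos[OF s] ab by simp_all
  then have "t \<noteq> a" "t \<noteq> b" unfolding \<phi>(2) by auto
  moreover have "t \<noteq> xang 0" "t \<noteq> xang pi"
    using xang_strict[OF \<phi>(1)] unfolding \<phi>(2) by auto
  moreover have "t \<in> {a..b}" unfolding \<phi>(2) by (rule xang_in)
  moreover have "2 * pot t + field t = robin" unfolding \<phi>(2) by (rule potential_inside(3)[OF \<phi>(1)])
  ultimately show "t \<in> {a..b} \<and> t \<notin> exceptional \<and> 2 * pot t + field t = robin"
    by (simp add: exceptional_def)
qed

end

section \<open>The energy functional in nonnegative form\<close>

lemma ennreal_sum_eqI:
  assumes "0 \<le> x" "0 \<le> y" "0 \<le> z" "0 \<le> u" "0 \<le> v" "x + y + z = u + v"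
  shows "ennreal x + ennreal y + ennreal z = ennreal u + ennreal v"
  using assms by (metis add_nonneg_nonneg ennreal_plus)

text \<open>Adding a constant to an extended real function keeps the difference of the integrals of the
  positive and negative parts meaningful, provided that one of them is finite.\<close>

lemma ereal_difference_shift:
  fixes D F G :: ennreal
  assumes "D + F + ennreal (max (- C) 0) = G + ennreal (max C 0)" "F < \<infinity>"
  shows "enn2ereal F - enn2ereal G = ereal C - enn2ereal D"
    and "enn2ereal G - enn2ereal F = enn2ereal D - ereal C"
proof -
  obtain f where f: "F = ennreal f" "0 \<le> f" using assms(2) by (cases F) auto
  have "enn2ereal F - enn2ereal G = ereal C - enn2ereal D \<and> enn2ereal G - enn2ereal F = enn2ereal D - ereal C"
  proof (cases G)
    case top
    then have "D = \<top>" using assms(1) f by (cases D) (auto simp: ennreal_plus[symmetric] simp del: ennreal_plus)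
    then show ?thesis using top f by simp
  next
    case (real g)
    have "G + ennreal (max C 0) \<noteq> \<top>" using real by (simp del: ennreal_max_0)
    moreover have "D \<le> G + ennreal (max C 0)" unfolding assms(1)[symmetric] by (metis add.assoc le_iff_add)
    ultimately have "D \<noteq> \<top>" by (metis top.extremum_uniqueI)
    then obtain d where d: "D = ennreal d" "0 \<le> d" by (cases D) auto
    have "d + f + max (- C) 0 = g + max C 0"
      using assms(1) f d real by (simp add: ennreal_plus[symmetric] del: ennreal_plus ennreal_max_0 ennreal_max_0')
    then have "f - g = C - d" by (simp add: max_def split: if_splits)
    then show ?thesis using f d real by (simp add: algebra_simps)
  qed
  then show "enn2ereal F - enn2ereal G = ereal C - enn2ereal D" "enn2ereal G - enn2ereal F = enn2ereal D - ereal C"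
    by auto
qed

text \<open>Reduces the integral of a function bounded above to that of a nonnegative function, where no
  difference of infinities can occur; \<open>ereal_integral_lower\<close> is the counterpart for lower bounds.\<close>

lemma ereal_integral_upper:
  assumes M: "prob_space M" and f: "f \<in> borel_measurable M" and le: "\<And>x. x \<in> space M \<Longrightarrow> f x \<le> ereal C"
  shows "ereal_integral M f = ereal C - enn2ereal (\<integral>\<^sup>+x. e2ennreal (ereal C - f x) \<partial>M)"
proof -
  interpret prob_space M by (rule M)
  let ?D = "\<lambda>x. e2ennreal (ereal C - f x)" and ?P = "\<lambda>x. e2ennreal (max (f x) 0)" and ?N = "\<lambda>x. e2ennreal (max (- f x) 0)"
  have m: "?D \<in> borel_measurable M" "?P \<in> borel_measurable M" "?N \<in> borel_measurable M"
    using f by measurable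
  have pw: "?D x + ?P x + ennreal (max (- C) 0) = ?N x + ennreal (max C 0)" if "x \<in> space M" for x
  proof (cases "f x")
    case (real r)
    then have "r \<le> C" using le[OF that] by simp
    have "max r 0 = r + max (- r) 0" "max C 0 = C + max (- C) 0" by auto
    then have "ennreal (C - r) + ennreal (max r 0) + ennreal (max (- C) 0) = ennreal (max (- r) 0) + ennreal (max C 0)"
      using \<open>r \<le> C\<close> by (intro ennreal_sum_eqI) auto
    moreover have "e2ennreal (max (ereal r) 0) = ennreal (max r 0)" "e2ennreal (max (- ereal r) 0) = ennreal (max (- r) 0)"
      by (auto simp: max_def e2ennreal_ereal ennreal_neg zero_ereal_def)
    ultimately show ?thesis using real by (simp add: e2ennreal_ereal)
  next
    case PInf
    then show ?thesis using le[OF that] by simp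
  next
    case MInf
    then show ?thesis by (simp add: e2ennreal_infty)
  qed
  have "(\<integral>\<^sup>+x. ?D x \<partial>M) + (\<integral>\<^sup>+x. ?P x \<partial>M) + ennreal (max (- C) 0) = (\<integral>\<^sup>+x. ?D x + ?P x + ennreal (max (- C) 0) \<partial>M)"
    using m by (simp add: nn_integral_add emeasure_space_1)
  also have "\<dots> = (\<integral>\<^sup>+x. ?N x + ennreal (max C 0) \<partial>M)"
    by (rule nn_integral_cong) (rule pw)
  also have "\<dots> = (\<integral>\<^sup>+x. ?N x \<partial>M) + ennreal (max C 0)"
    using m by (simp add: nn_integral_add emeasure_space_1)
  finally have eq: "(\<integral>\<^sup>+x. ?D x \<partial>M) + (\<integral>\<^sup>+x. ?P x \<partial>M) + ennreal (max (- C) 0) = (\<integral>\<^sup>+x. ?N x \<partial>M) + ennreal (max C 0)" .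
  have "(\<integral>\<^sup>+x. ?P x \<partial>M) \<le> (\<integral>\<^sup>+x. ennreal (max C 0) \<partial>M)"
  proof (rule nn_integral_mono)
    fix x assume "x \<in> space M"
    then have "max (f x) 0 \<le> ereal (max C 0)" using le[of x] by (simp add: max.coboundedI1 zero_ereal_def)
    from e2ennreal_mono[OF this] show "?P x \<le> ennreal (max C 0)" unfolding e2ennreal_ereal .
  qed
  also have "\<dots> < \<infinity>" by (simp add: emeasure_space_1)
  finally have fin: "(\<integral>\<^sup>+x. ?P x \<partial>M) < \<infinity>" .
  show ?thesis unfolding ereal_integral_def by (rule ereal_difference_shift(1)[OF eq fin])
qed

lemma ereal_integral_lower:
  assumes M: "prob_space M" and f: "f \<in> borel_measurable M" and ge: "\<And>x. x \<in> space M \<Longrightarrow> ereal (- C) \<le> f x"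
  shows "ereal_integral M f = enn2ereal (\<integral>\<^sup>+x. e2ennreal (f x + ereal C) \<partial>M) - ereal C"
proof -
  interpret prob_space M by (rule M)
  let ?D = "\<lambda>x. e2ennreal (f x + ereal C)" and ?P = "\<lambda>x. e2ennreal (max (f x) 0)" and ?N = "\<lambda>x. e2ennreal (max (- f x) 0)"
  have m: "?D \<in> borel_measurable M" "?P \<in> borel_measurable M" "?N \<in> borel_measurable M"
    using f by measurable
  have pw: "?D x + ?N x + ennreal (max (- C) 0) = ?P x + ennreal (max C 0)" if "x \<in> space M" for x
  proof (cases "f x")
    case (real r)
    then have "- C \<le> r" using ge[OF that] by simp
    have "max r 0 = r + max (- r) 0" "max C 0 = C + max (- C) 0" by auto
    then have "ennreal (r + C) + ennreal (max (- r) 0) + ennreal (max (- C) 0) = ennreal (max r 0) + ennreal (max C 0)"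
      using \<open>- C \<le> r\<close> by (intro ennreal_sum_eqI) auto
    moreover have "e2ennreal (max (ereal r) 0) = ennreal (max r 0)" "e2ennreal (max (- ereal r) 0) = ennreal (max (- r) 0)"
      by (auto simp: max_def e2ennreal_ereal ennreal_neg zero_ereal_def)
    ultimately show ?thesis using real by (simp add: e2ennreal_ereal)
  next
    case PInf
    then show ?thesis by (simp add: e2ennreal_infty)
  next
    case MInf
    then show ?thesis using ge[OF that] by simp
  qed
  have "(\<integral>\<^sup>+x. ?D x \<partial>M) + (\<integral>\<^sup>+x. ?N x \<partial>M) + ennreal (max (- C) 0) = (\<integral>\<^sup>+x. ?D x + ?N x + ennreal (max (- C) 0) \<partial>M)"
    using m by (simp add: nn_integral_add emeasure_space_1)
  also have "\<dots> = (\<integral>\<^sup>+x. ?P x + ennreal (max C 0) \<partial>M)"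
    by (rule nn_integral_cong) (rule pw)
  also have "\<dots> = (\<integral>\<^sup>+x. ?P x \<partial>M) + ennreal (max C 0)"
    using m by (simp add: nn_integral_add emeasure_space_1)
  finally have eq: "(\<integral>\<^sup>+x. ?D x \<partial>M) + (\<integral>\<^sup>+x. ?N x \<partial>M) + ennreal (max (- C) 0) = (\<integral>\<^sup>+x. ?P x \<partial>M) + ennreal (max C 0)" .
  have "(\<integral>\<^sup>+x. ?N x \<partial>M) \<le> (\<integral>\<^sup>+x. ennreal (max C 0) \<partial>M)"
  proof (rule nn_integral_mono)
    fix x assume "x \<in> space M"
    then have "- f x \<le> ereal C" using ge[of x] by (simp add: ereal_uminus_le_reorder)
    then have "max (- f x) 0 \<le> ereal (max C 0)" by (simp add: max.coboundedI1 zero_ereal_def)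
    from e2ennreal_mono[OF this] show "?N x \<le> ennreal (max C 0)" unfolding e2ennreal_ereal .
  qed
  also have "\<dots> < \<infinity>" by (simp add: emeasure_space_1)
  finally have fin: "(\<integral>\<^sup>+x. ?N x \<partial>M) < \<infinity>" .
  show ?thesis unfolding ereal_integral_def by (rule ereal_difference_shift(2)[OF eq fin])
qed

text \<open>The logarithmic kernel shifted by \<open>ln (b - a)\<close>, which makes it nonnegative on \<open>[a,b]\<close>. On the
  diagonal it is infinite.\<close>

definition log_energy_kernel :: "real \<Rightarrow> real \<Rightarrow> real \<Rightarrow> real \<Rightarrow> ennreal" where
  "log_energy_kernel a b t s = e2ennreal (ereal (ln (b - a)) - elog \<bar>t - s\<bar>)"

lemma elog_measurable: "elog \<in> borel_measurable borel"
  unfolding elog_def by measurable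

lemma log_energy_kernel_off: "t \<noteq> s \<Longrightarrow> log_energy_kernel a b t s = ennreal (ln (b - a) - ln \<bar>t - s\<bar>)"
  by (simp add: log_energy_kernel_def elog_def e2ennreal_ereal)

lemma log_energy_kernel_diag: "log_energy_kernel a b t t = \<top>"
  by (simp add: log_energy_kernel_def elog_def e2ennreal_infty)

lemma pair_coord_measurable:
  assumes "L1 \<in> borel_prob_on a b" "L2 \<in> borel_prob_on a b"
  shows "fst \<in> borel_measurable (L1 \<Otimes>\<^sub>M L2)" "snd \<in> borel_measurable (L1 \<Otimes>\<^sub>M L2)"
proof -
  have 1: "(\<lambda>x. x) \<in> borel_measurable L1" by (rule borel_prob_on_measurable[OF assms(1)]) simp
  have 2: "(\<lambda>x. x) \<in> borel_measurable L2" by (rule borel_prob_on_measurable[OF assms(2)]) simp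
  show "fst \<in> borel_measurable (L1 \<Otimes>\<^sub>M L2)" by (rule measurable_compose[OF measurable_fst[of L1 L2] 1])
  show "snd \<in> borel_measurable (L1 \<Otimes>\<^sub>M L2)" by (rule measurable_compose[OF measurable_snd[of L1 L2] 2])
qed

lemma log_energy_kernel_measurable:
  assumes "f \<in> borel_measurable M" "g \<in> borel_measurable M"
  shows "(\<lambda>x. log_energy_kernel a b (f x) (g x)) \<in> borel_measurable M"
proof -
  have "(\<lambda>x. elog \<bar>f x - g x\<bar>) \<in> borel_measurable M"
    by (rule measurable_compose[OF _ elog_measurable]) (use assms in measurable)
  then show ?thesis unfolding log_energy_kernel_def by measurable
qed

lemma elog_le: "0 \<le> x \<Longrightarrow> x \<le> c \<Longrightarrow> elog x \<le> ereal (ln c)"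
  by (auto simp: elog_def)

text \<open>On \<open>[a,b]\<close> the field is bounded below and \<open>elog \<bar>t - s\<bar>\<close> above, so the energy is a nonnegative
  integral minus a constant.\<close>

theorem energy_eq:
  assumes ab: "a < b" and \<nu>: "\<nu> \<in> borel_prob_on a b"
    and Q: "Q \<in> borel_measurable borel" and ge: "\<And>t. t \<in> {a..b} \<Longrightarrow> ereal (- C) \<le> Q t"
  shows "energy Q \<nu> = enn2ereal ((\<integral>\<^sup>+t. e2ennreal (Q t + ereal C) \<partial>\<nu>) +
      (\<integral>\<^sup>+s. \<integral>\<^sup>+t. log_energy_kernel a b t s \<partial>\<nu> \<partial>\<nu>)) - ereal (C + ln (b - a))"
proof -
  interpret prob_space \<nu> by (rule borel_prob_onD[OF \<nu>])
  have sp: "space \<nu> = {a..b}" by (rule borel_prob_onD[OF \<nu>])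
  let ?c = "ln (b - a)"
  define U where "U s = (\<integral>\<^sup>+t. log_energy_kernel a b t s \<partial>\<nu>)" for s
  have Um: "U \<in> borel_measurable \<nu>"
    unfolding U_def
    by (rule borel_measurable_nn_integral)
       (unfold case_prod_beta, rule log_energy_kernel_measurable[OF pair_coord_measurable(2)[OF \<nu> \<nu>] pair_coord_measurable(1)[OF \<nu> \<nu>]])
  have inner: "ereal_integral \<nu> (\<lambda>t. elog \<bar>t - s\<bar>) = ereal ?c - enn2ereal (U s)" if "s \<in> {a..b}" for s
    unfolding U_def log_energy_kernel_def
  proof (rule ereal_integral_upper[OF prob_space_axioms])
    show "(\<lambda>t. elog \<bar>t - s\<bar>) \<in> borel_measurable \<nu>"
      by (rule borel_prob_on_measurable[OF \<nu>], rule measurable_compose[OF _ elog_measurable]) measurable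
    show "elog \<bar>t - s\<bar> \<le> ereal ?c" if "t \<in> space \<nu>" for t
      using that sp \<open>s \<in> {a..b}\<close> by (intro elog_le) auto
  qed
  have "ereal_integral \<nu> (\<lambda>s. ereal_integral \<nu> (\<lambda>t. elog \<bar>t - s\<bar>)) = ereal_integral \<nu> (\<lambda>s. ereal ?c - enn2ereal (U s))"
    unfolding ereal_integral_def[of \<nu> "\<lambda>s. ereal_integral \<nu> (\<lambda>t. elog \<bar>t - s\<bar>)"] ereal_integral_def[of \<nu> "\<lambda>s. ereal ?c - enn2ereal (U s)"]
    by (intro arg_cong2[where f="(-)"] arg_cong[where f=enn2ereal] nn_integral_cong) (simp_all add: inner sp)
  also have "\<dots> = ereal ?c - enn2ereal (\<integral>\<^sup>+s. e2ennreal (ereal ?c - (ereal ?c - enn2ereal (U s))) \<partial>\<nu>)"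
  proof (rule ereal_integral_upper[OF prob_space_axioms])
    show "(\<lambda>s. ereal ?c - enn2ereal (U s)) \<in> borel_measurable \<nu>" using Um by measurable
    show "ereal ?c - enn2ereal (U s) \<le> ereal ?c" for s
      by (cases "U s") (auto simp: enn2ereal_ennreal)
  qed
  also have "(\<integral>\<^sup>+s. e2ennreal (ereal ?c - (ereal ?c - enn2ereal (U s))) \<partial>\<nu>) = (\<integral>\<^sup>+s. U s \<partial>\<nu>)"
  proof (rule nn_integral_cong)
    fix s
    show "e2ennreal (ereal ?c - (ereal ?c - enn2ereal (U s))) = U s"
      by (cases "U s") (auto simp: enn2ereal_ennreal e2ennreal_ereal e2ennreal_infty)
  qed
  finally have 1: "ereal_integral \<nu> (\<lambda>s. ereal_integral \<nu> (\<lambda>t. elog \<bar>t - s\<bar>)) = ereal ?c - enn2ereal (\<integral>\<^sup>+s. U s \<partial>\<nu>)" .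
  have 2: "ereal_integral \<nu> Q = enn2ereal (\<integral>\<^sup>+t. e2ennreal (Q t + ereal C) \<partial>\<nu>) - ereal C"
    by (rule ereal_integral_lower[OF prob_space_axioms borel_prob_on_measurable[OF \<nu> Q]]) (use ge sp in auto)
  have "(enn2ereal x - ereal C) - (ereal ?c - enn2ereal y) = enn2ereal (x + y) - ereal (C + ?c)" for x y
    by (cases x; cases y) (auto simp: enn2ereal_ennreal ennreal_plus[symmetric] simp del: ennreal_plus)
  then show ?thesis unfolding energy_def 1 2 U_def .
qed

section \<open>Positivity of the logarithmic energy\<close>

text \<open>The angle of the point \<open>x\<close> with respect to \<open>[a,b]\<close>. The argument is clipped to make the function
  continuous on the whole line.\<close>

definition angle_of :: "real \<Rightarrow> real \<Rightarrow> real \<Rightarrow> real" where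
  "angle_of a b x = arccos (max (- 1) (min 1 ((x - (a + b) / 2) / ((b - a) / 2))))"

lemma angle_of_continuous: "a < b \<Longrightarrow> continuous_on UNIV (angle_of a b)"
  unfolding angle_of_def by (intro continuous_intros) auto

lemma cos_angle_of:
  assumes "a < b" "x \<in> {a..b}"
  shows "cos (angle_of a b x) = (x - (a + b) / 2) / ((b - a) / 2)"
proof -
  have "- 1 \<le> (x - (a + b) / 2) / ((b - a) / 2)" "(x - (a + b) / 2) / ((b - a) / 2) \<le> 1"
    using assms by (auto simp: field_simps)
  then show ?thesis unfolding angle_of_def by (subst cos_arccos) auto
qed

lemma log_kernel_angle_of:
  assumes "a < b" "x \<in> {a..b}" "y \<in> {a..b}" "x \<noteq> y"
  shows "cos (angle_of a b x) \<noteq> cos (angle_of a b y)" and "log_kernel (angle_of a b x) (angle_of a b y) = ln ((b - a) / 4) - ln \<bar>x - y\<bar>"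
proof -
  have d: "cos (angle_of a b x) - cos (angle_of a b y) = (x - y) / ((b - a) / 2)"
    unfolding cos_angle_of[OF assms(1,2)] cos_angle_of[OF assms(1,3)] by (simp add: diff_divide_distrib)
  then show "cos (angle_of a b x) \<noteq> cos (angle_of a b y)" using assms by auto
  have "2 * \<bar>cos (angle_of a b x) - cos (angle_of a b y)\<bar> = \<bar>x - y\<bar> / ((b - a) / 4)"
  proof -
    have "2 * (z / ((b - a) / 2)) = z / ((b - a) / 4)" for z :: real by simp
    moreover have "\<bar>(b - a) / 2\<bar> = (b - a) / 2" using assms(1) by simp
    ultimately show ?thesis unfolding d abs_divide[of "x - y"] by simp
  qed
  then have "ln (2 * \<bar>cos (angle_of a b x) - cos (angle_of a b y)\<bar>) = ln \<bar>x - y\<bar> - ln ((b - a) / 4)"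
    using assms(1,4) by (simp only:) (subst ln_div, auto)
  then show "log_kernel (angle_of a b x) (angle_of a b y) = ln ((b - a) / 4) - ln \<bar>x - y\<bar>" by (simp add: log_kernel_def)
qed

text \<open>The moment of the \<open>k\<close>-th Chebyshev polynomial of \<open>[a,b]\<close>.\<close>

definition cheb_moment :: "real \<Rightarrow> real \<Rightarrow> nat \<Rightarrow> real measure \<Rightarrow> real" where
  "cheb_moment a b k \<nu> = (\<integral>x. cos (real k * angle_of a b x) \<partial>\<nu>)"

text \<open>Since \<open>ln 0 = 0\<close> in the reals, the condition that the diagonal is a null set has to be stated
  separately.\<close>

definition log_integrable :: "real measure \<Rightarrow> real measure \<Rightarrow> bool" where
  "log_integrable L1 L2 \<longleftrightarrow> (AE p in L1 \<Otimes>\<^sub>M L2. fst p \<noteq> snd p) \<and> integrable (L1 \<Otimes>\<^sub>M L2) (\<lambda>p. ln \<bar>fst p - snd p\<bar>)"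

definition mutual_log :: "real measure \<Rightarrow> real measure \<Rightarrow> real" where
  "mutual_log L1 L2 = (\<integral>p. ln \<bar>fst p - snd p\<bar> \<partial>(L1 \<Otimes>\<^sub>M L2))"

lemma pair_prob:
  assumes "L1 \<in> borel_prob_on a b" "L2 \<in> borel_prob_on a b"
  shows "pair_prob_space L1 L2"
  using borel_prob_onD(1)[OF assms(1)] borel_prob_onD(1)[OF assms(2)]
  by (simp add: pair_prob_space_def pair_sigma_finite_def prob_space_imp_sigma_finite)

text \<open>For the regularized kernel the mutual energy is diagonal in Chebyshev moments, and the kernel
  converges to the logarithm.\<close>

lemma regularized_mutual_log:
  assumes ab: "a < b" and L: "L1 \<in> borel_prob_on a b" "L2 \<in> borel_prob_on a b"
  shows "\<bar>\<rho>\<bar> < 1 \<Longrightarrow> (\<lambda>k. 2 / real k * \<rho> ^ k * (cheb_moment a b k L1 * cheb_moment a b k L2)) sums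
      (\<integral>p. reg_log_kernel \<rho> (angle_of a b (fst p)) (angle_of a b (snd p)) \<partial>(L1 \<Otimes>\<^sub>M L2))"
    and "log_integrable L1 L2 \<Longrightarrow> (\<lambda>n. \<integral>p. reg_log_kernel (radius n) (angle_of a b (fst p)) (angle_of a b (snd p)) \<partial>(L1 \<Otimes>\<^sub>M L2)) \<longlonglongrightarrow>
      ln ((b - a) / 4) - mutual_log L1 L2"
proof -
  interpret pair_prob_space L1 L2 by (rule pair_prob[OF L])
  let ?N = "L1 \<Otimes>\<^sub>M L2"
  have am: "angle_of a b \<in> borel_measurable borel" by (rule borel_measurable_continuous_onI[OF angle_of_continuous[OF ab]])
  have fm: "(\<lambda>p. angle_of a b (fst p)) \<in> borel_measurable ?N" "(\<lambda>p. angle_of a b (snd p)) \<in> borel_measurable ?N"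
    using measurable_compose[OF pair_coord_measurable(1)[OF L] am] measurable_compose[OF pair_coord_measurable(2)[OF L] am] by auto
  have fin: "finite_measure ?N" by (rule finite_measure_axioms)
  have prod: "(\<integral>p. cos (real k * angle_of a b (fst p)) * cos (real k * angle_of a b (snd p)) \<partial>?N) = cheb_moment a b k L1 * cheb_moment a b k L2" for k
  proof -
    have "integrable ?N (\<lambda>p. cos (real k * angle_of a b (fst p)) * cos (real k * angle_of a b (snd p)))"
    proof (rule P.integrable_const_bound[of _ 1])
      show "AE p in ?N. norm (cos (real k * angle_of a b (fst p)) * cos (real k * angle_of a b (snd p))) \<le> 1"
        by (rule AE_I2) (simp add: abs_mult mult_le_one)
    qed (use fm in measurable)
    then have "(\<integral>p. cos (real k * angle_of a b (fst p)) * cos (real k * angle_of a b (snd p)) \<partial>?N) =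
       (\<integral>x. \<integral>y. cos (real k * angle_of a b x) * cos (real k * angle_of a b y) \<partial>L2 \<partial>L1)"
      by (subst integral_fst'[symmetric]) auto
    also have "\<dots> = cheb_moment a b k L1 * cheb_moment a b k L2" by (simp add: cheb_moment_def)
    finally show ?thesis .
  qed
  show "\<bar>\<rho>\<bar> < 1 \<Longrightarrow> (\<lambda>k. 2 / real k * \<rho> ^ k * (cheb_moment a b k L1 * cheb_moment a b k L2)) sums
      (\<integral>p. reg_log_kernel \<rho> (angle_of a b (fst p)) (angle_of a b (snd p)) \<partial>?N)"
    using reg_log_kernel_integral_sums(2)[OF fin fm] unfolding prod .
  assume li: "log_integrable L1 L2"
  then have ne: "AE p in ?N. fst p \<noteq> snd p" and int: "integrable ?N (\<lambda>p. ln \<bar>fst p - snd p\<bar>)"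
    by (auto simp: log_integrable_def)
  have sp: "AE p in ?N. fst p \<in> {a..b} \<and> snd p \<in> {a..b}"
    by (rule AE_I2) (auto simp: space_pair_measure borel_prob_onD(3)[OF L(1)] borel_prob_onD(3)[OF L(2)])
  have ne': "AE p in ?N. cos (angle_of a b (fst p)) \<noteq> cos (angle_of a b (snd p))"
    using ne sp by eventually_elim (use log_kernel_angle_of(1)[OF ab] in blast)
  have eq: "AE p in ?N. log_kernel (angle_of a b (fst p)) (angle_of a b (snd p)) = ln ((b - a) / 4) - ln \<bar>fst p - snd p\<bar>"
    using ne sp by eventually_elim (use log_kernel_angle_of(2)[OF ab] in blast)
  have lm: "(\<lambda>p. log_kernel (angle_of a b (fst p)) (angle_of a b (snd p))) \<in> borel_measurable ?N" by (rule log_kernel_measurable[OF fm])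
  have rm: "(\<lambda>p. ln ((b - a) / 4) - ln \<bar>fst p - snd p\<bar>) \<in> borel_measurable ?N"
    using pair_coord_measurable[OF L] by measurable
  have "integrable ?N (\<lambda>p. ln ((b - a) / 4) - ln \<bar>fst p - snd p\<bar>)" using int by simp
  then have li: "integrable ?N (\<lambda>p. log_kernel (angle_of a b (fst p)) (angle_of a b (snd p)))"
    using integrable_cong_AE[OF lm rm eq] by simp
  have "(\<integral>p. log_kernel (angle_of a b (fst p)) (angle_of a b (snd p)) \<partial>?N) = (\<integral>p. ln ((b - a) / 4) - ln \<bar>fst p - snd p\<bar> \<partial>?N)"
    by (rule integral_cong_AE[OF lm rm eq])
  also have "\<dots> = ln ((b - a) / 4) - mutual_log L1 L2"
    using int by (simp add: mutual_log_def P.prob_space)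
  finally show "(\<lambda>n. \<integral>p. reg_log_kernel (radius n) (angle_of a b (fst p)) (angle_of a b (snd p)) \<partial>?N) \<longlonglongrightarrow> ln ((b - a) / 4) - mutual_log L1 L2"
    using log_kernel_limit[OF fin fm ne' li] by simp
qed

text \<open>The regularized energy of \<open>\<nu> - \<mu>\<close> is a series of nonnegative terms, one of which is kept in the
  limit. For \<open>k = 0\<close> the left-hand side vanishes by division by zero.\<close>

theorem log_energy_positive:
  assumes ab: "a < b" and L: "\<nu> \<in> borel_prob_on a b" "\<mu> \<in> borel_prob_on a b"
    and li: "log_integrable \<nu> \<nu>" "log_integrable \<nu> \<mu>" "log_integrable \<mu> \<mu>"
  shows "2 / real k * (cheb_moment a b k \<nu> - cheb_moment a b k \<mu>)\<^sup>2 \<le> 2 * mutual_log \<nu> \<mu> - mutual_log \<nu> \<nu> - mutual_log \<mu> \<mu>"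
proof -
  let ?G = "\<lambda>\<rho> L1 L2. \<integral>p. reg_log_kernel \<rho> (angle_of a b (fst p)) (angle_of a b (snd p)) \<partial>(L1 \<Otimes>\<^sub>M L2)"
  let ?D = "\<lambda>\<rho>. ?G \<rho> \<nu> \<nu> - 2 * ?G \<rho> \<nu> \<mu> + ?G \<rho> \<mu> \<mu>"
  have le: "2 / real k * radius n ^ k * (cheb_moment a b k \<nu> - cheb_moment a b k \<mu>)\<^sup>2 \<le> ?D (radius n)" for n
  proof -
    let ?t = "\<lambda>k. 2 / real k * radius n ^ k * (cheb_moment a b k \<nu> - cheb_moment a b k \<mu>)\<^sup>2"
    have r: "\<bar>radius n\<bar> < 1" by (rule radius_bounds)
    have "(\<lambda>k. 2 / real k * radius n ^ k * (cheb_moment a b k \<nu> * cheb_moment a b k \<nu>) - 2 * (2 / real k * radius n ^ k * (cheb_moment a b k \<nu> * cheb_moment a b k \<mu>))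
      + 2 / real k * radius n ^ k * (cheb_moment a b k \<mu> * cheb_moment a b k \<mu>)) sums ?D (radius n)"
      by (intro sums_add sums_diff sums_mult regularized_mutual_log(1)[OF ab _ _ r] L)
    moreover have "2 / real k * radius n ^ k * (cheb_moment a b k \<nu> * cheb_moment a b k \<nu>) - 2 * (2 / real k * radius n ^ k * (cheb_moment a b k \<nu> * cheb_moment a b k \<mu>))
      + 2 / real k * radius n ^ k * (cheb_moment a b k \<mu> * cheb_moment a b k \<mu>) = ?t k" for k
      by (simp only: power2_diff) (simp add: power2_eq_square algebra_simps)
    ultimately have s: "?t sums ?D (radius n)" by (simp only:)
    have "0 \<le> radius n" using radius_bounds(1)[of n] by simp
    then have nn: "0 \<le> ?t k" for k by simp
    have "sum ?t {k} \<le> suminf ?t"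
      by (rule sum_le_suminf) (use s nn in \<open>auto simp: sums_iff\<close>)
    then show ?thesis using s by (simp add: sums_iff)
  qed
  have "(\<lambda>n. 2 / real k * radius n ^ k * (cheb_moment a b k \<nu> - cheb_moment a b k \<mu>)\<^sup>2) \<longlonglongrightarrow> 2 / real k * 1 ^ k * (cheb_moment a b k \<nu> - cheb_moment a b k \<mu>)\<^sup>2"
    by (intro tendsto_intros radius_tendsto)
  moreover have "(\<lambda>n. ?D (radius n)) \<longlonglongrightarrow> (ln ((b - a) / 4) - mutual_log \<nu> \<nu>) - 2 * (ln ((b - a) / 4) - mutual_log \<nu> \<mu>) + (ln ((b - a) / 4) - mutual_log \<mu> \<mu>)"
    by (intro tendsto_intros regularized_mutual_log(2)[OF ab] L li)
  ultimately have "2 / real k * 1 ^ k * (cheb_moment a b k \<nu> - cheb_moment a b k \<mu>)\<^sup>2 \<le> (ln ((b - a) / 4) - mutual_log \<nu> \<nu>) - 2 * (ln ((b - a) / 4) - mutual_log \<nu> \<mu>) + (ln ((b - a) / 4) - mutual_log \<mu> \<mu>)"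
    by (rule LIMSEQ_le) (use le in auto)
  then show ?thesis by simp
qed

text \<open>The product formula \<open>2 cos \<theta> cos (k \<theta>) = cos ((k + 1) \<theta>) + cos ((k - 1) \<theta>)\<close> lets one raise the power of
  \<open>x\<close>, so all ordinary moments are determined.\<close>

lemma cheb_moments_determine:
  assumes ab: "a < b" and L: "\<nu> \<in> borel_prob_on a b" "\<mu> \<in> borel_prob_on a b"
    and eq: "\<And>k. cheb_moment a b k \<nu> = cheb_moment a b k \<mu>"
  shows "\<nu> = \<mu>"
proof (rule borel_prob_on_eqI[OF less_imp_le[OF ab] L])
  let ?f = "\<lambda>n k x. x ^ n * cos (real k * angle_of a b x)"
  have int: "integrable M (?f n k)" if "M \<in> borel_prob_on a b" for M n k
    by (rule borel_prob_on_integrable[OF that]) (intro continuous_intros angle_of_continuous[OF ab])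
  \<comment> \<open>For \<open>k = 0\<close> the lower neighbour is \<open>cos (- \<theta>) = cos \<theta>\<close>.\<close>
  have step: "(\<integral>x. ?f (Suc n) k x \<partial>M) = (a + b) / 2 * (\<integral>x. ?f n k x \<partial>M) +
      (b - a) / 4 * ((\<integral>x. ?f n (Suc k) x \<partial>M) + (\<integral>x. ?f n (if k = 0 then 1 else k - 1) x \<partial>M))"
    if M: "M \<in> borel_prob_on a b" for M n k
  proof -
    have "(\<integral>x. ?f (Suc n) k x \<partial>M) = (\<integral>x. (a + b) / 2 * ?f n k x + (b - a) / 4 * (?f n (Suc k) x + ?f n (if k = 0 then 1 else k - 1) x) \<partial>M)"
    proof (rule Bochner_Integration.integral_cong)
      fix x assume "x \<in> space M"
      then have x: "x \<in> {a..b}" using borel_prob_onD(3)[OF M] by simp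
      let ?t = "angle_of a b x"
      have xc: "x = (a + b) / 2 + (b - a) / 2 * cos ?t"
        unfolding cos_angle_of[OF ab x] using ab by (subst times_divide_eq_right, subst nonzero_mult_div_cancel_left) simp_all
      have cc: "cos ?t * cos (real k * ?t) = (cos (real (Suc k) * ?t) + cos (real (if k = 0 then 1 else k - 1) * ?t)) / 2"
      proof (cases k)
        case (Suc j)
        have e: "real (Suc k) * ?t = real k * ?t + ?t" "real (if k = 0 then 1 else k - 1) * ?t = real k * ?t - ?t"
          using Suc by (simp_all add: algebra_simps)
        show ?thesis unfolding e by (simp add: cos_add cos_diff)
      qed simp
      have "?f (Suc n) k x = x ^ n * (((a + b) / 2 + (b - a) / 2 * cos ?t) * cos (real k * ?t))"
        using xc by simp
      also have "\<dots> = x ^ n * ((a + b) / 2 * cos (real k * ?t) + (b - a) / 2 * (cos ?t * cos (real k * ?t)))"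
        by (simp add: algebra_simps)
      also have "\<dots> = (a + b) / 2 * ?f n k x + (b - a) / 4 * (?f n (Suc k) x + ?f n (if k = 0 then 1 else k - 1) x)"
        unfolding cc by (simp add: field_simps)
      finally show "?f (Suc n) k x = (a + b) / 2 * ?f n k x + (b - a) / 4 * (?f n (Suc k) x + ?f n (if k = 0 then 1 else k - 1) x)" .
    qed simp
    also have "\<dots> = (a + b) / 2 * (\<integral>x. ?f n k x \<partial>M) + (b - a) / 4 * ((\<integral>x. ?f n (Suc k) x \<partial>M) + (\<integral>x. ?f n (if k = 0 then 1 else k - 1) x \<partial>M))"
      by (simp only: integral_mult_right_zero Bochner_Integration.integral_add[OF integrable_mult_right[OF int[OF M]] integrable_mult_right[OF Bochner_Integration.integrable_add[OF int[OF M] int[OF M]]]]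
           Bochner_Integration.integral_add[OF int[OF M] int[OF M]])
    finally show ?thesis .
  qed
  have "(\<integral>x. ?f n k x \<partial>\<nu>) = (\<integral>x. ?f n k x \<partial>\<mu>)" for n k
  proof (induction n arbitrary: k)
    case 0
    then show ?case using eq[of k] by (simp add: cheb_moment_def)
  next
    case (Suc n)
    show ?case unfolding step[OF L(1)] step[OF L(2)] Suc ..
  qed
  from this[of _ 0] show "(\<integral>x. x ^ n \<partial>\<nu>) = (\<integral>x. x ^ n \<partial>\<mu>)" for n by simp
qed

section \<open>The equilibrium measure\<close>

text \<open>Finiteness of the nonnegative double integral already forces the diagonal, where the kernel is
  infinite, to be a null set.\<close>

lemma log_integrable_of_kernel:
  assumes ab: "a < b" and L: "L1 \<in> borel_prob_on a b" "L2 \<in> borel_prob_on a b"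
    and fin: "(\<integral>\<^sup>+s. \<integral>\<^sup>+t. log_energy_kernel a b t s \<partial>L2 \<partial>L1) \<noteq> \<top>"
  shows "log_integrable L1 L2"
    and "(\<integral>\<^sup>+s. \<integral>\<^sup>+t. log_energy_kernel a b t s \<partial>L2 \<partial>L1) = ennreal (ln (b - a) - mutual_log L1 L2)"
    and "0 \<le> ln (b - a) - mutual_log L1 L2"
proof -
  interpret pair_prob_space L1 L2 by (rule pair_prob[OF L])
  let ?N = "L1 \<Otimes>\<^sub>M L2" and ?k = "\<lambda>p. log_energy_kernel a b (snd p) (fst p)"
  let ?g = "\<lambda>p. ln (b - a) - ln \<bar>fst p - snd p\<bar>"
  have km: "?k \<in> borel_measurable ?N"
    by (rule log_energy_kernel_measurable[OF pair_coord_measurable(2)[OF L] pair_coord_measurable(1)[OF L]])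
  have eq: "(\<integral>\<^sup>+s. \<integral>\<^sup>+t. log_energy_kernel a b t s \<partial>L2 \<partial>L1) = (\<integral>\<^sup>+p. ?k p \<partial>?N)"
    using M2.nn_integral_fst[OF km] by simp
  have ne: "AE p in ?N. ?k p \<noteq> \<infinity>"
    using fin unfolding eq by (intro nn_integral_noteq_infinite[OF km]) simp
  have ne: "AE p in ?N. fst p \<noteq> snd p"
    using ne by eventually_elim (use log_energy_kernel_diag in force)
  have sp: "AE p in ?N. fst p \<in> {a..b} \<and> snd p \<in> {a..b}"
    by (rule AE_I2) (auto simp: space_pair_measure borel_prob_onD(3)[OF L(1)] borel_prob_onD(3)[OF L(2)])
  have gm: "?g \<in> borel_measurable ?N" "(\<lambda>p. ln \<bar>fst p - snd p\<bar>) \<in> borel_measurable ?N"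
    using pair_coord_measurable[OF L] by measurable
  have nn: "AE p in ?N. 0 \<le> ?g p"
    using ne sp
  proof eventually_elim
    fix p assume p: "fst p \<noteq> snd p" "fst p \<in> {a..b} \<and> snd p \<in> {a..b}"
    then have "ln \<bar>fst p - snd p\<bar> \<le> ln (b - a)" by (subst ln_le_cancel_iff) auto
    then show "0 \<le> ?g p" by simp
  qed
  have kg: "(\<integral>\<^sup>+p. ?k p \<partial>?N) = (\<integral>\<^sup>+p. ennreal (?g p) \<partial>?N)"
  proof (rule nn_integral_cong_AE)
    show "AE p in ?N. ?k p = ennreal (?g p)"
      using ne
    proof eventually_elim
      fix p :: "real \<times> real" assume "fst p \<noteq> snd p"
      then show "?k p = ennreal (?g p)"
        using log_energy_kernel_off[of "snd p" "fst p" a b] by (simp add: abs_minus_commute)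
    qed
  qed
  have gi: "integrable ?N ?g"
    using fin unfolding eq kg by (intro integrableI_nonneg[OF gm(1) nn]) (simp add: top.not_eq_extremum)
  have "integrable ?N (\<lambda>p. ln (b - a) - ?g p)" by (intro Bochner_Integration.integrable_diff gi) simp
  then have li: "integrable ?N (\<lambda>p. ln \<bar>fst p - snd p\<bar>)" by simp
  then show "log_integrable L1 L2" using ne by (simp add: log_integrable_def)
  have ig: "(\<integral>p. ?g p \<partial>?N) = ln (b - a) - mutual_log L1 L2"
    using li by (simp add: mutual_log_def P.prob_space)
  show "(\<integral>\<^sup>+s. \<integral>\<^sup>+t. log_energy_kernel a b t s \<partial>L2 \<partial>L1) = ennreal (ln (b - a) - mutual_log L1 L2)"
    unfolding eq kg nn_integral_eq_integral[OF gi nn] ig ..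
  show "0 \<le> ln (b - a) - mutual_log L1 L2"
    unfolding ig[symmetric] by (rule integral_nonneg_AE[OF nn])
qed

text \<open>An atom of \<open>\<nu>\<close> would give the diagonal positive mass.\<close>

lemma log_integrable_no_atoms:
  assumes L: "\<nu> \<in> borel_prob_on a b" and li: "log_integrable \<nu> \<nu>"
  shows "AE t in \<nu>. t \<noteq> c"
proof (rule ccontr)
  interpret pair_prob_space \<nu> \<nu> by (rule pair_prob[OF L L])
  assume c: "\<not> (AE t in \<nu>. t \<noteq> c)"
  have "AE p in \<nu> \<Otimes>\<^sub>M \<nu>. fst p \<noteq> snd p" using li by (simp add: log_integrable_def)
  from AE_pair[OF this] have "AE x in \<nu>. AE y in \<nu>. x \<noteq> y" by simp
  then have "AE x in \<nu>. x \<noteq> c"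
  proof eventually_elim
    fix x assume x: "AE y in \<nu>. x \<noteq> y"
    show "x \<noteq> c"
    proof
      assume "x = c"
      with x have "AE y in \<nu>. y \<noteq> c" by (simp add: eq_commute)
      then show False using c by blast
    qed
  qed
  then show False using c by blast
qed

context jacobi_noatom
begin

text \<open>Adding this constant makes the field nonnegative on \<open>[a,b]\<close>.\<close>

definition field_shift :: real where "field_shift = (al + be) * ln (b - a)"

lemma ext_field_inside: "a < t \<Longrightarrow> t < b \<Longrightarrow> ext_field a b p1 p2 t = ereal (field t)"
  by (simp add: ext_field_def elog_def field_def al_def be_def algebra_simps)

lemma ext_field_ge:
  assumes "t \<in> {a..b}"
  shows "ereal (- field_shift) \<le> ext_field a b p1 p2 t"
proof -
  have "ereal al * elog (t - a) \<le> ereal al * ereal (ln (b - a))"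
    by (rule ereal_mult_left_mono[OF elog_le]) (use assms al_be_nonneg in auto)
  moreover have "ereal be * elog (b - t) \<le> ereal be * ereal (ln (b - a))"
    by (rule ereal_mult_left_mono[OF elog_le]) (use assms al_be_nonneg in auto)
  moreover have "ereal (- (x + y)) \<le> - u - v" if "u \<le> ereal x" "v \<le> ereal y" for x y u v
    using that by (cases u; cases v) auto
  ultimately have "ereal (- (al * ln (b - a) + be * ln (b - a))) \<le> - (ereal al * elog (t - a)) - ereal be * elog (b - t)"
    by simp
  then show ?thesis by (simp add: ext_field_def field_shift_def al_def be_def distrib_right)
qed

lemma ext_field_measurable: "ext_field a b p1 p2 \<in> borel_measurable borel"
proof -
  have "(\<lambda>t. elog (t - a)) \<in> borel_measurable borel" "(\<lambda>t. elog (b - t)) \<in> borel_measurable borel"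
    by (rule measurable_compose[OF _ elog_measurable], measurable)+
  then show ?thesis unfolding ext_field_def by measurable
qed

lemma field_measurable: "field \<in> borel_measurable borel"
  unfolding field_def by measurable

definition shifted_energy :: "real measure \<Rightarrow> ennreal" where
  "shifted_energy \<nu> = (\<integral>\<^sup>+t. e2ennreal (ext_field a b p1 p2 t + ereal field_shift) \<partial>\<nu>) +
     (\<integral>\<^sup>+s. \<integral>\<^sup>+t. log_energy_kernel a b t s \<partial>\<nu> \<partial>\<nu>)"

lemma energy_shifted:
  "\<nu> \<in> borel_prob_on a b \<Longrightarrow> energy (ext_field a b p1 p2) \<nu> = enn2ereal (shifted_energy \<nu>) - ereal (field_shift + ln (b - a))"
  unfolding shifted_energy_def by (rule energy_eq[OF ab _ ext_field_measurable ext_field_ge])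

text \<open>Measures of finite energy have no atoms, so the extended field agrees with the real-valued one
  almost everywhere and all integrals become real.\<close>

lemma finite_energy:
  assumes \<nu>: "\<nu> \<in> borel_prob_on a b" and fin: "shifted_energy \<nu> \<noteq> \<top>"
  shows "log_integrable \<nu> \<nu>" and "integrable \<nu> field"
    and "shifted_energy \<nu> = ennreal ((\<integral>t. field t \<partial>\<nu>) + field_shift + ln (b - a) - mutual_log \<nu> \<nu>)"
    and "0 \<le> (\<integral>t. field t \<partial>\<nu>) + field_shift + ln (b - a) - mutual_log \<nu> \<nu>"
proof -
  interpret prob_space \<nu> by (rule borel_prob_onD[OF \<nu>])
  have f: "(\<integral>\<^sup>+t. e2ennreal (ext_field a b p1 p2 t + ereal field_shift) \<partial>\<nu>) \<noteq> \<top>"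
    "(\<integral>\<^sup>+s. \<integral>\<^sup>+t. log_energy_kernel a b t s \<partial>\<nu> \<partial>\<nu>) \<noteq> \<top>"
    using fin by (auto simp: shifted_energy_def)
  note k = log_integrable_of_kernel[OF ab \<nu> \<nu> f(2)]
  show li: "log_integrable \<nu> \<nu>" by (rule k)
  have inside: "AE t in \<nu>. t \<in> {a<..<b}"
    using log_integrable_no_atoms[OF \<nu> li, of a] log_integrable_no_atoms[OF \<nu> li, of b] AE_space
    by eventually_elim (auto simp: borel_prob_onD(3)[OF \<nu>])
  have fm: "(\<lambda>t. field t + field_shift) \<in> borel_measurable \<nu>"
    by (rule borel_prob_on_measurable[OF \<nu>]) (use field_measurable in measurable)
  have nn: "AE t in \<nu>. 0 \<le> field t + field_shift"
    using inside
  proof eventually_elim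
    fix t assume t: "t \<in> {a<..<b}"
    then show "0 \<le> field t + field_shift" using ext_field_ge[of t] ext_field_inside[of t] by auto
  qed
  have e: "(\<integral>\<^sup>+t. e2ennreal (ext_field a b p1 p2 t + ereal field_shift) \<partial>\<nu>) = (\<integral>\<^sup>+t. ennreal (field t + field_shift) \<partial>\<nu>)"
  proof (rule nn_integral_cong_AE)
    show "AE t in \<nu>. e2ennreal (ext_field a b p1 p2 t + ereal field_shift) = ennreal (field t + field_shift)"
      using inside by eventually_elim (simp add: ext_field_inside e2ennreal_ereal)
  qed
  have int: "integrable \<nu> (\<lambda>t. field t + field_shift)"
    using f(1) unfolding e by (intro integrableI_nonneg[OF fm nn]) (simp add: top.not_eq_extremum)
  have "integrable \<nu> (\<lambda>t. (field t + field_shift) - field_shift)" by (intro Bochner_Integration.integrable_diff int) simp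
  then show fi: "integrable \<nu> field" by simp
  have "(\<integral>t. field t + field_shift \<partial>\<nu>) = (\<integral>t. field t \<partial>\<nu>) + field_shift"
    using fi by (simp add: prob_space)
  moreover have "0 \<le> (\<integral>t. field t + field_shift \<partial>\<nu>)" by (rule integral_nonneg_AE[OF nn])
  ultimately have F: "(\<integral>\<^sup>+t. ennreal (field t + field_shift) \<partial>\<nu>) = ennreal ((\<integral>t. field t \<partial>\<nu>) + field_shift)"
    "0 \<le> (\<integral>t. field t \<partial>\<nu>) + field_shift"
    using nn_integral_eq_integral[OF int nn] by simp_all
  show "0 \<le> (\<integral>t. field t \<partial>\<nu>) + field_shift + ln (b - a) - mutual_log \<nu> \<nu>"
    using F(2) k(3) by simp
  have "shifted_energy \<nu> = ennreal ((\<integral>t. field t \<partial>\<nu>) + field_shift + (ln (b - a) - mutual_log \<nu> \<nu>))"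
    unfolding shifted_energy_def e F(1) k(2) by (rule ennreal_plus[OF F(2) k(3), symmetric])
  then show "shifted_energy \<nu> = ennreal ((\<integral>t. field t \<partial>\<nu>) + field_shift + ln (b - a) - mutual_log \<nu> \<nu>)"
    by (simp add: algebra_simps)
qed

lemma mu_AE_ne: "AE s in \<mu>. s \<noteq> c"
proof -
  have "AE t in angle_law. xang t \<noteq> c"
    using angle_AE_ne[of "arccos ((wA + wB - (c - a) / (b - a)) / (2 * rad))"]
  proof eventually_elim
    fix t assume t: "t \<in> {0..pi} \<and> t \<noteq> arccos ((wA + wB - (c - a) / (b - a)) / (2 * rad))"
    show "xang t \<noteq> c"
    proof
      assume "xang t = c"
      then have "(wA + wB - (c - a) / (b - a)) / (2 * rad) = cos t"
        using ab rad_pos by (auto simp: xang_def uang_def rad_def[symmetric])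
      then show False using t arccos_cos[of t] by auto
    qed
  qed
  then show ?thesis
    unfolding mu_eq_distr using xang_measurable_law
    by (subst AE_distr_iff) (auto simp: space_restrict_space sets_restrict_space Collect_conj_eq intro!: image_eqI[of _ _ "- {c}"])
qed

lemma kernel_potential:
  assumes s: "s \<in> {a..b}" "s \<notin> exceptional"
  shows "(\<integral>\<^sup>+t. log_energy_kernel a b t s \<partial>\<mu>) = ennreal (ln (b - a) + pot s)"
    and "0 \<le> ln (b - a) + pot s"
proof -
  interpret mu: prob_space \<mu> by (rule borel_prob_onD[OF mu_lim_in])
  have i: "integrable \<mu> (\<lambda>t. ln \<bar>s - t\<bar>)" by (rule potential[OF s])
  have nn: "AE t in \<mu>. 0 \<le> ln (b - a) - ln \<bar>s - t\<bar>"
    using mu_AE_ne[of s] AE_space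
  proof eventually_elim
    fix t assume t: "t \<noteq> s" "t \<in> space \<mu>"
    then have "t \<in> {a..b}" using borel_prob_onD(3)[OF mu_lim_in] by simp
    then have "ln \<bar>s - t\<bar> \<le> ln (b - a)" using t s by (subst ln_le_cancel_iff) auto
    then show "0 \<le> ln (b - a) - ln \<bar>s - t\<bar>" by simp
  qed
  have I: "(\<integral>t. ln (b - a) - ln \<bar>s - t\<bar> \<partial>\<mu>) = ln (b - a) + pot s"
    using i by (simp add: pot_def mu.prob_space)
  have "(\<integral>\<^sup>+t. log_energy_kernel a b t s \<partial>\<mu>) = (\<integral>\<^sup>+t. ennreal (ln (b - a) - ln \<bar>s - t\<bar>) \<partial>\<mu>)"
  proof (rule nn_integral_cong_AE)
    show "AE t in \<mu>. log_energy_kernel a b t s = ennreal (ln (b - a) - ln \<bar>s - t\<bar>)"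
      using mu_AE_ne[of s] by eventually_elim (simp add: log_energy_kernel_off abs_minus_commute)
  qed
  also have "\<dots> = ennreal (ln (b - a) + pot s)"
    using nn_integral_eq_integral[OF _ nn] i I by simp
  finally show "(\<integral>\<^sup>+t. log_energy_kernel a b t s \<partial>\<mu>) = ennreal (ln (b - a) + pot s)" .
  show "0 \<le> ln (b - a) + pot s" unfolding I[symmetric] by (rule integral_nonneg_AE[OF nn])
qed

text \<open>The potential of the limit measure is bounded above off the exceptional set, so it has finite mutual
  energy with every measure that does not charge that set.\<close>

lemma kernel_potential_finite:
  assumes \<nu>: "\<nu> \<in> borel_prob_on a b" and ne: "AE t in \<nu>. t \<notin> exceptional"
  shows "(\<integral>\<^sup>+s. \<integral>\<^sup>+t. log_energy_kernel a b t s \<partial>\<mu> \<partial>\<nu>) \<noteq> \<top>"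
proof -
  interpret prob_space \<nu> by (rule borel_prob_onD[OF \<nu>])
  have "(\<integral>\<^sup>+s. \<integral>\<^sup>+t. log_energy_kernel a b t s \<partial>\<mu> \<partial>\<nu>) \<le> (\<integral>\<^sup>+s. ennreal (ln (b - a) + pot_bound) \<partial>\<nu>)"
  proof (rule nn_integral_mono_AE)
    show "AE s in \<nu>. (\<integral>\<^sup>+t. log_energy_kernel a b t s \<partial>\<mu>) \<le> ennreal (ln (b - a) + pot_bound)"
      using ne AE_space
    proof eventually_elim
      fix s assume "s \<notin> exceptional" "s \<in> space \<nu>"
      then have s: "s \<in> {a..b}" "s \<notin> exceptional" using borel_prob_onD(3)[OF \<nu>] by auto
      show "(\<integral>\<^sup>+t. log_energy_kernel a b t s \<partial>\<mu>) \<le> ennreal (ln (b - a) + pot_bound)"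
        unfolding kernel_potential(1)[OF s] by (intro ennreal_leI) (use potential(2)[OF s] in simp)
    qed
  qed
  also have "\<dots> < \<top>" by (simp add: emeasure_space_1)
  finally show ?thesis by simp
qed

lemma mutual_log_pot:
  assumes \<nu>: "\<nu> \<in> borel_prob_on a b" and li: "log_integrable \<nu> \<mu>"
  shows "integrable \<nu> pot" and "mutual_log \<nu> \<mu> = - (\<integral>t. pot t \<partial>\<nu>)"
proof -
  interpret pair_prob_space \<nu> \<mu> by (rule pair_prob[OF \<nu> mu_lim_in])
  have i: "integrable (\<nu> \<Otimes>\<^sub>M \<mu>) (\<lambda>p. ln \<bar>fst p - snd p\<bar>)" using li by (simp add: log_integrable_def)
  from integrable_fst'[OF i] have "integrable \<nu> (\<lambda>t. \<integral>s. ln \<bar>t - s\<bar> \<partial>\<mu>)" by simp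
  then show "integrable \<nu> pot" unfolding pot_def by simp
  from integral_fst'[OF i] show "mutual_log \<nu> \<mu> = - (\<integral>t. pot t \<partial>\<nu>)" by (simp add: mutual_log_def pot_def)
qed

text \<open>By the Euler-Lagrange equality the field is bounded almost everywhere on the support, since the
  potential is bounded below on \<open>[a,b]\<close>.\<close>

lemma mu_energy_finite: "shifted_energy \<mu> \<noteq> \<top>"
proof -
  interpret mu: prob_space \<mu> by (rule borel_prob_onD[OF mu_lim_in])
  have "AE t in \<mu>. t \<notin> exceptional" using potential_AE by eventually_elim blast
  then have 1: "(\<integral>\<^sup>+s. \<integral>\<^sup>+t. log_energy_kernel a b t s \<partial>\<mu> \<partial>\<mu>) \<noteq> \<top>" by (rule kernel_potential_finite[OF mu_lim_in])
  have "(\<integral>\<^sup>+t. e2ennreal (ext_field a b p1 p2 t + ereal field_shift) \<partial>\<mu>) \<le> (\<integral>\<^sup>+t. ennreal (robin + 2 * ln (b - a) + field_shift) \<partial>\<mu>)"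
  proof (rule nn_integral_mono_AE)
    show "AE t in \<mu>. e2ennreal (ext_field a b p1 p2 t + ereal field_shift) \<le> ennreal (robin + 2 * ln (b - a) + field_shift)"
      using potential_AE
    proof eventually_elim
      fix t assume t: "t \<in> {a..b} \<and> t \<notin> exceptional \<and> 2 * pot t + field t = robin"
      then have "a < t" "t < b" by (auto simp: exceptional_def)
      moreover have "field t \<le> robin + 2 * ln (b - a)" using kernel_potential(2)[of t] t by simp
      ultimately show "e2ennreal (ext_field a b p1 p2 t + ereal field_shift) \<le> ennreal (robin + 2 * ln (b - a) + field_shift)"
        by (simp add: ext_field_inside e2ennreal_ereal ennreal_leI)
    qed
  qed
  also have "\<dots> < \<top>" by (simp add: mu.emeasure_space_1)
  finally show ?thesis using 1 by (simp add: shifted_energy_def)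
qed

text \<open>The energy of \<open>\<nu>\<close> minus that of \<open>\<mu>\<close> is the logarithmic energy of \<open>\<nu> - \<mu>\<close> plus the integral of
  \<open>2 * pot + field\<close> against \<open>\<nu> - \<mu>\<close>. The second term is nonnegative by the Euler-Lagrange
  conditions, the first one controls all Chebyshev moments.\<close>

theorem energy_minimizer_unique:
  assumes \<nu>: "\<nu> \<in> borel_prob_on a b"
    and le: "energy (ext_field a b p1 p2) \<nu> \<le> energy (ext_field a b p1 p2) \<mu>"
  shows "\<nu> = \<mu>"
proof -
  interpret prob_space \<nu> by (rule borel_prob_onD[OF \<nu>])
  interpret mu: prob_space \<mu> by (rule borel_prob_onD[OF mu_lim_in])
  have "x \<le> y" if "enn2ereal x - ereal c \<le> enn2ereal y - ereal c" for x y c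
    using that by (cases x; cases y) (auto simp: enn2ereal_ennreal)
  then have sle: "shifted_energy \<nu> \<le> shifted_energy \<mu>"
    using le unfolding energy_shifted[OF \<nu>] energy_shifted[OF mu_lim_in] by blast
  then have "shifted_energy \<nu> \<noteq> \<top>" using mu_energy_finite by (metis top.extremum_uniqueI)
  note fn = finite_energy[OF \<nu> this] and fm = finite_energy[OF mu_lim_in mu_energy_finite]
  \<comment> \<open>The hypothesis on the energies in real form.\<close>
  have A: "(\<integral>t. field t \<partial>\<nu>) - mutual_log \<nu> \<nu> \<le> (\<integral>t. field t \<partial>\<mu>) - mutual_log \<mu> \<mu>"
    using sle fm(4) unfolding fn(3) fm(3) by (simp add: ennreal_le_iff)
  have ne: "AE t in \<nu>. t \<notin> exceptional"
    using log_integrable_no_atoms[OF \<nu> fn(1), of a] log_integrable_no_atoms[OF \<nu> fn(1), of b]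
      log_integrable_no_atoms[OF \<nu> fn(1), of "xang 0"] log_integrable_no_atoms[OF \<nu> fn(1), of "xang pi"]
    by eventually_elim (simp add: exceptional_def)
  have lnm: "log_integrable \<nu> \<mu>"
    by (rule log_integrable_of_kernel(1)[OF ab \<nu> mu_lim_in kernel_potential_finite[OF \<nu> ne]])
  note pn = mutual_log_pot[OF \<nu> lnm] and pm = mutual_log_pot[OF mu_lim_in fm(1)]
  \<comment> \<open>The Euler-Lagrange inequality integrated against \<open>\<nu>\<close>, then the equality integrated against
    \<open>\<mu>\<close>.\<close>
  have "robin = (\<integral>t. robin \<partial>\<nu>)" by (simp add: prob_space)
  also have "\<dots> \<le> (\<integral>t. 2 * pot t + field t \<partial>\<nu>)"
  proof (rule integral_mono_AE)
    show "AE t in \<nu>. robin \<le> 2 * pot t + field t"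
      using ne AE_space by eventually_elim (use potential(3) borel_prob_onD(3)[OF \<nu>] in auto)
  qed (use pn(1) fn(2) in simp_all)
  also have "\<dots> = 2 * (\<integral>t. pot t \<partial>\<nu>) + (\<integral>t. field t \<partial>\<nu>)" using pn(1) fn(2) by simp
  finally have B: "robin \<le> 2 * (\<integral>t. pot t \<partial>\<nu>) + (\<integral>t. field t \<partial>\<nu>)" .
  have "AE t in \<mu>. 2 * pot t + field t = robin" using potential_AE by eventually_elim blast
  then have "(\<integral>t. 2 * pot t + field t \<partial>\<mu>) = (\<integral>t. robin \<partial>\<mu>)"
    using pm(1) fm(2) by (intro integral_cong_AE) auto
  then have C: "2 * (\<integral>t. pot t \<partial>\<mu>) + (\<integral>t. field t \<partial>\<mu>) = robin" using pm(1) fm(2) by (simp add: mu.prob_space)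
  \<comment> \<open>The squared logarithmic norm of \<open>\<nu> - \<mu>\<close>.\<close>
  have D: "2 * mutual_log \<nu> \<mu> - mutual_log \<nu> \<nu> - mutual_log \<mu> \<mu> \<le> 0"
    using A B C pn(2) pm(2) by linarith
  have "cheb_moment a b k \<nu> = cheb_moment a b k \<mu>" for k
  proof (cases "k = 0")
    case True
    then show ?thesis by (simp add: cheb_moment_def prob_space mu.prob_space)
  next
    case False
    have "2 / real k * (cheb_moment a b k \<nu> - cheb_moment a b k \<mu>)\<^sup>2 \<le> 0"
      using log_energy_positive[OF ab \<nu> mu_lim_in fn(1) lnm fm(1), of k] D by linarith
    then have "(cheb_moment a b k \<nu> - cheb_moment a b k \<mu>)\<^sup>2 \<le> 0" using False by (simp add: mult_le_0_iff field_simps)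
    then show ?thesis by simp
  qed
  then show ?thesis by (rule cheb_moments_determine[OF ab \<nu> mu_lim_in])
qed

theorem equilibrium: "is_equilibrium_measure a b (ext_field a b p1 p2) \<mu>"
  unfolding is_equilibrium_measure_def unique_minimizer_def is_arg_min_def
proof (intro allI iffI)
  fix \<nu> assume \<nu>: "\<nu> \<in> borel_prob_on a b \<and> (\<nexists>y. y \<in> borel_prob_on a b \<and> energy (ext_field a b p1 p2) y < energy (ext_field a b p1 p2) \<nu>)"
  then have "\<not> energy (ext_field a b p1 p2) \<mu> < energy (ext_field a b p1 p2) \<nu>" using mu_lim_in by blast
  then have "energy (ext_field a b p1 p2) \<nu> \<le> energy (ext_field a b p1 p2) \<mu>" by (rule leI)
  then show "\<nu> = \<mu>" using energy_minimizer_unique \<nu> by blast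
next
  fix \<nu> assume \<nu>: "\<nu> = \<mu>"
  have "\<not> energy (ext_field a b p1 p2) y < energy (ext_field a b p1 p2) \<mu>" if "y \<in> borel_prob_on a b" for y
  proof
    assume l: "energy (ext_field a b p1 p2) y < energy (ext_field a b p1 p2) \<mu>"
    have "y = \<mu>" by (rule energy_minimizer_unique[OF that less_imp_le[OF l]])
    then show False using l by simp
  qed
  then show "\<nu> \<in> borel_prob_on a b \<and> (\<nexists>y. y \<in> borel_prob_on a b \<and> energy (ext_field a b p1 p2) y < energy (ext_field a b p1 p2) \<nu>)"
    unfolding \<nu> using mu_lim_in by blast
qed

end

text \<open>The positive parts in the weights of the atoms vanish exactly when these inequalities hold.\<close>

lemma (in jacobi_law) no_atoms_parameters:
  assumes "\<forall>x\<in>{a..b}. emeasure (mu_lim a b p1 p2) {x} = 0"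
  shows "p2 \<le> p1" "p1 + p2 \<le> 1"
proof -
  have s: "{x} \<in> sets (mu_lim a b p1 p2)" if "x \<in> {a..b}" for x
    unfolding borel_prob_onD(2)[OF mu_lim_in] sets_restrict_space
    by (rule image_eqI[where x="{x}"]) (use that in simp_all)
  have 0: "ennreal atom_a * indicator {x} a + ennreal atom_b * indicator {x} b = 0" if x: "x \<in> {a..b}" for x
  proof -
    have "(\<integral>\<^sup>+t. indicator {x} t \<partial>mu_lim a b p1 p2) = 0"
      using assms x by (simp add: nn_integral_indicator[OF s[OF x]])
    then show ?thesis using nn_integral_mu_lim[of "indicator {x}"] by simp
  qed
  have "atom_a \<le> 0" using 0[of a] ab atoms_nonneg by simp
  then show "p2 \<le> p1" using p2 by (simp add: atom_a_def field_simps)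
  have "atom_b \<le> 0" using 0[of b] ab atoms_nonneg by simp
  then show "p1 + p2 \<le> 1" using p2 by (simp add: atom_b_def field_simps)
qed

theorem theorem2p1:
  fixes a b p1 p2 :: real
    and V1 V2 :: "real \<Rightarrow> real"
    and \<Omega> :: "'w measure"
    and X :: "nat \<Rightarrow> 'w \<Rightarrow> nat \<Rightarrow> real"
  assumes "a < b"
    and "C2_on_unit V1" and "continuous_on {0..1} V1"
    and "C2_on_unit V2" and "continuous_on {0..1} V2"
    and "p1 \<in> {0<..<1}" and "p2 \<in> {0<..<1}"
  shows
    "(unique_minimizer (W_of V1) {0<..<1} p1 \<and> unique_minimizer (W_of V2) {0<..<1} p2 \<and>
      prob_space \<Omega> \<and>
      (\<forall>n\<ge>1. X n \<in> measurable \<Omega> (Rn_leb n) \<and>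
             distr \<Omega> (Rn_leb n) (X n) = moment_ensemble n a b V1 V2)
      \<longrightarrow>
      mu_lim a b p1 p2 \<in> borel_prob_on a b \<and>
      (\<forall>k\<ge>1.
         (AE \<omega> in \<Omega>. \<forall>j\<in>{1..k}.
            (\<lambda>n. X n \<omega> j) \<longlonglongrightarrow> moment j (mu_lim a b p1 p2)) \<and>
         (\<forall>n\<ge>k. integrable \<Omega>
            (\<lambda>\<omega>. L2_set (\<lambda>j. X n \<omega> j - moment j (mu_lim a b p1 p2)) {1..k})) \<and>
         (\<lambda>n. \<integral>\<omega>. L2_set (\<lambda>j. X n \<omega> j - moment j (mu_lim a b p1 p2)) {1..k} \<partial>\<Omega>)
            \<longlonglongrightarrow> 0))
     \<and>
     ((\<forall>x\<in>{a..b}. emeasure (mu_lim a b p1 p2) {x} = 0) \<longrightarrow>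
      is_equilibrium_measure a b (ext_field a b p1 p2) (mu_lim a b p1 p2))"
proof -
  interpret jacobi_law a b p1 p2
    by unfold_locales (use assms in auto)
  have "is_equilibrium_measure a b (ext_field a b p1 p2) (mu_lim a b p1 p2)"
    if "\<forall>x\<in>{a..b}. emeasure (mu_lim a b p1 p2) {x} = 0"
  proof -
    interpret jacobi_noatom a b p1 p2
      by unfold_locales (use no_atoms_parameters[OF that] in auto)
    show ?thesis by (rule equilibrium)
  qed
  moreover have "mu_lim a b p1 p2 \<in> borel_prob_on a b" by (rule mu_lim_in)
  moreover note random_moments_converge[OF assms(1) assms(3) assms(5) _ _ _ _ _ moment_mu_lim, of \<Omega> X]
  ultimately show ?thesis by (intro conjI impI allI) (elim conjE; blast)+
qed

end
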